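(* Let $\Sigma_0$ and $\Sigma_1$ be spacelike slices in the sub-extremal Reissner-Nordström spacetime ($0<e<m$) as described in the context. Then there exists a sequence $\{u_i\}_{i\in\mathbb{N}}$ of solutions to the wave equation $\Box_gu_i=0$ with initial energy $E_0^{n_{\Sigma_0}}(u_i)=1$ on $\Sigma_0$ such that the $n_{\Sigma_1}$-energy on $\Sigma_1$ goes to infinity, i.e. $E_1^{n_{\Sigma_1}}(u_i)\to\infty$ for $i\to\infty$.
   Context: Spacetime. Let $0<e<m$, $D(r)=1-\frac{2m}r+\frac{e^2}{r^2}$, with roots $r_\pm=m\pm\sqrt{m^2-e^2}$. The Reissner-Nordström exterior (region $I$) is $\mathbb{R}\times(r_+,\infty)\times\mathbb{S}^2$ with $g=-D\,dt^2+D^{-1}dr^2+r^2d\theta^2+r^2\sin^2\theta\,d\varphi^2$. One considers its maximal analytic extension. Put $v=t+r_I^*$ in $I$, $\frac{dr_I^*}{dr}=\frac1D$; the coordinates $(v,r,\theta,\varphi)$, $r\in(0,\infty)$, with metric $g=-D\,dv^2+dv\otimes dr+dr\otimes dv+r^2d\theta^2+r^2\sin^2\theta\,d\varphi^2$ cover region $I$ ($r>r_+$), region $II$ ($r_-<r<r_+$, part of the black hole interior) and region $III$ ($0<r<r_-$), with $-\partial_r|_v$ future directed. In $II$ let $\frac{dr_{II}^*}{dr}=\frac1D$, $t=v-r_{II}^*$, $u=t-r_{II}^*$; the coordinates $(u,r,\theta,\varphi)$, with $g=-D\,du^2-du\otimes dr-dr\otimes du+r^2d\theta^2+r^2\sin^2\theta\,d\varphi^2$,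 cover region $II$ and another region $IV$ ($0<r<r_-$). The event horizon is $r=r_+$; the future Cauchy horizon of $\Sigma_0$ is $r=r_-$ and has two components: $\{r=r_-\}$ in the $v$-chart (between $II$ and $III$) and $\{r=r_-\}$ in the $u$-chart (between $II$ and $IV$, where $v\to\infty$; it is the one adjacent to future timelike infinity $i^+$ of $I$). Slices (both represented by curves in the Penrose diagram). $\Sigma_0$ is a spacelike Cauchy hypersurface of the globally hyperbolic diamond shaped region consisting of region $I$, the second exterior region, the region $II$, the corresponding white hole region and the horizons $r=r_+$ between them (i.e. without regions $III$, $IV$), and asymptotes to a hypersurface of constant $t$ at spatial infinity $i^0$. $\Sigma_1$ is a spacelike slice contained in region $II$, to the future of $\Sigma_0$, running between the two components of the Cauchy horizon, which is extendible as a smooth spacelike slice across the Cauchy horizon into the neighbouring regions $III$ and $IV$. Energy. $n_{\Sigma_j}$ is the future directed unit normal of $\Sigma_j$. $\mathbb{T}(u)=\frac12\overline{du}\otimes du+\frac12du\otimes\overline{du}-\frac12g\,g^{-1}(du,\overline{du})$ and $E_j^{n_{\Sigma_j}}(u)=\int_{\Sigma_j}\mathbb{T}(u)(n_{\Sigma_j},n_{\Sigma_j})\,\mathrm{vol}_{\Sigma_j}$, with the induced volume, $j=0,1$. Solutions are smooth functions on the domain of dependence of $\Sigma_0$. *)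

theory Defs
  imports "HOL-Analysis.Analysis"
begin

section \<open>Smooth functions and coordinate expressions\<close>

primrec Ck_on :: "nat \<Rightarrow> 'a::real_normed_vector set \<Rightarrow> ('a \<Rightarrow> 'b::real_normed_vector) \<Rightarrow> bool" where
  "Ck_on 0 S f \<longleftrightarrow> continuous_on S f"
| "Ck_on (Suc k) S f \<longleftrightarrow>
     (\<forall>x\<in>S. f differentiable at x) \<and> (\<forall>v. Ck_on k S (\<lambda>x. frechet_derivative f (at x) v))"

text \<open>To be used for open \<^term>\<open>S\<close> only.\<close>

definition smooth_on :: "'a::real_normed_vector set \<Rightarrow> ('a \<Rightarrow> 'b::real_normed_vector) \<Rightarrow> bool" where
  "smooth_on S f \<longleftrightarrow> (\<forall>k. Ck_on k S f)"

definition pderiv_at :: "(real^'n \<Rightarrow> 'b::real_normed_vector) \<Rightarrow> 'n \<Rightarrow> real^'n \<Rightarrow> 'b" where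
  "pderiv_at f i x = vector_derivative (\<lambda>h. f (x + h *\<^sub>R axis i 1)) (at 0)"

definition pullback_metric ::
  "('p::real_normed_vector \<Rightarrow> 'p \<Rightarrow> 'p \<Rightarrow> real) \<Rightarrow> (real^'n \<Rightarrow> 'p) \<Rightarrow> real^'n \<Rightarrow> real^'n^'n" where
  "pullback_metric g f x = (\<chi> i j. g (f x) (pderiv_at f i x) (pderiv_at f j x))"

definition bilin :: "(real^'n \<Rightarrow> real^'n^'n) \<Rightarrow> real^'n \<Rightarrow> real^'n \<Rightarrow> real^'n \<Rightarrow> real" where
  "bilin G x X Y = X \<bullet> (G x *v Y)"

definition dalembertian :: "(real^'n \<Rightarrow> real^'n^'n) \<Rightarrow> (real^'n \<Rightarrow> complex) \<Rightarrow> real^'n \<Rightarrow> complex" where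
  "dalembertian G w x =
     (1 / sqrt \<bar>det (G x)\<bar>) *\<^sub>R
       (\<Sum>i\<in>UNIV. pderiv_at
          (\<lambda>y. sqrt \<bar>det (G y)\<bar> *\<^sub>R (\<Sum>j\<in>UNIV. (matrix_inv (G y) $ i $ j) *\<^sub>R pderiv_at w j y)) i x)"

definition differential :: "(real^'n \<Rightarrow> complex) \<Rightarrow> real^'n \<Rightarrow> real^'n \<Rightarrow> complex" where
  "differential w x X = (\<Sum>i\<in>UNIV. (X $ i) *\<^sub>R pderiv_at w i x)"

definition stress_energy ::
  "(real^'n \<Rightarrow> real^'n^'n) \<Rightarrow> (real^'n \<Rightarrow> complex) \<Rightarrow> real^'n \<Rightarrow> real^'n \<Rightarrow> real^'n \<Rightarrow> complex" where
  "stress_energy G w x X Y =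
     (1/2) * cnj (differential w x X) * differential w x Y
   + (1/2) * differential w x X * cnj (differential w x Y)
   - (1/2) * of_real (bilin G x X Y) *
       (\<Sum>i\<in>UNIV. \<Sum>j\<in>UNIV. (matrix_inv (G x) $ i $ j) *\<^sub>R (pderiv_at w i x * cnj (pderiv_at w j x)))"


section \<open>Sub-extremal Reissner--Nordstroem\<close>

definition D_RN :: "real \<Rightarrow> real \<Rightarrow> real \<Rightarrow> real" where
  "D_RN m e r = 1 - 2 * m / r + e\<^sup>2 / r\<^sup>2"

definition r_plus :: "real \<Rightarrow> real \<Rightarrow> real" where
  "r_plus m e = m + sqrt (m\<^sup>2 - e\<^sup>2)"

definition r_minus :: "real \<Rightarrow> real \<Rightarrow> real" where
  "r_minus m e = m - sqrt (m\<^sup>2 - e\<^sup>2)"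

text \<open>The surface gravities \<open>\<bar>D'(r\<^sub>\<plusminus>)\<bar> / 2\<close>.\<close>

definition kappa_plus :: "real \<Rightarrow> real \<Rightarrow> real" where
  "kappa_plus m e = (r_plus m e - r_minus m e) / (2 * (r_plus m e)\<^sup>2)"

definition kappa_minus :: "real \<Rightarrow> real \<Rightarrow> real" where
  "kappa_minus m e = (r_plus m e - r_minus m e) / (2 * (r_minus m e)\<^sup>2)"

text \<open>An antiderivative of \<open>1/D\<close> on each of the regions \<open>r > r\<^sub>+\<close> and \<open>r\<^sub>- < r < r\<^sub>+\<close>.\<close>

definition rstar :: "real \<Rightarrow> real \<Rightarrow> real \<Rightarrow> real" where
  "rstar m e r = r + ln \<bar>r - r_plus m e\<bar> / (2 * kappa_plus m e)
                   - ln \<bar>r - r_minus m e\<bar> / (2 * kappa_minus m e)"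

text \<open>
  The diamond shaped region (both exteriors, the black hole region \<open>II\<close>, the white hole region
  and the horizons \<open>r = r\<^sub>+\<close> between them, including the bifurcation sphere) is covered by the
  Kruskal coordinates of the event horizon. With \<open>u = t - r*\<close> and \<open>v = t + r*\<close> they are
  \<open>U = - exp (- \<kappa>\<^sub>+ u)\<close>, \<open>V = exp (\<kappa>\<^sub>+ v)\<close> in region \<open>I\<close> and
  \<open>U = exp (- \<kappa>\<^sub>+ u)\<close>, \<open>V = exp (\<kappa>\<^sub>+ v)\<close> in region \<open>II\<close>. In both regions
  \<open>U V = kruskal_product r\<close>; this is a strictly decreasing bijection from \<open>(r\<^sub>-, \<infinity>)\<close> onto the
  reals, so that the diamond is \<open>\<real>\<^sup>2 \<times> S\<^sup>2\<close>. From \<open>-D dt\<^sup>2 + dr\<^sup>2/D = -D du dv\<close> one gets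
  \<open>-F(r) dU dV\<close> with \<open>F = - D / (\<kappa>\<^sub>+\<^sup>2 U V)\<close>, in which the factor \<open>r - r\<^sub>+\<close> cancels.
\<close>

definition kruskal_product :: "real \<Rightarrow> real \<Rightarrow> real \<Rightarrow> real" where
  "kruskal_product m e r =
     - (r - r_plus m e) * exp (2 * kappa_plus m e * r)
       * (r - r_minus m e) powr (- (kappa_plus m e / kappa_minus m e))"

definition kruskal_radius :: "real \<Rightarrow> real \<Rightarrow> real \<Rightarrow> real \<Rightarrow> real" where
  "kruskal_radius m e U V = (THE r. r_minus m e < r \<and> kruskal_product m e r = U * V)"

definition kruskal_F :: "real \<Rightarrow> real \<Rightarrow> real \<Rightarrow> real" where
  "kruskal_F m e r =
     (r - r_minus m e) powr (1 + kappa_plus m e / kappa_minus m e) * exp (- 2 * kappa_plus m e * r)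
     / ((kappa_plus m e)\<^sup>2 * r\<^sup>2)"

text \<open>Points \<open>(U, V, \<omega>)\<close>; the sphere is the unit sphere of \<open>\<real>\<^sup>3\<close>, and tangent vectors at a point
  are the triples \<open>(a, b, w)\<close> with \<open>w\<close> orthogonal to \<open>\<omega>\<close>.\<close>

type_synonym event = "real \<times> real \<times> (real^3)"

definition diamond :: "event set" where
  "diamond = UNIV \<times> UNIV \<times> sphere 0 1"

definition RN_metric :: "real \<Rightarrow> real \<Rightarrow> event \<Rightarrow> event \<Rightarrow> event \<Rightarrow> real" where
  "RN_metric m e p X Y =
     (case (p, X, Y) of ((U, V, \<omega>), (a, b, w), (a', b', w')) \<Rightarrow>
        - (kruskal_F m e (kruskal_radius m e U V) / 2) * (a * b' + b * a')
        + (kruskal_radius m e U V)\<^sup>2 * (w \<bullet> w'))"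

text \<open>The time orientation is given by the timelike field \<open>\<partial>\<^sub>U + \<partial>\<^sub>V\<close>; it agrees with \<open>\<partial>\<^sub>t\<close>
  in region \<open>I\<close> and with \<open>-\<partial>\<^sub>r\<close> (at constant \<open>v\<close>) in region \<open>II\<close>.\<close>

definition timelike_curve :: "real \<Rightarrow> real \<Rightarrow> (real \<Rightarrow> event) \<Rightarrow> bool" where
  "timelike_curve m e \<gamma> \<longleftrightarrow>
     \<gamma> C1_differentiable_on UNIV \<and> range \<gamma> \<subseteq> diamond \<and>
     (\<forall>s. RN_metric m e (\<gamma> s) (vector_derivative \<gamma> (at s)) (vector_derivative \<gamma> (at s)) < 0)"

definition future_directed_curve :: "real \<Rightarrow> real \<Rightarrow> (real \<Rightarrow> event) \<Rightarrow> bool" where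
  "future_directed_curve m e \<gamma> \<longleftrightarrow>
     (\<forall>s. RN_metric m e (\<gamma> s) (vector_derivative \<gamma> (at s)) (1, 1, 0) < 0)"

definition inextendible_curve :: "(real \<Rightarrow> event) \<Rightarrow> bool" where
  "inextendible_curve \<gamma> \<longleftrightarrow>
     \<not> (\<exists>p\<in>diamond. (\<gamma> \<longlongrightarrow> p) at_top) \<and> \<not> (\<exists>p\<in>diamond. (\<gamma> \<longlongrightarrow> p) at_bot)"

definition cauchy_hypersurface :: "real \<Rightarrow> real \<Rightarrow> event set \<Rightarrow> bool" where
  "cauchy_hypersurface m e S \<longleftrightarrow>
     S \<subseteq> diamond \<and> (\<forall>\<gamma>. timelike_curve m e \<gamma> \<and> inextendible_curve \<gamma> \<longrightarrow> (\<exists>!s. \<gamma> s \<in> S))"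

definition chronological_future :: "real \<Rightarrow> real \<Rightarrow> event set \<Rightarrow> event set" where
  "chronological_future m e S =
     {q. \<exists>\<gamma> s s'. timelike_curve m e \<gamma> \<and> future_directed_curve m e \<gamma> \<and>
                  s < s' \<and> \<gamma> s \<in> S \<and> \<gamma> s' = q}"


section \<open>The charts of regions \<open>I\<close>, \<open>II\<close>, \<open>III\<close> and \<open>IV\<close>\<close>

definition region_II :: "(real \<times> real) set" where
  "region_II = {(U, V). U > 0 \<and> V > 0}"

text \<open>Kruskal coordinates \<open>(U, V)\<close> of the point \<open>(t, r)\<close> of region \<open>I\<close>.\<close>

definition kruskal_of_tr :: "real \<Rightarrow> real \<Rightarrow> real \<times> real \<Rightarrow> real \<times> real" where
  "kruskal_of_tr m e = (\<lambda>(t, r). (- exp (- kappa_plus m e * (t - rstar m e r)),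
                                    exp (kappa_plus m e * (t + rstar m e r))))"

text \<open>Kruskal coordinates \<open>(U, V)\<close> of the point \<open>(v, r)\<close>, respectively \<open>(u, r)\<close>, of region \<open>II\<close>.\<close>

definition kruskal_of_vr :: "real \<Rightarrow> real \<Rightarrow> real \<times> real \<Rightarrow> real \<times> real" where
  "kruskal_of_vr m e = (\<lambda>(v, r). (exp (- kappa_plus m e * (v - 2 * rstar m e r)),
                                   exp (kappa_plus m e * v)))"

definition kruskal_of_ur :: "real \<Rightarrow> real \<Rightarrow> real \<times> real \<Rightarrow> real \<times> real" where
  "kruskal_of_ur m e = (\<lambda>(u, r). (exp (- kappa_plus m e * u),
                                   exp (kappa_plus m e * (u + 2 * rstar m e r))))"

text \<open>The \<open>(v, r)\<close> and \<open>(u, r)\<close> parts of the metric; regular for all \<open>r > 0\<close>.\<close>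

definition metric_vr :: "real \<Rightarrow> real \<Rightarrow> real \<times> real \<Rightarrow> real \<times> real \<Rightarrow> real \<times> real \<Rightarrow> real" where
  "metric_vr m e p X Y =
     - D_RN m e (snd p) * fst X * fst Y + fst X * snd Y + snd X * fst Y"

definition metric_ur :: "real \<Rightarrow> real \<Rightarrow> real \<times> real \<Rightarrow> real \<times> real \<Rightarrow> real \<times> real \<Rightarrow> real" where
  "metric_ur m e p X Y =
     - D_RN m e (snd p) * fst X * fst Y - fst X * snd Y - snd X * fst Y"


section \<open>Slices\<close>

text \<open>A slice represented by a curve \<open>c\<close> in the Penrose diagram, given by its Kruskal coordinates
  \<open>(U, V)\<close> and defined on an open interval \<open>J\<close>.\<close>

definition slice :: "(real \<Rightarrow> real \<times> real) \<Rightarrow> real set \<Rightarrow> event set" where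
  "slice c J = {(U, V, \<omega>). (U, V) \<in> c ` J \<and> \<omega> \<in> sphere 0 1}"

definition spacelike_slice :: "real \<Rightarrow> real \<Rightarrow> (real \<Rightarrow> real \<times> real) \<Rightarrow> real set \<Rightarrow> bool" where
  "spacelike_slice m e c J \<longleftrightarrow>
     open J \<and> is_interval J \<and> J \<noteq> {} \<and> smooth_on J c \<and>
     (\<forall>s\<in>J. \<forall>\<omega>\<in>sphere 0 1. \<forall>a w. w \<bullet> \<omega> = 0 \<and> (a, w) \<noteq> (0, 0) \<longrightarrow>
        (let X = (a * fst (vector_derivative c (at s)), a * snd (vector_derivative c (at s)), w)
         in 0 < RN_metric m e (fst (c s), snd (c s), \<omega>) X X))"

text \<open>Along the part of the slice in region \<open>I\<close>, \<open>t\<close> has a limit as \<open>r\<close> tends to infinity.\<close>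

definition asymptotic_to_const_t :: "real \<Rightarrow> real \<Rightarrow> (real \<Rightarrow> real \<times> real) \<Rightarrow> real set \<Rightarrow> bool" where
  "asymptotic_to_const_t m e c J \<longleftrightarrow>
     (\<exists>t\<^sub>0. \<forall>\<epsilon>>0. \<exists>R>r_plus m e. \<forall>t r. r > R \<and> kruskal_of_tr m e (t, r) \<in> c ` J \<longrightarrow> \<bar>t - t\<^sub>0\<bar> < \<epsilon>)"

definition initial_slice :: "real \<Rightarrow> real \<Rightarrow> (real \<Rightarrow> real \<times> real) \<Rightarrow> real set \<Rightarrow> bool" where
  "initial_slice m e c J \<longleftrightarrow>
     spacelike_slice m e c J \<and> cauchy_hypersurface m e (slice c J) \<and> asymptotic_to_const_t m e c J"

text \<open>At its end \<open>a\<close> the curve reaches the component \<open>r = r\<^sub>-\<close> of the Cauchy horizon in the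
  \<open>v\<close>-chart and continues as a smooth spacelike curve into region \<open>III\<close>.\<close>

definition extendible_into_III :: "real \<Rightarrow> real \<Rightarrow> (real \<Rightarrow> real \<times> real) \<Rightarrow> real \<Rightarrow> real \<Rightarrow> bool" where
  "extendible_into_III m e c a b \<longleftrightarrow>
     (\<exists>\<epsilon>>0. \<exists>q. smooth_on {a-\<epsilon><..<b} q \<and>
        (\<forall>s\<in>{a-\<epsilon><..<b}. 0 < metric_vr m e (q s) (vector_derivative q (at s)) (vector_derivative q (at s))) \<and>
        (\<forall>s\<in>{a-\<epsilon><..<a}. 0 < snd (q s) \<and> snd (q s) < r_minus m e) \<and>
        snd (q a) = r_minus m e \<and>
        (\<forall>s\<in>{a<..<b}. r_minus m e < snd (q s) \<and> snd (q s) < r_plus m e \<and> c s = kruskal_of_vr m e (q s)))"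

text \<open>At its end \<open>b\<close> the curve reaches the component \<open>r = r\<^sub>-\<close> of the Cauchy horizon in the
  \<open>u\<close>-chart and continues as a smooth spacelike curve into region \<open>IV\<close>.\<close>

definition extendible_into_IV :: "real \<Rightarrow> real \<Rightarrow> (real \<Rightarrow> real \<times> real) \<Rightarrow> real \<Rightarrow> real \<Rightarrow> bool" where
  "extendible_into_IV m e c a b \<longleftrightarrow>
     (\<exists>\<epsilon>>0. \<exists>q. smooth_on {a<..<b+\<epsilon>} q \<and>
        (\<forall>s\<in>{a<..<b+\<epsilon>}. 0 < metric_ur m e (q s) (vector_derivative q (at s)) (vector_derivative q (at s))) \<and>
        (\<forall>s\<in>{a<..<b}. r_minus m e < snd (q s) \<and> snd (q s) < r_plus m e \<and> c s = kruskal_of_ur m e (q s)) \<and>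
        snd (q b) = r_minus m e \<and>
        (\<forall>s\<in>{b<..<b+\<epsilon>}. 0 < snd (q s) \<and> snd (q s) < r_minus m e))"

definition interior_slice :: "real \<Rightarrow> real \<Rightarrow> (real \<Rightarrow> real \<times> real) \<Rightarrow> real \<Rightarrow> real \<Rightarrow> bool" where
  "interior_slice m e c a b \<longleftrightarrow>
     a < b \<and> spacelike_slice m e c {a<..<b} \<and> c ` {a<..<b} \<subseteq> region_II \<and>
     extendible_into_III m e c a b \<and> extendible_into_IV m e c a b"


section \<open>Solutions of the wave equation and their energy\<close>

definition sph :: "real \<Rightarrow> real \<Rightarrow> real^3" where
  "sph \<theta> \<phi> = vector [sin \<theta> * cos \<phi>, sin \<theta> * sin \<phi>, cos \<theta>]"

text \<open>Coordinates \<open>(U, V, \<theta>, \<phi>)\<close> with spherical coordinates rotated by the orthogonal matrix \<open>R\<close>.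
  The restrictions to \<open>0 < \<theta> < \<pi>\<close> cover the diamond as \<open>R\<close> varies.\<close>

definition kruskal_chart :: "real^3^3 \<Rightarrow> real^4 \<Rightarrow> event" where
  "kruskal_chart R x = (x $ 1, x $ 2, R *v sph (x $ 3) (x $ 4))"

definition RN_coord_metric :: "real \<Rightarrow> real \<Rightarrow> real^3^3 \<Rightarrow> real^4 \<Rightarrow> real^4^4" where
  "RN_coord_metric m e R = pullback_metric (RN_metric m e) (kruskal_chart R)"

text \<open>Smoothness on the embedded submanifold \<open>diamond\<close>.\<close>

definition smooth_on_diamond :: "(event \<Rightarrow> complex) \<Rightarrow> bool" where
  "smooth_on_diamond w \<longleftrightarrow>
     (\<exists>W W'. open W \<and> diamond \<subseteq> W \<and> smooth_on W W' \<and> (\<forall>p\<in>diamond. W' p = w p))"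

definition wave_solution :: "real \<Rightarrow> real \<Rightarrow> (event \<Rightarrow> complex) \<Rightarrow> bool" where
  "wave_solution m e w \<longleftrightarrow>
     smooth_on_diamond w \<and>
     (\<forall>R x. orthogonal_matrix R \<and> 0 < x $ 3 \<and> x $ 3 < pi \<longrightarrow>
        dalembertian (RN_coord_metric m e R) (w \<circ> kruskal_chart R) x = 0)"

text \<open>The slice in terms of the coordinates \<open>(s, \<theta>, \<phi>)\<close>, which cover it up to a null set.\<close>

definition slice_param :: "(real \<Rightarrow> real \<times> real) \<Rightarrow> real^3 \<Rightarrow> real^4" where
  "slice_param c y =
     (\<chi> i. if i = 1 then fst (c (y $ 1)) else if i = 2 then snd (c (y $ 1)) else if i = 3 then y $ 2 else y $ 3)"

definition unit_normal :: "real \<Rightarrow> real \<Rightarrow> (real \<Rightarrow> real \<times> real) \<Rightarrow> real^3 \<Rightarrow> real^4" where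
  "unit_normal m e c y =
     (let g = bilin (RN_coord_metric m e (mat 1)) (slice_param c y)
      in THE n. g n n = -1 \<and> (\<forall>k. g n (pderiv_at (slice_param c) k y) = 0) \<and> g n (axis 1 1 + axis 2 1) < 0)"

definition induced_metric :: "real \<Rightarrow> real \<Rightarrow> (real \<Rightarrow> real \<times> real) \<Rightarrow> real^3 \<Rightarrow> real^3^3" where
  "induced_metric m e c = pullback_metric (bilin (RN_coord_metric m e (mat 1))) (slice_param c)"

definition energy :: "real \<Rightarrow> real \<Rightarrow> (real \<Rightarrow> real \<times> real) \<Rightarrow> real set \<Rightarrow> (event \<Rightarrow> complex) \<Rightarrow> ennreal" where
  "energy m e c J w =
     (\<integral>\<^sup>+ y \<in> {y. y $ 1 \<in> J \<and> 0 < y $ 2 \<and> y $ 2 < pi \<and> 0 < y $ 3 \<and> y $ 3 < 2 * pi}.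
        ennreal (Re (stress_energy (RN_coord_metric m e (mat 1)) (w \<circ> kruskal_chart (mat 1))
                       (slice_param c y) (unit_normal m e c y) (unit_normal m e c y))
                 * sqrt (det (induced_metric m e c y))) \<partial>lborel)"


section \<open>Consistency of the Kruskal form with the other coordinates\<close>

text \<open>
  The radius function is well defined, \<open>r*\<close> is an antiderivative of \<open>1/D\<close>, and the metric of the
  diamond pulls back to the given expressions in the \<open>(t, r)\<close>, \<open>(v, r)\<close> and \<open>(u, r)\<close> coordinates
  and to the diagonal form \<open>r\<^sup>2 d\<theta>\<^sup>2 + r\<^sup>2 sin\<^sup>2\<theta> d\<phi>\<^sup>2\<close> on the spheres.
\<close>

context
  fixes m e :: real
  assumes e0: "0 < e" and em: "e < m"
begin

lemma r_minus_pos: "0 < r_minus m e"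
  and r_minus_less_r_plus: "r_minus m e < r_plus m e"
  and r_plus_add_r_minus: "r_plus m e + r_minus m e = 2 * m"
  and r_plus_mult_r_minus: "r_plus m e * r_minus m e = e\<^sup>2"
proof -
  have pos: "0 < m\<^sup>2 - e\<^sup>2"
    using e0 em by (simp add: power_strict_mono)
  then have "sqrt (m\<^sup>2 - e\<^sup>2) < m"
    using e0 em by (intro real_less_lsqrt) auto
  then show "0 < r_minus m e" by (simp add: r_minus_def)
  show "r_minus m e < r_plus m e" using pos by (simp add: r_minus_def r_plus_def)
  show "r_plus m e + r_minus m e = 2 * m" by (simp add: r_minus_def r_plus_def)
  show "r_plus m e * r_minus m e = e\<^sup>2"
    using pos by (simp add: r_minus_def r_plus_def algebra_simps flip: power2_eq_square)
qed

lemma r_plus_pos: "0 < r_plus m e"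
  using r_minus_pos r_minus_less_r_plus by linarith

lemma kappa_plus_pos: "0 < kappa_plus m e" and kappa_minus_pos: "0 < kappa_minus m e"
  using r_minus_pos r_plus_pos r_minus_less_r_plus
  by (auto simp: kappa_plus_def kappa_minus_def)

lemma kappa_quotient: "kappa_plus m e / kappa_minus m e = (r_minus m e)\<^sup>2 / (r_plus m e)\<^sup>2"
  using r_minus_pos r_plus_pos r_minus_less_r_plus
  by (simp add: kappa_plus_def kappa_minus_def field_simps)

lemma D_RN_factor:
  assumes "r > 0"
  shows "D_RN m e r = (r - r_plus m e) * (r - r_minus m e) / r\<^sup>2"
proof -
  have "(r - r_plus m e) * (r - r_minus m e) = r\<^sup>2 - 2 * m * r + e\<^sup>2"
    using r_plus_add_r_minus r_plus_mult_r_minus by algebra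
  then show ?thesis using assms by (simp add: D_RN_def field_simps power2_eq_square)
qed

lemma DERIV_rstar:
  assumes "r_minus m e < r" "r \<noteq> r_plus m e"
  shows "(rstar m e has_real_derivative 1 / D_RN m e r) (at r)"
proof -
  let ?p = "r_plus m e" and ?q = "r_minus m e"
  have r: "r > 0" using assms r_minus_pos by linarith
  have ln: "((\<lambda>r. ln \<bar>r - x\<bar>) has_real_derivative 1 / (r - x)) (at r)" if "r \<noteq> x" for x
  proof -
    have ev: "\<forall>\<^sub>F y in nhds r. \<bar>y - x\<bar> = (if r < x then x - y else y - x)"
    proof (cases "r < x")
      case True
      then have "\<forall>\<^sub>F y in nhds r. y < x" by (intro eventually_nhds_in_open[of "{..<x}", simplified]) auto
      then show ?thesis by eventually_elim (use True in auto)
    next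
      case False
      then have "\<forall>\<^sub>F y in nhds r. y > x" using that by (intro eventually_nhds_in_open[of "{x<..}", simplified]) auto
      then show ?thesis by eventually_elim (use False in auto)
    qed
    then have ev': "\<forall>\<^sub>F y in nhds r. ln \<bar>y - x\<bar> = ln (if r < x then x - y else y - x)"
      by eventually_elim simp
    have "((\<lambda>y. ln (if r < x then x - y else y - x)) has_real_derivative 1 / (r - x)) (at r)"
      using that by (cases "r < x") (auto intro!: derivative_eq_intros simp: field_simps)
    then show ?thesis using DERIV_cong_ev[OF refl ev' refl] by blast
  qed
  have *: "(rstar m e has_real_derivative
      1 + (1 / (r - ?p)) / (2 * kappa_plus m e) - (1 / (r - ?q)) / (2 * kappa_minus m e)) (at r)"
    unfolding rstar_def[abs_def] using assms
    by (intro derivative_intros DERIV_cdivide ln) auto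
  have "1 + (1 / (r - ?p)) / (2 * kappa_plus m e) - (1 / (r - ?q)) / (2 * kappa_minus m e)
      = 1 + ?p\<^sup>2 / ((?p - ?q) * (r - ?p)) - ?q\<^sup>2 / ((?p - ?q) * (r - ?q))"
  proof -
    have "1 / (2 * kappa_plus m e) = ?p\<^sup>2 / (?p - ?q)" "1 / (2 * kappa_minus m e) = ?q\<^sup>2 / (?p - ?q)"
      using r_minus_less_r_plus by (auto simp: kappa_plus_def kappa_minus_def divide_simps)
    then have "(1 / (r - x)) / (2 * kappa_plus m e) = ?p\<^sup>2 / ((?p - ?q) * (r - x))"
      "(1 / (r - x)) / (2 * kappa_minus m e) = ?q\<^sup>2 / ((?p - ?q) * (r - x))" for x
      by (metis divide_divide_eq_left mult.commute)+
    then show ?thesis by simp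
  qed
  also have "\<dots> = r\<^sup>2 / ((r - ?p) * (r - ?q))"
  proof -
    have a: "?p - ?q \<noteq> 0" "r - ?p \<noteq> 0" "r - ?q \<noteq> 0" using assms r_minus_less_r_plus by auto
    show ?thesis using a by (simp add: divide_simps) (simp add: algebra_simps power2_eq_square)
  qed
  also have "\<dots> = 1 / D_RN m e r" using D_RN_factor[OF r] r by simp
  finally show ?thesis using * by simp
qed

lemma kruskal_product_rstar:
  assumes "r_minus m e < r" "r \<noteq> r_plus m e"
  shows "kruskal_product m e r
           = (if r < r_plus m e then 1 else - 1) * exp (2 * kappa_plus m e * rstar m e r)"
proof -
  let ?k = "kappa_plus m e" and ?l = "kappa_minus m e"
  have k: "?k > 0" "?l > 0" using kappa_plus_pos kappa_minus_pos by auto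
  have "2 * ?k * rstar m e r
      = 2 * ?k * r + ln \<bar>r - r_plus m e\<bar> - (?k / ?l) * ln (r - r_minus m e)"
    using k assms by (simp add: rstar_def field_simps)
  also have "\<dots> = 2 * ?k * r + ln \<bar>r - r_plus m e\<bar> + (- (?k / ?l) * ln (r - r_minus m e))"
    by simp
  finally have "exp (2 * ?k * rstar m e r)
      = exp (2 * ?k * r) * \<bar>r - r_plus m e\<bar> * exp (- (?k / ?l) * ln (r - r_minus m e))"
    using assms by (simp only: exp_add) simp
  then show ?thesis using assms by (auto simp: kruskal_product_def powr_def)
qed

lemma DERIV_kruskal_product:
  assumes "r_minus m e < r"
  shows "(kruskal_product m e has_real_derivative
            - 2 * kappa_plus m e * r\<^sup>2 * exp (2 * kappa_plus m e * r)
              * (r - r_minus m e) powr (- (kappa_plus m e / kappa_minus m e) - 1)) (at r)"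
proof -
  let ?p = "r_plus m e" and ?q = "r_minus m e" and ?k = "kappa_plus m e"
  define c where "c = kappa_plus m e / kappa_minus m e"
  define E where "E = exp (2 * ?k * r)"
  define w where "w = (r - ?q) powr (- c - 1)"
  have rq: "r - ?q > 0" using assms by simp
  have w: "(r - ?q) powr (- c) = (r - ?q) * w"
    using rq by (simp add: w_def powr_diff)
  have "(kruskal_product m e has_real_derivative
      (- E + - (r - ?p) * (2 * ?k * E)) * (r - ?q) powr (- c) + (- (r - ?p) * E) * (- c * w)) (at r)"
    unfolding kruskal_product_def[abs_def] c_def[symmetric] using rq
    by (auto intro!: derivative_eq_intros simp: E_def w_def algebra_simps)
  also have "(- E + - (r - ?p) * (2 * ?k * E)) * (r - ?q) powr (- c) + (- (r - ?p) * E) * (- c * w)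
     = - E * w * ((1 + 2 * ?k * (r - ?p)) * (r - ?q) - c * (r - ?p))"
    unfolding w by (simp add: algebra_simps)
  also have "(1 + 2 * ?k * (r - ?p)) * (r - ?q) - c * (r - ?p) = 2 * ?k * r\<^sup>2"
  proof -
    have c': "c = ?q\<^sup>2 / ?p\<^sup>2" by (simp add: c_def kappa_quotient)
    show ?thesis using r_plus_pos unfolding c' kappa_plus_def
      by (simp add: divide_simps) algebra
  qed
  finally show ?thesis unfolding c_def E_def w_def by (simp add: mult_ac)
qed

lemma kruskal_product_ex1: "\<exists>!r. r_minus m e < r \<and> kruskal_product m e r = x"
proof -
  let ?p = "r_plus m e" and ?q = "r_minus m e" and ?k = "kappa_plus m e"
  define c where "c = kappa_plus m e / kappa_minus m e"
  have c: "c > 0" using kappa_plus_pos kappa_minus_pos by (simp add: c_def)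
  have k: "?k > 0" by (rule kappa_plus_pos)
  have qp: "?q < ?p" and q0: "0 < ?q" using r_minus_less_r_plus r_minus_pos by auto
  have anti: "kruskal_product m e r' < kruskal_product m e r" if "?q < r" "r < r'" for r r'
  proof (rule DERIV_neg_imp_decreasing[OF that(2)])
    fix y assume "r \<le> y" "y \<le> r'"
    then have y: "?q < y" using that by simp
    then have "y > 0" using q0 by simp
    then have "- 2 * ?k * y\<^sup>2 * exp (2 * ?k * y) * (y - ?q) powr (- (?k / kappa_minus m e) - 1) < 0"
      using k y by (simp add: mult_neg_pos)
    then show "\<exists>d. (kruskal_product m e has_real_derivative d) (at y) \<and> d < 0"
      using DERIV_kruskal_product[OF y] by blast
  qed
  have c1: "c < 1"
    using qp q0 unfolding c_def kappa_quotient by (simp add: power_strict_mono)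
  have lower: "\<exists>r>?q. kruskal_product m e r \<le> x"
  proof -
    define r where "r = max (2 * ?p + 1) (\<bar>x\<bar> / ?k)"
    have r: "r \<ge> 2 * ?p + 1" "r \<ge> \<bar>x\<bar> / ?k" by (auto simp: r_def)
    have rq: "r - ?q \<ge> 1" "r > 0" "r - ?p > 0" using r qp q0 by auto
    have "(r - ?q) powr (- c) \<ge> (r - ?q) powr (- 1)"
      using rq c1 by (intro powr_mono) auto
    then have h1: "(r - ?q) powr (- c) \<ge> 1 / (r - ?q)"
      using rq by (simp add: powr_minus_divide)
    have h2: "exp (2 * ?k * r) \<ge> 2 * ?k * r"
      using exp_ge_add_one_self[of "2 * ?k * r"] by linarith
    have h3: "(r - ?p) / (r - ?q) \<ge> 1 / 2" using r rq q0 by (simp add: field_simps)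
    have "\<bar>x\<bar> \<le> ?k * r" using r(2) k by (simp add: field_simps)
    also have "\<dots> = (1 / 2) * (2 * ?k * r)" by simp
    also have "\<dots> \<le> ((r - ?p) / (r - ?q)) * exp (2 * ?k * r)"
      using h2 h3 k rq by (intro mult_mono) auto
    also have "\<dots> = (r - ?p) * exp (2 * ?k * r) * (1 / (r - ?q))" by simp
    also have "\<dots> \<le> (r - ?p) * exp (2 * ?k * r) * (r - ?q) powr (- c)"
      using h1 rq by (intro mult_left_mono) auto
    also have "\<dots> = - kruskal_product m e r" by (simp add: kruskal_product_def c_def algebra_simps)
    finally show ?thesis using rq by (intro exI[of _ r]) auto
  qed
  have upper: "\<exists>r>?q. kruskal_product m e r \<ge> x"
  proof -
    define d where "d = (?p - ?q) / (2 * (\<bar>x\<bar> + 1))"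
    have d: "d > 0" using qp by (simp add: d_def)
    define h where "h = min ((?p - ?q) / 2) (d powr (1 / c))"
    have h: "h > 0" "h \<le> (?p - ?q) / 2" "h \<le> d powr (1 / c)"
      using qp d by (simp_all add: h_def del: le_divide_eq_numeral1)
    have "h powr (- c) \<ge> (d powr (1 / c)) powr (- c)"
      using h c by (intro powr_mono2') auto
    then have h1: "h powr (- c) \<ge> 1 / d"
      using c d by (simp add: powr_powr powr_minus_divide)
    have h2: "exp (2 * ?k * (?q + h)) \<ge> 1" using k q0 h by simp
    have "x \<le> \<bar>x\<bar> + 1" by simp
    also have "\<dots> = ((?p - ?q) / 2 * 1) * (1 / d)" using qp by (simp add: d_def field_simps)
    also have "\<dots> \<le> ((?p - ?q - h) * exp (2 * ?k * (?q + h))) * h powr (- c)"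
      using h h1 h2 qp d by (intro mult_mono) auto
    also have "\<dots> = kruskal_product m e (?q + h)" by (simp add: kruskal_product_def c_def algebra_simps)
    finally show ?thesis using h by (intro exI[of _ "?q + h"]) auto
  qed
  obtain a b where a: "a > ?q" "kruskal_product m e a \<le> x" and b: "b > ?q" "kruskal_product m e b \<ge> x"
    using lower upper by blast
  have ba: "b \<le> a" using anti[of a b] a b by (cases "b \<le> a") auto
  have "\<exists>r\<ge>b. r \<le> a \<and> kruskal_product m e r = x"
    using a b ba by (intro IVT2) (auto intro!: DERIV_isCont[OF DERIV_kruskal_product])
  then obtain r where "b \<le> r" "kruskal_product m e r = x" by blast
  then have "?q < r" "kruskal_product m e r = x" using b(1) by simp_all
  then show ?thesis using anti by (metis linorder_neqE_linordered_idom order_less_irrefl)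
qed

lemma kruskal_radius_eqI:
  assumes "r_minus m e < r" "kruskal_product m e r = U * V"
  shows "kruskal_radius m e U V = r"
  unfolding kruskal_radius_def using kruskal_product_ex1[of "U * V"] assms by blast

lemma kruskal_F_eq:
  assumes "r_minus m e < r" "r \<noteq> r_plus m e"
  shows "kruskal_F m e r = - D_RN m e r / ((kappa_plus m e)\<^sup>2 * kruskal_product m e r)"
proof -
  have "r > 0" using assms r_minus_pos by linarith
  then show ?thesis
    using assms kappa_plus_pos
    by (simp add: kruskal_F_def kruskal_product_def D_RN_factor powr_add powr_minus exp_minus field_simps)
qed

lemma rstar_snd:
  assumes "r_minus m e < r" "r \<noteq> r_plus m e"
  shows "((\<lambda>p. rstar m e (snd p)) has_derivative (\<lambda>X. snd X / D_RN m e r)) (at (t::real, r))"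
proof -
  have "(rstar m e has_derivative (\<lambda>x. x / D_RN m e r)) (at (snd (t, r)))"
  proof -
    have "(*) (1 / D_RN m e r) = (\<lambda>x. x / D_RN m e r)" by auto
    then show ?thesis using DERIV_rstar[OF assms] by (simp only: has_field_derivative_def snd_conv)
  qed
  from has_derivative_compose[OF has_derivative_snd[OF has_derivative_ident] this]
  show ?thesis by simp
qed

lemma RN_metric_null_frame:
  assumes "r_minus m e < r" "r \<noteq> r_plus m e" "U * V = kruskal_product m e r"
  shows "RN_metric m e (U, V, \<omega>)
           (- kappa_plus m e * U * \<alpha>, kappa_plus m e * V * \<beta>, w)
           (- kappa_plus m e * U * \<alpha>', kappa_plus m e * V * \<beta>', w')
         = - (D_RN m e r / 2) * (\<alpha> * \<beta>' + \<beta> * \<alpha>') + r\<^sup>2 * (w \<bullet> w')"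
proof -
  let ?k = "kappa_plus m e"
  have k: "?k \<noteq> 0" using kappa_plus_pos by simp
  have UV0: "U * V \<noteq> 0" unfolding assms(3) kruskal_product_rstar[OF assms(1,2)] by simp
  have F: "kruskal_F m e r * (?k\<^sup>2 * (U * V)) = - D_RN m e r"
    using k UV0 unfolding kruskal_F_eq[OF assms(1,2)] assms(3) by simp
  have rad: "kruskal_radius m e U V = r" using assms by (intro kruskal_radius_eqI) auto
  have "RN_metric m e (U, V, \<omega>) (- ?k * U * \<alpha>, ?k * V * \<beta>, w) (- ?k * U * \<alpha>', ?k * V * \<beta>', w')
      = (kruskal_F m e r * (?k\<^sup>2 * (U * V))) / 2 * (\<alpha> * \<beta>' + \<beta> * \<alpha>') + r\<^sup>2 * (w \<bullet> w')"
    by (simp add: RN_metric_def rad field_simps power2_eq_square)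
  then show ?thesis unfolding F by simp
qed

lemma RN_metric_region_I:
  assumes r: "r_plus m e < r"
  shows "\<exists>A. (kruskal_of_tr m e has_derivative A) (at (t, r)) \<and>
    (\<forall>X Y \<omega> w w'. RN_metric m e (fst (kruskal_of_tr m e (t, r)), snd (kruskal_of_tr m e (t, r)), \<omega>)
        (fst (A X), snd (A X), w) (fst (A Y), snd (A Y), w')
      = - D_RN m e r * fst X * fst Y + snd X * snd Y / D_RN m e r + r\<^sup>2 * (w \<bullet> w'))"
proof -
  let ?k = "kappa_plus m e" and ?D = "D_RN m e r" and ?s = "rstar m e r"
  have rq: "r_minus m e < r" "r \<noteq> r_plus m e" "r > 0"
    using r r_minus_less_r_plus r_minus_pos by auto
  have D: "?D > 0" using rq r by (simp add: D_RN_factor)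
  define U V where "U = - exp (- ?k * (t - ?s))" and "V = exp (?k * (t + ?s))"
  have pt: "kruskal_of_tr m e (t, r) = (U, V)" by (simp add: kruskal_of_tr_def U_def V_def)
  have UV: "U * V = kruskal_product m e r"
    using kruskal_product_rstar[OF rq(1,2)] r by (simp add: U_def V_def algebra_simps flip: exp_add)
  define A where "A = (\<lambda>X::real \<times> real. (- ?k * U * (fst X - snd X / ?D), ?k * V * (fst X + snd X / ?D)))"
  have rs: "((\<lambda>p. rstar m e (snd p)) has_derivative (\<lambda>X. snd X / ?D)) (at (t, r))"
    by (rule rstar_snd[OF rq(1,2)])
  have "(kruskal_of_tr m e has_derivative A) (at (t, r))"
    unfolding kruskal_of_tr_def case_prod_beta A_def U_def V_def
    by (auto intro!: derivative_eq_intros rs simp: fun_eq_iff algebra_simps)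
  moreover have "RN_metric m e (U, V, \<omega>) (fst (A X), snd (A X), w) (fst (A Y), snd (A Y), w')
      = - ?D * fst X * fst Y + snd X * snd Y / ?D + r\<^sup>2 * (w \<bullet> w')" for X Y \<omega> w w'
    unfolding A_def fst_conv snd_conv RN_metric_null_frame[OF rq(1,2) UV]
    using D by (simp add: field_simps)
  ultimately show ?thesis by (auto simp: pt)
qed

lemma RN_metric_region_II:
  assumes r: "r_minus m e < r" "r < r_plus m e"
  shows "\<exists>A. (kruskal_of_vr m e has_derivative A) (at (v, r)) \<and>
    (\<forall>X Y \<omega> w w'. RN_metric m e (fst (kruskal_of_vr m e (v, r)), snd (kruskal_of_vr m e (v, r)), \<omega>)
        (fst (A X), snd (A X), w) (fst (A Y), snd (A Y), w')
      = metric_vr m e (v, r) X Y + r\<^sup>2 * (w \<bullet> w'))"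
  and "\<exists>A. (kruskal_of_ur m e has_derivative A) (at (u, r)) \<and>
    (\<forall>X Y \<omega> w w'. RN_metric m e (fst (kruskal_of_ur m e (u, r)), snd (kruskal_of_ur m e (u, r)), \<omega>)
        (fst (A X), snd (A X), w) (fst (A Y), snd (A Y), w')
      = metric_ur m e (u, r) X Y + r\<^sup>2 * (w \<bullet> w'))"
proof -
  let ?k = "kappa_plus m e" and ?D = "D_RN m e r" and ?s = "rstar m e r"
  have rq: "r_minus m e < r" "r \<noteq> r_plus m e" "r > 0"
    using r r_minus_less_r_plus r_minus_pos by auto
  have D: "?D < 0" using rq r by (simp add: D_RN_factor divide_neg_pos mult_neg_pos)
  have rs: "((\<lambda>p. rstar m e (snd p)) has_derivative (\<lambda>X. snd X / ?D)) (at (t, r))" for t :: real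
    by (rule rstar_snd[OF rq(1,2)])
  {
    define U V where "U = exp (- ?k * (v - 2 * ?s))" and "V = exp (?k * v)"
    have pt: "kruskal_of_vr m e (v, r) = (U, V)" by (simp add: kruskal_of_vr_def U_def V_def)
    have UV: "U * V = kruskal_product m e r"
      using kruskal_product_rstar[OF rq(1,2)] r by (simp add: U_def V_def algebra_simps flip: exp_add)
    define A where "A = (\<lambda>X::real \<times> real. (- ?k * U * (fst X - 2 * snd X / ?D), ?k * V * fst X))"
    have "(kruskal_of_vr m e has_derivative A) (at (v, r))"
      unfolding kruskal_of_vr_def case_prod_beta A_def U_def V_def
      by (auto intro!: derivative_eq_intros rs simp: fun_eq_iff algebra_simps)
    moreover have "RN_metric m e (U, V, \<omega>) (fst (A X), snd (A X), w) (fst (A Y), snd (A Y), w')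
        = metric_vr m e (v, r) X Y + r\<^sup>2 * (w \<bullet> w')" for X Y \<omega> w w'
      unfolding A_def fst_conv snd_conv RN_metric_null_frame[OF rq(1,2) UV] metric_vr_def
      using D by (simp add: field_simps)
    ultimately show "\<exists>A. (kruskal_of_vr m e has_derivative A) (at (v, r)) \<and>
      (\<forall>X Y \<omega> w w'. RN_metric m e (fst (kruskal_of_vr m e (v, r)), snd (kruskal_of_vr m e (v, r)), \<omega>)
          (fst (A X), snd (A X), w) (fst (A Y), snd (A Y), w')
        = metric_vr m e (v, r) X Y + r\<^sup>2 * (w \<bullet> w'))" by (auto simp: pt)
  }
  {
    define U V where "U = exp (- ?k * u)" and "V = exp (?k * (u + 2 * ?s))"
    have pt: "kruskal_of_ur m e (u, r) = (U, V)" by (simp add: kruskal_of_ur_def U_def V_def)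
    have UV: "U * V = kruskal_product m e r"
      using kruskal_product_rstar[OF rq(1,2)] r by (simp add: U_def V_def algebra_simps flip: exp_add)
    define A where "A = (\<lambda>X::real \<times> real. (- ?k * U * fst X, ?k * V * (fst X + 2 * snd X / ?D)))"
    have "(kruskal_of_ur m e has_derivative A) (at (u, r))"
      unfolding kruskal_of_ur_def case_prod_beta A_def U_def V_def
      by (auto intro!: derivative_eq_intros rs simp: fun_eq_iff algebra_simps)
    moreover have "RN_metric m e (U, V, \<omega>) (fst (A X), snd (A X), w) (fst (A Y), snd (A Y), w')
        = metric_ur m e (u, r) X Y + r\<^sup>2 * (w \<bullet> w')" for X Y \<omega> w w'
      unfolding A_def fst_conv snd_conv RN_metric_null_frame[OF rq(1,2) UV] metric_ur_def
      using D by (simp add: field_simps)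
    ultimately show "\<exists>A. (kruskal_of_ur m e has_derivative A) (at (u, r)) \<and>
      (\<forall>X Y \<omega> w w'. RN_metric m e (fst (kruskal_of_ur m e (u, r)), snd (kruskal_of_ur m e (u, r)), \<omega>)
          (fst (A X), snd (A X), w) (fst (A Y), snd (A Y), w')
        = metric_ur m e (u, r) X Y + r\<^sup>2 * (w \<bullet> w'))" by (auto simp: pt)
  }
qed

end

lemma sph_nth [simp]:
  "sph \<theta> \<phi> $ 1 = sin \<theta> * cos \<phi>" "sph \<theta> \<phi> $ 2 = sin \<theta> * sin \<phi>" "sph \<theta> \<phi> $ 3 = cos \<theta>"
  by (simp_all add: sph_def)

lemma sph_has_vector_derivative:
  assumes "(f has_real_derivative f') (at h)" "(g has_real_derivative g') (at h)"
  shows "((\<lambda>h. sph (f h) (g h)) has_vector_derivative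
     vector [cos (f h) * f' * cos (g h) - sin (f h) * (sin (g h) * g'),
             cos (f h) * f' * sin (g h) + sin (f h) * (cos (g h) * g'), - sin (f h) * f']) (at h)"
proof -
  note fg = assms
  have "((\<lambda>h. \<chi> i. sph (f h) (g h) $ i) has_vector_derivative
     (\<chi> i. (vector [cos (f h) * f' * cos (g h) - sin (f h) * (sin (g h) * g'),
             cos (f h) * f' * sin (g h) + sin (f h) * (cos (g h) * g'), - sin (f h) * f'] :: real^3) $ i)) (at h)"
    unfolding has_vector_derivative_def
  proof (subst has_derivative_componentwise_within, safe)
    fix b :: "real^3" assume "b \<in> Basis"
    then obtain i where b: "b = axis i 1" by (auto simp: Basis_vec_def)
    have "((\<lambda>h. sph (f h) (g h) $ i) has_real_derivative
      (vector [cos (f h) * f' * cos (g h) - sin (f h) * (sin (g h) * g'),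
             cos (f h) * f' * sin (g h) + sin (f h) * (cos (g h) * g'), - sin (f h) * f'] :: real^3) $ i) (at h)"
      using exhaust_3[of i]
      by (elim disjE) (auto intro!: derivative_eq_intros fg simp: algebra_simps)
    then show "((\<lambda>h. (\<chi> i. sph (f h) (g h) $ i) \<bullet> b) has_derivative
        (\<lambda>x. (x *\<^sub>R (\<chi> i. (vector [cos (f h) * f' * cos (g h) - sin (f h) * (sin (g h) * g'),
             cos (f h) * f' * sin (g h) + sin (f h) * (cos (g h) * g'), - sin (f h) * f'] :: real^3) $ i)) \<bullet> b)) (at h)"
      unfolding has_real_derivative_iff_has_vector_derivative has_vector_derivative_def
      by (simp add: b inner_axis)
  qed
  then show ?thesis by simp
qed

lemma pderiv_kruskal_chart:
  "pderiv_at (kruskal_chart R) i x = (axis i 1 $ 1, axis i 1 $ 2,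
     R *v vector [cos (x $ 3) * axis i 1 $ 3 * cos (x $ 4) - sin (x $ 3) * (sin (x $ 4) * axis i 1 $ 4),
             cos (x $ 3) * axis i 1 $ 3 * sin (x $ 4) + sin (x $ 3) * (cos (x $ 4) * axis i 1 $ 4),
             - sin (x $ 3) * axis i 1 $ 3])"
proof -
  have lin: "((\<lambda>h. x $ k + h * axis i 1 $ k) has_real_derivative axis i 1 $ k) (at 0)" for k
    by (auto intro!: derivative_eq_intros)
  have lin': "((\<lambda>h. x $ k + h * axis i 1 $ k) has_vector_derivative axis i 1 $ k) (at 0)" for k
    using lin by (simp add: has_real_derivative_iff_has_vector_derivative)
  note s = sph_has_vector_derivative[OF lin[of 3] lin[of 4]]
  note Rs = bounded_linear.has_vector_derivative[OF matrix_vector_mul_bounded_linear[of R] s]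
  note all = has_vector_derivative_Pair[OF lin'[of 1] has_vector_derivative_Pair[OF lin'[of 2] Rs]]
  have "(\<lambda>h. kruskal_chart R (x + h *\<^sub>R axis i 1)) = (\<lambda>h. (x $ 1 + h * axis i 1 $ 1, x $ 2 + h * axis i 1 $ 2,
      R *v sph (x $ 3 + h * axis i 1 $ 3) (x $ 4 + h * axis i 1 $ 4)))"
    by (simp add: kruskal_chart_def fun_eq_iff)
  then show ?thesis unfolding pderiv_at_def
    using vector_derivative_at[OF all] by simp
qed

lemma RN_coord_metric_eq:
  assumes R: "orthogonal_matrix R"
  shows "RN_coord_metric m e R x =
    (let r = kruskal_radius m e (x $ 1) (x $ 2) in
     \<chi> i j. if i = 1 \<and> j = 2 \<or> i = 2 \<and> j = 1 then - kruskal_F m e r / 2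
           else if i = 3 \<and> j = 3 then r\<^sup>2
           else if i = 4 \<and> j = 4 then r\<^sup>2 * (sin (x $ 3))\<^sup>2 else 0)"
proof -
  have inn: "(R *v a) \<bullet> (R *v b) = a $ 1 * b $ 1 + a $ 2 * b $ 2 + a $ 3 * b $ 3" for a b
    unfolding sum_3[of "\<lambda>i. a $ i * b $ i", symmetric] inner_vec_def[of a b, unfolded inner_real_def, symmetric]
    using R orthogonal_transformation_matrix[of "(*v) R"]
    by (simp add: orthogonal_transformation_def matrix_vector_mul_linear)
  have sc: "(sin (x $ 3))\<^sup>2 + (cos (x $ 3))\<^sup>2 = 1" "(sin (x $ 4))\<^sup>2 + (cos (x $ 4))\<^sup>2 = 1" by simp_all
  show ?thesis
    unfolding vec_eq_iff forall_4 RN_coord_metric_def pullback_metric_def pderiv_kruskal_chart RN_metric_def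
      kruskal_chart_def Let_def
    by (simp add: inn axis_def power2_eq_square algebra_simps) (insert sc, safe; algebra)
qed

end

theory Submission
  imports Defs
begin

text \<open>
  Spherically symmetric solutions suffice. For \<open>w = \<psi>(U, V) / r\<close> the wave equation becomes
  \<open>\<psi>\<^sub>U\<^sub>V = (r\<^sub>U\<^sub>V / r) \<psi>\<close> with a smooth coefficient on the Kruskal plane, and
  on a slice with tangent \<open>(U', V')\<close> the energy is the integral of
  \<open>r\<^sup>2 (w\<^sub>U\<^sup>2 U'\<^sup>2 + w\<^sub>V\<^sup>2 V'\<^sup>2) / sqrt (F \<bar>U' V'\<bar>)\<close>.

  For a profile \<open>\<phi>(V)\<close> supported near \<open>V\<^sub>0\<close> there is a solution \<open>\<psi> = \<phi>(V) + O(sup \<bar>\<phi>\<bar>)\<close> which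
  vanishes far out on \<open>\<Sigma>\<^sub>0\<close>: cut \<open>\<phi>\<close> off in \<open>U\<close>, and add the retarded correction of one part to the
  advanced correction of the other. Letting \<open>\<phi>\<close> concentrate at \<open>V\<^sub>0\<close>, only \<open>\<phi>'\<close> contributes to the
  energies, and their ratio is that of the numbers \<open>sqrt (\<bar>V'\<bar> / (F \<bar>U'\<bar>))\<close> at the points where the null
  line \<open>V = V\<^sub>0\<close> meets the slices. Now let \<open>V\<^sub>0 \<rightarrow> \<infinity>\<close>. On \<open>\<Sigma>\<^sub>0\<close>, where \<open>t\<close> stays bounded, this number is
  at most \<open>2 \<kappa>\<^sub>+ V\<^sub>0\<close> for suitable arbitrarily large \<open>V\<^sub>0\<close>. On \<open>\<Sigma>\<^sub>1\<close> it is \<open>V\<^sub>0\<close> times a quantity of size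
  \<open>1 / \<bar>D\<bar>\<close>, which blows up at the Cauchy horizon \<open>r = r\<^sub>-\<close>: this is the blue-shift.
\<close>

section \<open>Finite-order smoothness of functions on the Kruskal plane\<close>

section \<open>Calculus of functions of two real variables\<close>

text \<open>The hypothesis on the initial slice makes \<open>t\<close> converge but says nothing
  about derivatives, so the weight there cannot be bounded at every large V; a mean value argument
  along the far end yields only some good values. Near the Cauchy horizon the weight is large at
  every large V, so both slices can be matched on one null line. The order of choices is: the
  threshold on the interior slice, then \<open>V0\<close>, then a compact piece of the initial slice
  and the constant of the correction, and only then the width \<delta>. The correction may therefore
  depend badly on \<open>V0\<close>. A single Goursat solution starting from \<phi>(V) would in
  general leave a tail along one end of the initial slice, with uncontrolled energy. The cut-off in
  U splits \<phi>(V) so that both corrections vanish in the two quadrants into which the ends of the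
  slice run. The two pieces add up to \<phi>(V) again, so the cut-off is never differentiated. The
  profile is sqrt \<delta> times a bump of width \<delta>: the square integral of its derivative
  does not depend on \<delta>, while its supremum, which controls the correction, is of order sqrt
  \<delta>.\<close>

definition has_partials ::
  "(real \<Rightarrow> real \<Rightarrow> real) \<Rightarrow> (real \<Rightarrow> real \<Rightarrow> real) \<Rightarrow> (real \<Rightarrow> real \<Rightarrow> real) \<Rightarrow> bool" where
  "has_partials f fU fV \<longleftrightarrow>
     (\<forall>p. ((\<lambda>p. f (fst p) (snd p)) has_derivative
       (\<lambda>h. fst h * fU (fst p) (snd p) + snd h * fV (fst p) (snd p))) (at p))"

text \<open>The argument is the order: \<open>C2 k\<close> is k-fold continuous differentiability in
  two variables. The partials are existential witnesses, so that closure lemmas only have to name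
  them; \<open>has_partials_unique\<close> shows that they are determined.\<close>

primrec C2 :: "nat \<Rightarrow> (real \<Rightarrow> real \<Rightarrow> real) \<Rightarrow> bool" where
  "C2 0 f \<longleftrightarrow> continuous_on UNIV (\<lambda>p. f (fst p) (snd p))"
| "C2 (Suc k) f \<longleftrightarrow> (\<exists>fU fV. has_partials f fU fV \<and> C2 k fU \<and> C2 k fV)"

declare C2.simps(2) [simp del]

lemma has_partials_continuous:
  "has_partials f fU fV \<Longrightarrow> continuous_on UNIV (\<lambda>p. f (fst p) (snd p))"
  unfolding has_partials_def
  by (intro continuous_at_imp_continuous_on ballI, drule spec, erule has_derivative_continuous)

lemma has_partials_DERIV:
  assumes "has_partials f fU fV"
  shows "((\<lambda>U. f U V) has_real_derivative fU U V) (at U)"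
    and "((\<lambda>V. f U V) has_real_derivative fV U V) (at V)"
proof -
  have *: "((\<lambda>p. f (fst p) (snd p)) has_derivative (\<lambda>h. fst h * fU U V + snd h * fV U V)) (at (U, V))"
    using assms[unfolded has_partials_def, rule_format, of "(U, V)"] by simp
  have "((\<lambda>U. (U, V)) has_derivative (\<lambda>h. (h, 0))) (at U)" by (auto intro!: derivative_eq_intros)
  from has_derivative_compose[OF this *]
  show "((\<lambda>U. f U V) has_real_derivative fU U V) (at U)"
    by (simp add: has_field_derivative_def mult_commute_abs)
  have "((\<lambda>V. (U, V)) has_derivative (\<lambda>h. (0, h))) (at V)" by (auto intro!: derivative_eq_intros)
  from has_derivative_compose[OF this *]
  show "((\<lambda>V. f U V) has_real_derivative fV U V) (at V)"
    by (simp add: has_field_derivative_def mult_commute_abs)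
qed

lemma has_partials_unique:
  assumes "has_partials f fU fV" "has_partials f gU gV"
  shows "gU = fU" "gV = fV"
  by (intro ext DERIV_unique[OF has_partials_DERIV(1)[OF assms(2)] has_partials_DERIV(1)[OF assms(1)]]
    DERIV_unique[OF has_partials_DERIV(2)[OF assms(2)] has_partials_DERIV(2)[OF assms(1)]])+

text \<open>Joint continuity of one partial already gives total differentiability. For the integral
  operators below the second partial is an integrand or an integral whose continuity is
  known.\<close>

lemma has_partialsI:
  assumes U: "\<And>U V. ((\<lambda>U. f U V) has_real_derivative fU U V) (at U)"
    and V: "\<And>U V. ((\<lambda>V. f U V) has_real_derivative fV U V) (at V)"
    and c: "C2 0 fV"
  shows "has_partials f fU fV"
  unfolding has_partials_def
proof
  fix p :: "real \<times> real"
  obtain x y where p: "p = (x, y)" by (cases p)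
  have "((\<lambda>(x, y). f x y) has_derivative
      (\<lambda>(tx, ty). tx * fU x y + blinfun_apply (blinfun_scaleR_left (fV x y)) ty)) (at (x, y) within UNIV \<times> UNIV)"
  proof (rule has_derivative_partialsI)
    show "((\<lambda>x. f x y) has_derivative (\<lambda>t. t * fU x y)) (at x within UNIV)"
      using U[where U=x and V=y] by (simp add: has_field_derivative_def mult_commute_abs)
    show "((\<lambda>y. f x y) has_derivative blinfun_apply (blinfun_scaleR_left (fV x y))) (at y within UNIV)" for x y
      using V[where U=x and V=y] by (simp add: has_field_derivative_def mult_commute_abs)
    have "((\<lambda>p. fV (fst p) (snd p)) \<longlongrightarrow> fV x y) (at (x, y))"
      using c by (simp add: continuous_on_def)
    from bounded_linear.tendsto[OF bounded_linear_blinfun_scaleR_left this]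
    show "continuous (at (x, y) within UNIV \<times> UNIV) (\<lambda>(x, y). blinfun_scaleR_left (fV x y))"
      by (simp add: case_prod_beta' continuous_within)
  qed auto
  then show "((\<lambda>p. f (fst p) (snd p)) has_derivative (\<lambda>h. fst h * fU (fst p) (snd p) + snd h * fV (fst p) (snd p))) (at p)"
    by (simp add: p case_prod_beta')
qed

lemma has_partials_const: "has_partials (\<lambda>U V. c) (\<lambda>U V. 0) (\<lambda>U V. 0)"
  by (auto simp: has_partials_def)

lemma has_partials_add:
  assumes "has_partials f fU fV" "has_partials g gU gV"
  shows "has_partials (\<lambda>U V. f U V + g U V) (\<lambda>U V. fU U V + gU U V) (\<lambda>U V. fV U V + gV U V)"
  unfolding has_partials_def
proof
  fix p :: "real \<times> real"
  note * = assms[unfolded has_partials_def, rule_format, of p]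
  show "((\<lambda>p. f (fst p) (snd p) + g (fst p) (snd p)) has_derivative
     (\<lambda>h. fst h * (fU (fst p) (snd p) + gU (fst p) (snd p)) + snd h * (fV (fst p) (snd p) + gV (fst p) (snd p)))) (at p)"
    by (rule has_derivative_eq_rhs[OF has_derivative_add[OF *]]) (simp add: fun_eq_iff algebra_simps)
qed

lemma has_partials_mult:
  assumes "has_partials f fU fV" "has_partials g gU gV"
  shows "has_partials (\<lambda>U V. f U V * g U V) (\<lambda>U V. fU U V * g U V + f U V * gU U V)
           (\<lambda>U V. fV U V * g U V + f U V * gV U V)"
  unfolding has_partials_def
proof
  fix p :: "real \<times> real"
  note * = assms[unfolded has_partials_def, rule_format, of p]
  show "((\<lambda>p. f (fst p) (snd p) * g (fst p) (snd p)) has_derivative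
     (\<lambda>h. fst h * (fU (fst p) (snd p) * g (fst p) (snd p) + f (fst p) (snd p) * gU (fst p) (snd p))
       + snd h * (fV (fst p) (snd p) * g (fst p) (snd p) + f (fst p) (snd p) * gV (fst p) (snd p)))) (at p)"
    by (rule has_derivative_eq_rhs[OF has_derivative_mult[OF *]]) (simp add: fun_eq_iff algebra_simps)
qed

lemma has_partials_compose:
  assumes "has_partials f fU fV" "\<And>U V. (g has_real_derivative g' (f U V)) (at (f U V))"
  shows "has_partials (\<lambda>U V. g (f U V)) (\<lambda>U V. g' (f U V) * fU U V) (\<lambda>U V. g' (f U V) * fV U V)"
  unfolding has_partials_def
proof
  fix p :: "real \<times> real"
  have "((\<lambda>p. g (f (fst p) (snd p))) has_derivative
     (\<lambda>h. g' (f (fst p) (snd p)) * (fst h * fU (fst p) (snd p) + snd h * fV (fst p) (snd p)))) (at p)"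
    by (rule has_derivative_compose[OF assms(1)[unfolded has_partials_def, rule_format]
          assms(2)[unfolded has_field_derivative_def]])
  then show "((\<lambda>p. g (f (fst p) (snd p))) has_derivative
     (\<lambda>h. fst h * (g' (f (fst p) (snd p)) * fU (fst p) (snd p)) + snd h * (g' (f (fst p) (snd p)) * fV (fst p) (snd p)))) (at p)"
    by (simp add: algebra_simps)
qed

lemma C2_SucI: "has_partials f fU fV \<Longrightarrow> C2 k fU \<Longrightarrow> C2 k fV \<Longrightarrow> C2 (Suc k) f"
  by (auto simp: C2.simps(2))

lemma C2_SucE:
  assumes "C2 (Suc k) f"
  obtains fU fV where "has_partials f fU fV" "C2 k fU" "C2 k fV"
  using assms by (auto simp: C2.simps(2))

lemma C2_partials:
  assumes "has_partials f fU fV" "C2 (Suc k) f"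
  shows "C2 k fU" "C2 k fV"
proof -
  obtain gU gV where g: "has_partials f gU gV" "C2 k gU" "C2 k gV" using assms(2) by (rule C2_SucE)
  with has_partials_unique[OF assms(1) g(1)] show "C2 k fU" "C2 k fV" by simp_all
qed

lemma C2_0: "C2 k f \<Longrightarrow> C2 0 f"
  by (cases k) (simp_all, erule C2_SucE, erule has_partials_continuous)

lemma C2_Suc_imp: "C2 (Suc k) f \<Longrightarrow> C2 k f"
proof (induction k arbitrary: f)
  case 0 then show ?case by (rule C2_0)
next
  case (Suc k)
  from Suc.prems obtain fU fV where f: "has_partials f fU fV" "C2 (Suc k) fU" "C2 (Suc k) fV" by (rule C2_SucE)
  show ?case using f(2,3) by (intro C2_SucI[OF f(1)] Suc.IH)
qed

lemma C2_const: "C2 k (\<lambda>U V. c)"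
proof (induction k arbitrary: c)
  case 0 then show ?case by simp
next
  case (Suc k) then show ?case by (intro C2_SucI[OF has_partials_const])
qed

lemma C2_add: "C2 k f \<Longrightarrow> C2 k g \<Longrightarrow> C2 k (\<lambda>U V. f U V + g U V)"
proof (induction k arbitrary: f g)
  case 0 then show ?case by (auto intro: continuous_intros)
next
  case (Suc k)
  from Suc.prems obtain fU fV gU gV where *: "has_partials f fU fV" "C2 k fU" "C2 k fV"
    "has_partials g gU gV" "C2 k gU" "C2 k gV" by (auto elim!: C2_SucE)
  show ?case using * by (intro C2_SucI[OF has_partials_add[OF *(1,4)]] Suc.IH)
qed

lemma C2_mult: "C2 k f \<Longrightarrow> C2 k g \<Longrightarrow> C2 k (\<lambda>U V. f U V * g U V)"
proof (induction k arbitrary: f g)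
  case 0 then show ?case by (auto intro: continuous_intros)
next
  case (Suc k)
  from Suc.prems obtain fU fV gU gV where *: "has_partials f fU fV" "C2 k fU" "C2 k fV"
    "has_partials g gU gV" "C2 k gU" "C2 k gV" by (auto elim!: C2_SucE)
  have "C2 k f" "C2 k g" using Suc.prems by (simp_all add: C2_Suc_imp)
  with * show ?case by (intro C2_SucI[OF has_partials_mult[OF *(1,4)]] C2_add Suc.IH)
qed

lemma C2_diff: "C2 k f \<Longrightarrow> C2 k g \<Longrightarrow> C2 k (\<lambda>U V. f U V - g U V)"
  using C2_add[OF _ C2_mult[OF C2_const[of k "- 1"], of g], of f] by simp

lemma has_partials_affine:
  "has_partials (\<lambda>U V. \<alpha> * U + \<beta> * V + \<gamma>) (\<lambda>U V. \<alpha>) (\<lambda>U V. \<beta>)"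
  unfolding has_partials_def by (auto intro!: derivative_eq_intros simp: algebra_simps)

lemma C2_affine: "C2 k (\<lambda>U V. \<alpha> * U + \<beta> * V + \<gamma>)"
  by (rule C2_Suc_imp[OF C2_SucI[OF has_partials_affine C2_const C2_const]])

lemma C2_fst: "C2 k (\<lambda>U V. U)" and C2_snd: "C2 k (\<lambda>U V. V)"
  using C2_affine[of k 1 0 0] C2_affine[of k 0 1 0] by simp_all

text \<open>The partials of the inverse are products of the inverse itself and the partials of
  \<open>f\<close>, so the induction closes.\<close>

lemma C2_inverse:
  assumes "\<And>U V. f U V \<noteq> 0"
  shows "C2 k f \<Longrightarrow> C2 k (\<lambda>U V. inverse (f U V))"
proof (induction k)
  case 0 then show ?case using assms by (auto intro: continuous_intros)
next
  case (Suc k)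
  from Suc.prems obtain fU fV where f: "has_partials f fU fV" "C2 k fU" "C2 k fV" by (rule C2_SucE)
  have IH: "C2 k (\<lambda>U V. inverse (f U V))" by (rule Suc.IH[OF C2_Suc_imp[OF Suc.prems]])
  have "has_partials (\<lambda>U V. inverse (f U V)) (\<lambda>U V. (- 1 * (inverse (f U V) * inverse (f U V))) * fU U V)
     (\<lambda>U V. (- 1 * (inverse (f U V) * inverse (f U V))) * fV U V)"
    by (rule has_partials_compose[OF f(1)]) (use assms in \<open>auto intro!: derivative_eq_intros simp: power2_eq_square\<close>)
  then show ?case by (rule C2_SucI) (intro C2_mult C2_const f IH)+
qed

lemmas C2_intros = C2_const C2_fst C2_snd C2_affine C2_add C2_diff C2_mult

lemma C2_swap: "C2 k f \<Longrightarrow> C2 k (\<lambda>U V. f V U)"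
proof (induction k arbitrary: f)
  case 0
  then have "continuous_on UNIV (\<lambda>p. f (fst p) (snd p))" by simp
  then have "continuous_on UNIV ((\<lambda>p. f (fst p) (snd p)) \<circ> (\<lambda>p::real\<times>real. (snd p, fst p)))"
    by (intro continuous_on_compose continuous_intros) (auto intro: continuous_on_subset)
  then show ?case by (simp add: o_def)
next
  case (Suc k)
  from Suc.prems obtain fU fV where f: "has_partials f fU fV" "C2 k fU" "C2 k fV" by (rule C2_SucE)
  have "has_partials (\<lambda>U V. f V U) (\<lambda>U V. fV V U) (\<lambda>U V. fU V U)"
    unfolding has_partials_def
  proof
    fix p :: "real \<times> real"
    have "((\<lambda>p::real\<times>real. (snd p, fst p)) has_derivative (\<lambda>h. (snd h, fst h))) (at p)"
      by (auto intro!: derivative_eq_intros)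
    from has_derivative_compose[OF this f(1)[unfolded has_partials_def, rule_format]]
    show "((\<lambda>p. f (snd p) (fst p)) has_derivative
       (\<lambda>h. fst h * fV (snd p) (fst p) + snd h * fU (snd p) (fst p))) (at p)"
      by (simp add: add.commute)
  qed
  then show ?case by (rule C2_SucI[OF _ Suc.IH[OF f(3)] Suc.IH[OF f(2)]])
qed

text \<open>Link to the smoothness notion of the problem: the derivative in a fixed direction
  \<open>v\<close> has the same shape again, with \<open>f\<close> replaced by a combination of its
  partials with constant coefficients.\<close>

lemma Ck_on_radial:
  "C2 k f \<Longrightarrow> Ck_on k UNIV (\<lambda>p::event. complex_of_real (f (fst p) (fst (snd p))))"
proof (induction k arbitrary: f)
  case 0
  then have "continuous_on UNIV (\<lambda>p. f (fst p) (snd p))" by simp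
  then have "continuous_on UNIV ((\<lambda>p. f (fst p) (snd p)) \<circ> (\<lambda>p::event. (fst p, fst (snd p))))"
    by (intro continuous_on_compose continuous_intros) (auto intro: continuous_on_subset)
  then show ?case by (auto simp: o_def intro!: continuous_intros)
next
  case (Suc k)
  from Suc.prems obtain fU fV where f: "has_partials f fU fV" "C2 k fU" "C2 k fV" by (rule C2_SucE)
  have d: "((\<lambda>p::event. complex_of_real (f (fst p) (fst (snd p)))) has_derivative
     (\<lambda>h. complex_of_real (fst h * fU (fst p) (fst (snd p)) + fst (snd h) * fV (fst p) (fst (snd p))))) (at p)" for p
  proof -
    have "((\<lambda>p::event. (fst p, fst (snd p))) has_derivative (\<lambda>h. (fst h, fst (snd h)))) (at p)"
      by (auto intro!: derivative_eq_intros)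
    from has_derivative_compose[OF this f(1)[unfolded has_partials_def, rule_format]]
    show ?thesis by (intro has_derivative_of_real) simp
  qed
  have "Ck_on k UNIV (\<lambda>p::event. frechet_derivative (\<lambda>p. complex_of_real (f (fst p) (fst (snd p)))) (at p) v)" for v
    unfolding frechet_derivative_at[OF d, symmetric]
    by (intro Suc.IH C2_add C2_mult C2_const f)
  moreover have "(\<lambda>p::event. complex_of_real (f (fst p) (fst (snd p)))) differentiable at p" for p
    using d differentiable_def by blast
  ultimately show ?case by simp
qed


section \<open>Oriented integrals along the two null directions, with parameters\<close>

section \<open>Integration in one variable\<close>

text \<open>The oriented integrals from \<open>b\<close> to \<open>V\<close> and from \<open>a\<close> to \<open>U\<close>, transported to \<open>[0, 1]\<close> so that
  no distinction between \<open>b \<le> V\<close> and \<open>V \<le> b\<close> is needed.\<close>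

definition int_snd :: "real \<Rightarrow> (real \<Rightarrow> real \<Rightarrow> real) \<Rightarrow> real \<Rightarrow> real \<Rightarrow> real" where
  "int_snd b g U V = (V - b) * integral {0..1} (\<lambda>s. g U (b + s * (V - b)))"

definition int_fst :: "real \<Rightarrow> (real \<Rightarrow> real \<Rightarrow> real) \<Rightarrow> real \<Rightarrow> real \<Rightarrow> real" where
  "int_fst a g U V = int_snd a (\<lambda>V U. g U V) V U"

lemma C2_0_compose:
  assumes "C2 0 g" "continuous_on S f" "continuous_on S h"
  shows "continuous_on S (\<lambda>x. g (f x) (h x))"
proof -
  have "continuous_on UNIV (\<lambda>p. g (fst p) (snd p))" using assms by simp
  from continuous_on_compose2[OF this continuous_on_Pair[OF assms(2,3)]]
  show ?thesis by simp
qed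

lemma C2_0_int_snd: "C2 0 g \<Longrightarrow> C2 0 (int_snd b g)"
proof -
  assume g: "C2 0 g"
  have "continuous_on (UNIV \<times> cbox 0 1) (\<lambda>(p, s). g (fst p) (b + s * (snd p - b)))"
    unfolding case_prod_beta by (intro C2_0_compose[OF g] continuous_intros)
  then have "continuous_on UNIV (\<lambda>p. integral (cbox 0 1) (\<lambda>s. g (fst p) (b + s * (snd p - b))))"
    by (rule integral_continuous_on_param)
  then show ?thesis by (auto simp: int_snd_def intro!: continuous_intros)
qed

lemma integrable_C2_0:
  assumes "C2 0 g"
  shows "(\<lambda>s. g U (b + s * (V - b))) integrable_on {0..1}"
  by (intro integrable_continuous_interval C2_0_compose[OF assms] continuous_intros)

text \<open>An antiderivative \<open>F\<close> of \<open>g U\<close> on the whole line turns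
  \<open>int_snd\<close> into \<open>F V - F b\<close> by substitution, whichever side of
  \<open>b\<close> the point \<open>V\<close> lies on.\<close>

lemma DERIV_int_snd:
  assumes "C2 0 g"
  shows "((\<lambda>V. int_snd b g U V) has_real_derivative g U V) (at V)"
proof -
  have "\<exists>F. \<forall>x::real. - \<infinity> < ereal x \<longrightarrow> ereal x < \<infinity> \<longrightarrow> (F has_vector_derivative g U x) (at x)"
  proof (rule einterval_antiderivative)
    have "continuous_on UNIV (\<lambda>x. g U x)" by (intro C2_0_compose[OF assms] continuous_intros)
    then show "isCont (\<lambda>x. g U x) x" for x by (simp add: continuous_on_eq_continuous_at)
  qed simp
  then obtain F where F: "\<And>x. (F has_real_derivative g U x) (at x)"
    by (auto simp: has_real_derivative_iff_has_vector_derivative)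
  have "int_snd b g U V = F V - F b" for V
  proof -
    have "((\<lambda>s. (V - b) * g U (b + s * (V - b))) has_integral F (b + 1 * (V - b)) - F (b + 0 * (V - b))) {0..1}"
    proof (rule fundamental_theorem_of_calculus)
      show "((\<lambda>s. F (b + s * (V - b))) has_vector_derivative (V - b) * g U (b + s * (V - b))) (at s within {0..1})" for s
        unfolding has_real_derivative_iff_has_vector_derivative[symmetric]
        by (rule DERIV_subset[of _ _ _ UNIV], rule DERIV_cong[OF DERIV_chain2[OF F]])
          (auto intro!: derivative_eq_intros)
    qed simp
    from integral_unique[OF this] show ?thesis unfolding int_snd_def by simp
  qed
  then show ?thesis using DERIV_diff[OF F DERIV_const[of "F b"]] by simp
qed

lemma DERIV_int_snd_param:
  assumes g: "C2 0 g" "C2 0 gU" and D: "\<And>U V. ((\<lambda>U. g U V) has_real_derivative gU U V) (at U)"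
  shows "((\<lambda>U. int_snd b g U V) has_real_derivative int_snd b gU U V) (at U)"
proof -
  have "((\<lambda>U. integral (cbox 0 1) (\<lambda>s. g U (b + s * (V - b)))) has_field_derivative
      integral (cbox 0 1) (\<lambda>s. gU U (b + s * (V - b)))) (at U within UNIV)"
  proof (rule leibniz_rule_field_derivative)
    show "continuous_on (UNIV \<times> cbox 0 1) (\<lambda>(U, s). gU U (b + s * (V - b)))"
      unfolding case_prod_beta by (intro C2_0_compose[OF g(2)] continuous_intros)
    show "((\<lambda>U. g U (b + s * (V - b))) has_field_derivative gU U (b + s * (V - b))) (at U within UNIV)" for U s
      using D by simp
    show "(\<lambda>s. g U (b + s * (V - b))) integrable_on cbox 0 1" for U
      using integrable_C2_0[OF g(1)] by simp
  qed auto
  from DERIV_cmult[OF this, of "V - b"] show ?thesis by (simp add: int_snd_def)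
qed

lemma has_partials_int_snd:
  assumes "C2 0 g" "has_partials g gU gV" "C2 0 gU"
  shows "has_partials (int_snd b g) (int_snd b gU) g"
  by (rule has_partialsI[OF DERIV_int_snd_param[OF assms(1,3) has_partials_DERIV(1)[OF assms(2)]]
        DERIV_int_snd[OF assms(1)] assms(1)])

lemma C2_int_snd: "C2 k g \<Longrightarrow> C2 k (int_snd b g)"
proof (induction k arbitrary: g)
  case 0 then show ?case by (rule C2_0_int_snd)
next
  case (Suc k)
  from Suc.prems obtain gU gV where g: "has_partials g gU gV" "C2 k gU" "C2 k gV" by (rule C2_SucE)
  show ?case
    by (rule C2_SucI[OF has_partials_int_snd[OF C2_0[OF Suc.prems] g(1) C2_0[OF g(2)]]
        Suc.IH[OF g(2)] C2_Suc_imp[OF Suc.prems]])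
qed

lemma C2_int_fst: "C2 k g \<Longrightarrow> C2 k (int_fst a g)"
  unfolding int_fst_def[abs_def] by (rule C2_swap[OF C2_int_snd[OF C2_swap]])

text \<open>Each differentiation undoes one of the two integrations, so continuity of
  \<open>g\<close> suffices. The double integral is thus one order smoother than \<open>g\<close>,
  which drives the regularity of the Goursat solution.\<close>

lemma has_partials_int_fst_int_snd:
  assumes g: "C2 0 g"
  shows "has_partials (int_fst a (int_snd b g)) (int_snd b g) (int_fst a g)"
proof (rule has_partialsI)
  show "((\<lambda>U. int_fst a (int_snd b g) U V) has_real_derivative int_snd b g U V) (at U)" for U V
    unfolding int_fst_def
    by (rule DERIV_int_snd[OF C2_swap[OF C2_0_int_snd[OF g]]])
  show "((\<lambda>V. int_fst a (int_snd b g) U V) has_real_derivative int_fst a g U V) (at V)" for U V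
    unfolding int_fst_def
    by (rule DERIV_int_snd_param[OF C2_swap[OF C2_0_int_snd[OF g]] C2_swap[OF g] DERIV_int_snd[OF g]])
  show "C2 0 (int_fst a g)" by (rule C2_int_fst[OF g])
qed

lemma int_snd_add:
  assumes "C2 0 f" "C2 0 g"
  shows "int_snd b (\<lambda>U V. f U V + g U V) U V = int_snd b f U V + int_snd b g U V"
  unfolding int_snd_def
  by (subst integral_add[OF integrable_C2_0[OF assms(1)] integrable_C2_0[OF assms(2)]]) (rule distrib_left)

lemma int_snd_cong: "(\<And>s. s \<in> {0..1} \<Longrightarrow> f U (b + s * (V - b)) = g U (b + s * (V - b))) \<Longrightarrow>
    int_snd b f U V = int_snd b g U V"
  unfolding int_snd_def by (rule arg_cong[OF integral_cong])

lemma int_fst_add: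
  assumes "C2 0 f" "C2 0 g"
  shows "int_fst a (\<lambda>U V. f U V + g U V) U V = int_fst a f U V + int_fst a g U V"
  unfolding int_fst_def using int_snd_add[OF assms[THEN C2_swap]] .

lemma int_snd_bound:
  assumes "C2 0 g" "\<And>s. s \<in> {0..1} \<Longrightarrow> \<bar>g U (b + s * (V - b))\<bar> \<le> M"
  shows "\<bar>int_snd b g U V\<bar> \<le> M * \<bar>V - b\<bar>"
proof -
  have "norm (integral {0..1} (\<lambda>s. g U (b + s * (V - b)))) \<le> integral {0..1} (\<lambda>s::real. M)"
    using assms by (intro integral_norm_bound_integral integrable_C2_0) auto
  then show ?thesis
    unfolding int_snd_def abs_mult by (subst mult.commute) (simp add: mult_right_mono)
qed

text \<open>Integrating an exponential of rate \<open>c\<close> gains the factor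
  \<open>1 / c\<close>; this is the gain of the weighted norm in the Picard estimate.\<close>

lemma int_fst_bound_exp:
  assumes g: "C2 0 g" and l: "c > 0" and M: "M \<ge> 0"
    and b: "\<And>s. s \<in> {0..1} \<Longrightarrow> \<bar>g (a + s * (U - a)) V\<bar> \<le> M * exp (c * (s * \<bar>U - a\<bar>))"
  shows "\<bar>int_fst a g U V\<bar> \<le> M / c * exp (c * \<bar>U - a\<bar>)"
proof -
  have h: "((\<lambda>s. \<bar>U - a\<bar> * (M * exp (c * (s * \<bar>U - a\<bar>)))) has_integral
      M / c * exp (c * (1 * \<bar>U - a\<bar>)) - M / c * exp (c * (0 * \<bar>U - a\<bar>))) {0..1}"
    by (rule fundamental_theorem_of_calculus)
      (use l in \<open>auto simp: has_real_derivative_iff_has_vector_derivative[symmetric] intro!: derivative_eq_intros\<close>)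
  have "norm (integral {0..1} (\<lambda>s. (U - a) * g (a + s * (U - a)) V))
      \<le> integral {0..1} (\<lambda>s. \<bar>U - a\<bar> * (M * exp (c * (s * \<bar>U - a\<bar>))))"
  proof (intro integral_norm_bound_integral)
    show "(\<lambda>s. (U - a) * g (a + s * (U - a)) V) integrable_on {0..1}"
      by (intro integrable_continuous_interval continuous_intros C2_0_compose[OF g])
    show "norm ((U - a) * g (a + s * (U - a)) V) \<le> \<bar>U - a\<bar> * (M * exp (c * (s * \<bar>U - a\<bar>)))"
      if "s \<in> {0..1}" for s
      using b[OF that] by (simp add: abs_mult mult_left_mono)
  qed (rule has_integral_integrable[OF h])
  also have "\<dots> \<le> M / c * exp (c * \<bar>U - a\<bar>)" using l M integral_unique[OF h] by simp
  finally show ?thesis by (simp add: int_fst_def int_snd_def)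
qed

lemma C2_0_bounded:
  assumes "C2 0 f"
  shows "\<exists>M>0. \<forall>U V. \<bar>U\<bar> \<le> L \<longrightarrow> \<bar>V\<bar> \<le> L \<longrightarrow> \<bar>f U V\<bar> \<le> M"
proof -
  have "compact ((\<lambda>p. f (fst p) (snd p)) ` ({-L..L} \<times> {-L..L}))"
    using assms by (intro compact_continuous_image compact_Times) (auto elim: continuous_on_subset)
  from compact_imp_bounded[OF this]
  obtain M where M: "M > 0" "\<And>x. x \<in> (\<lambda>p. f (fst p) (snd p)) ` ({-L..L} \<times> {-L..L}) \<Longrightarrow> norm x \<le> M"
    unfolding bounded_pos by blast
  have "\<bar>f U V\<bar> \<le> M" if "\<bar>U\<bar> \<le> L" "\<bar>V\<bar> \<le> L" for U V
    using M(2)[OF imageI[of "(U, V)"]] that by (simp add: abs_le_iff)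
  with \<open>M > 0\<close> show ?thesis by blast
qed


section \<open>Neumann series for the integral form of a linear equation with mixed second
  derivative\<close>

section \<open>The Goursat problem\<close>

context
  fixes Q f0 :: "real \<Rightarrow> real \<Rightarrow> real" and a b :: real
  assumes Q0: "C2 0 Q" and f00: "C2 0 f0"
begin

text \<open>These are the terms of the Neumann series of \<open>\<psi> = f0 + I (Q \<psi>)\<close>,
  with \<open>I\<close> the double integral from the base lines \<open>a\<close> and
  \<open>b\<close>; the Picard iterates are their partial sums.\<close>

primrec picard :: "nat \<Rightarrow> real \<Rightarrow> real \<Rightarrow> real" where
  "picard 0 = f0"
| "picard (Suc n) = int_fst a (int_snd b (\<lambda>U V. Q U V * picard n U V))"

lemma C2_0_picard: "C2 0 (picard n)"
proof (induction n)
  case 0 show ?case using f00 by simp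
next
  case (Suc n)
  show ?case unfolding picard.simps by (intro C2_int_fst C2_int_snd C2_mult Q0 Suc)
qed

text \<open>The exponential weight turns one application of the integral operator into a contraction by \<open>1 / 2\<close>.\<close>

lemma picard_bound:
  assumes K: "K > 0" and B: "B > 0" and M: "M \<ge> 0"
    and Qb: "\<And>U V. \<bar>U - a\<bar> \<le> A \<Longrightarrow> \<bar>V - b\<bar> \<le> B \<Longrightarrow> \<bar>Q U V\<bar> \<le> K"
    and fb: "\<And>U V. \<bar>U - a\<bar> \<le> A \<Longrightarrow> \<bar>V - b\<bar> \<le> B \<Longrightarrow> \<bar>f0 U V\<bar> \<le> M"
  shows "\<bar>U - a\<bar> \<le> A \<Longrightarrow> \<bar>V - b\<bar> \<le> B \<Longrightarrow>
    \<bar>picard n U V\<bar> \<le> M * (1 / 2) ^ n * exp (2 * K * B * \<bar>U - a\<bar>)"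
proof (induction n arbitrary: U V)
  case 0
  have "M * 1 \<le> M * exp (2 * K * B * \<bar>U - a\<bar>)" using K B M by (intro mult_left_mono) auto
  then show ?case using fb[OF 0] by simp
next
  case (Suc n)
  let ?g = "\<lambda>U V. Q U V * picard n U V" and ?N = "K * B * (M * (1 / 2) ^ n)"
  have g: "C2 0 ?g" by (intro C2_mult Q0 C2_0_picard)
  have "\<bar>int_snd b ?g (a + s * (U - a)) V\<bar> \<le> ?N * exp (2 * K * B * (s * \<bar>U - a\<bar>))"
    if s: "s \<in> {0..1}" for s
  proof -
    let ?u = "a + s * (U - a)"
    have u: "\<bar>?u - a\<bar> = s * \<bar>U - a\<bar>" using s by (simp add: abs_mult)
    have "s * \<bar>U - a\<bar> \<le> 1 * \<bar>U - a\<bar>" using s by (intro mult_right_mono) auto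
    then have uA: "\<bar>?u - a\<bar> \<le> A" using Suc.prems(1) unfolding u by simp
    have "\<bar>int_snd b ?g ?u V\<bar> \<le> K * (M * (1 / 2) ^ n * exp (2 * K * B * \<bar>?u - a\<bar>)) * \<bar>V - b\<bar>"
    proof (rule int_snd_bound[OF g])
      fix t :: real assume t: "t \<in> {0..1}"
      have "t * \<bar>V - b\<bar> \<le> 1 * \<bar>V - b\<bar>" using t by (intro mult_right_mono) auto
      then have tB: "\<bar>(b + t * (V - b)) - b\<bar> \<le> B" using Suc.prems(2) t by (simp add: abs_mult)
      show "\<bar>Q ?u (b + t * (V - b)) * picard n ?u (b + t * (V - b))\<bar>
          \<le> K * (M * (1 / 2) ^ n * exp (2 * K * B * \<bar>?u - a\<bar>))" unfolding abs_mult
        by (rule mult_mono[OF Qb[OF uA tB] Suc.IH[OF uA tB, unfolded abs_mult]]) (use K in auto)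
    qed
    also have "\<dots> \<le> K * (M * (1 / 2) ^ n * exp (2 * K * B * \<bar>?u - a\<bar>)) * B"
      using Suc.prems(2) K M by (intro mult_left_mono) auto
    finally show ?thesis unfolding u by (simp add: mult_ac)
  qed
  \<comment> \<open>The V-integration costs \<open>K * B\<close>; the rate \<open>2 * K * B\<close>
    of the weight divides it down to one half.\<close>
  then have "\<bar>picard (Suc n) U V\<bar> \<le> ?N / (2 * K * B) * exp (2 * K * B * \<bar>U - a\<bar>)"
    unfolding picard.simps using K B M by (intro int_fst_bound_exp[OF C2_int_snd[OF g]]) auto
  also have "?N / (2 * K * B) = M * (1 / 2) ^ Suc n" using K B by simp
  finally show ?case .
qed

lemma box_bound:
  assumes "C2 0 g"
  shows "\<exists>M>0. \<forall>U V. \<bar>U - a\<bar> \<le> A \<longrightarrow> \<bar>V - b\<bar> \<le> A \<longrightarrow> \<bar>g U V\<bar> \<le> M"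
proof -
  obtain M where M: "M > 0" "\<And>U V. \<bar>U\<bar> \<le> \<bar>a\<bar> + \<bar>b\<bar> + A \<Longrightarrow> \<bar>V\<bar> \<le> \<bar>a\<bar> + \<bar>b\<bar> + A \<Longrightarrow> \<bar>g U V\<bar> \<le> M"
    using C2_0_bounded[OF assms, of "\<bar>a\<bar> + \<bar>b\<bar> + A"] by blast
  have "\<bar>g U V\<bar> \<le> M" if "\<bar>U - a\<bar> \<le> A" "\<bar>V - b\<bar> \<le> A" for U V
    using that by (intro M(2)) auto
  with M(1) show ?thesis by blast
qed

lemma picard_geometric:
  "\<exists>C>0. \<forall>U V n. \<bar>U - a\<bar> \<le> A \<longrightarrow> \<bar>V - b\<bar> \<le> A \<longrightarrow> \<bar>picard n U V\<bar> \<le> C * (1 / 2) ^ n"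
proof -
  \<comment> \<open>\<open>picard_bound\<close> needs a positive width, whereas \<open>A\<close> is
    arbitrary here.\<close>
  define A' where "A' = max A 1"
  have A': "A' > 0" "A \<le> A'" by (auto simp: A'_def)
  obtain K where K: "K > 0" "\<And>U V. \<bar>U - a\<bar> \<le> A' \<Longrightarrow> \<bar>V - b\<bar> \<le> A' \<Longrightarrow> \<bar>Q U V\<bar> \<le> K"
    using box_bound[OF Q0, of A'] by blast
  obtain M where M: "M > 0" "\<And>U V. \<bar>U - a\<bar> \<le> A' \<Longrightarrow> \<bar>V - b\<bar> \<le> A' \<Longrightarrow> \<bar>f0 U V\<bar> \<le> M"
    using box_bound[OF f00, of A'] by blast
  have "\<bar>picard n U V\<bar> \<le> (M * exp (2 * K * A' * A')) * (1 / 2) ^ n"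
    if "\<bar>U - a\<bar> \<le> A" "\<bar>V - b\<bar> \<le> A" for U V n
  proof -
    have le: "\<bar>U - a\<bar> \<le> A'" "\<bar>V - b\<bar> \<le> A'" using that A' by auto
    have "\<bar>picard n U V\<bar> \<le> M * (1 / 2) ^ n * exp (2 * K * A' * \<bar>U - a\<bar>)"
      by (rule picard_bound[OF K(1) A'(1) less_imp_le[OF M(1)] K(2) M(2) le])
    also have "\<dots> \<le> M * (1 / 2) ^ n * exp (2 * K * A' * A')"
      using M(1) K(1) A'(1) le by (intro mult_left_mono) auto
    finally show ?thesis by (simp add: mult_ac)
  qed
  moreover have "M * exp (2 * K * A' * A') > 0" using M by simp
  ultimately show ?thesis by blast
qed

definition goursat :: "real \<Rightarrow> real \<Rightarrow> real" where
  "goursat U V = (\<Sum>n. picard n U V)"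

lemma summable_picard: "summable (\<lambda>n. picard n U V)"
proof -
  obtain C where C: "\<And>U' V' n. \<bar>U' - a\<bar> \<le> max \<bar>U - a\<bar> \<bar>V - b\<bar> \<Longrightarrow> \<bar>V' - b\<bar> \<le> max \<bar>U - a\<bar> \<bar>V - b\<bar> \<Longrightarrow>
      \<bar>picard n U' V'\<bar> \<le> C * (1 / 2) ^ n"
    using picard_geometric[of "max \<bar>U - a\<bar> \<bar>V - b\<bar>"] by blast
  show ?thesis
    by (rule summable_comparison_test'[where g = "\<lambda>n. C * (1 / 2) ^ n" and N = 0])
      (auto intro!: summable_mult summable_geometric C)
qed

lemma goursat_tail:
  assumes C: "\<And>n. \<bar>picard n U V\<bar> \<le> C * (1 / 2) ^ n"
  shows "\<bar>goursat U V - (\<Sum>n<N. picard n U V)\<bar> \<le> 2 * C * (1 / 2) ^ N"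
proof -
  have "goursat U V - (\<Sum>n<N. picard n U V) = (\<Sum>n. picard (n + N) U V)"
    unfolding goursat_def by (subst suminf_split_initial_segment[OF summable_picard, of _ _ N]) simp
  also have "\<bar>\<dots>\<bar> \<le> (\<Sum>n. C * (1 / 2) ^ N * (1 / 2) ^ n)"
  proof (rule norm_suminf_le[of "\<lambda>n. picard (n + N) U V", unfolded real_norm_def])
    show "\<bar>picard (n + N) U V\<bar> \<le> C * (1 / 2) ^ N * (1 / 2) ^ n" for n
      using C[of "n + N"] by (simp add: power_add mult_ac)
  qed (auto intro!: summable_mult summable_geometric)
  also have "\<dots> = 2 * C * (1 / 2) ^ N"
    by (subst suminf_mult) (auto simp: suminf_geometric summable_geometric)
  finally show ?thesis .
qed

text \<open>The geometric bound gives uniform convergence on every open box around the base point by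
  the M-test, and these boxes exhaust the plane.\<close>

lemma C2_0_goursat: "C2 0 goursat"
proof -
  define R where "R A = {p::real \<times> real. \<bar>fst p - a\<bar> < A \<and> \<bar>snd p - b\<bar> < A}" for A
  have op: "open (R A)" for A
    unfolding R_def by (intro open_Collect_conj open_Collect_less continuous_intros)
  have con: "continuous_on (R A) (\<lambda>p. goursat (fst p) (snd p))" for A
  proof -
    obtain C where C: "C > 0" "\<And>U V n. \<bar>U - a\<bar> \<le> A \<Longrightarrow> \<bar>V - b\<bar> \<le> A \<Longrightarrow> \<bar>picard n U V\<bar> \<le> C * (1 / 2) ^ n"
      using picard_geometric[of A] by blast
    have "uniform_limit (R A) (\<lambda>N p. \<Sum>n<N. picard n (fst p) (snd p)) (\<lambda>p. \<Sum>n. picard n (fst p) (snd p)) sequentially"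
      by (rule Weierstrass_m_test[where M = "\<lambda>n. C * (1 / 2) ^ n"])
        (auto simp: R_def intro!: C summable_mult summable_geometric)
    then show ?thesis unfolding goursat_def
      by (rule uniform_limit_theorem[rotated])
        (auto intro!: always_eventually continuous_intros C2_0_compose[OF C2_0_picard])
  qed
  have "UNIV = (\<Union>A. R A)"
  proof (intro set_eqI iffI)
    fix p :: "real \<times> real"
    have "p \<in> R (max \<bar>fst p - a\<bar> \<bar>snd p - b\<bar> + 1)" by (auto simp: R_def)
    then show "p \<in> (\<Union>A. R A)" by blast
  qed simp
  moreover have "continuous_on (\<Union>A. R A) (\<lambda>p. goursat (fst p) (snd p))"
    by (rule continuous_on_open_UN[OF op con])
  ultimately show ?thesis by simp
qed

text \<open>The partial sums satisfy \<open>S (Suc N) = f0 + I (S N)\<close>. The tail estimate on a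
  box containing the rectangle of integration allows the limit to pass through the integral operator
  \<open>I\<close>.\<close>

lemma goursat_eq:
  "goursat U V = f0 U V + int_fst a (int_snd b (\<lambda>U V. Q U V * goursat U V)) U V"
proof -
  define S where "S N U V = (\<Sum>n<N. picard n U V)" for N U V
  let ?I = "\<lambda>g. int_fst a (int_snd b (\<lambda>U V. Q U V * g U V))"
  define A where "A = max \<bar>U - a\<bar> \<bar>V - b\<bar> + 1"
  obtain C where C: "C > 0" "\<And>U V n. \<bar>U - a\<bar> \<le> A \<Longrightarrow> \<bar>V - b\<bar> \<le> A \<Longrightarrow> \<bar>picard n U V\<bar> \<le> C * (1 / 2) ^ n"
    using picard_geometric[of A] by blast
  obtain K where K: "K > 0" "\<And>U V. \<bar>U - a\<bar> \<le> A \<Longrightarrow> \<bar>V - b\<bar> \<le> A \<Longrightarrow> \<bar>Q U V\<bar> \<le> K"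
    using box_bound[OF Q0, of A] by blast
  have S0: "C2 0 (S N)" for N
  proof (induction N)
    case 0 then show ?case unfolding S_def by (simp add: S_def)
  next
    case (Suc N)
    have "S (Suc N) = (\<lambda>U V. S N U V + picard N U V)" by (simp add: S_def fun_eq_iff)
    then show ?case using C2_add[OF Suc C2_0_picard] by simp
  qed
  have add: "?I (\<lambda>U V. g U V + h U V) U V = ?I g U V + ?I h U V" if "C2 0 g" "C2 0 h" for g h U V
  proof -
    have gh: "C2 0 (\<lambda>U V. Q U V * g U V)" "C2 0 (\<lambda>U V. Q U V * h U V)" using that Q0 by (blast intro: C2_mult)+
    have "int_snd b (\<lambda>U V. Q U V * (g U V + h U V))
        = (\<lambda>U V. int_snd b (\<lambda>U V. Q U V * g U V) U V + int_snd b (\<lambda>U V. Q U V * h U V) U V)"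
      unfolding distrib_left by (intro ext int_snd_add gh)
    then show ?thesis by (simp only: int_fst_add[OF C2_int_snd[OF gh(1)] C2_int_snd[OF gh(2)]])
  qed
  have SI: "S (Suc N) U V = f0 U V + ?I (S N) U V" for N U V
  proof (induction N)
    case 0
    have "?I (S 0) U V = 0" by (simp add: S_def int_fst_def int_snd_def)
    then show ?case by (simp add: S_def)
  next
    case (Suc N)
    have "S (Suc N) = (\<lambda>U V. S N U V + picard N U V)" by (simp add: S_def fun_eq_iff)
    then have "?I (S (Suc N)) U V = ?I (S N) U V + picard (Suc N) U V"
      using add[OF S0 C2_0_picard, of N N U V] by simp
    then show ?case using Suc by (simp add: S_def)
  qed
  have diff: "\<bar>?I goursat U V - ?I (S N) U V\<bar> \<le> (K * (2 * C) * A * A) * (1 / 2) ^ N" for N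
  proof -
    let ?h = "\<lambda>U V. goursat U V - S N U V"
    have h: "C2 0 ?h" by (intro C2_diff C2_0_goursat S0)
    have Qh: "C2 0 (\<lambda>U V. Q U V * ?h U V)" by (intro C2_mult Q0 h)
    have "goursat = (\<lambda>U V. S N U V + ?h U V)" by simp
    then have "?I goursat U V = ?I (S N) U V + ?I ?h U V"
      using add[OF S0 h, of N U V] by simp
    then have eq: "?I goursat U V - ?I (S N) U V = ?I ?h U V" by simp
    have Vb: "\<bar>V - b\<bar> \<le> A" and Ua: "\<bar>U - a\<bar> \<le> A" by (auto simp: A_def)
    have "\<bar>?I ?h U V\<bar> \<le> (K * (2 * C * (1 / 2) ^ N) * \<bar>V - b\<bar>) * \<bar>U - a\<bar>"
      unfolding int_fst_def
    proof (rule int_snd_bound[OF C2_swap[OF C2_int_snd[OF Qh]]])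
      fix s :: real assume s: "s \<in> {0..1}"
      show "\<bar>int_snd b (\<lambda>U V. Q U V * ?h U V) (a + s * (U - a)) V\<bar> \<le> K * (2 * C * (1 / 2) ^ N) * \<bar>V - b\<bar>"
      proof (rule int_snd_bound[OF Qh])
        fix t :: real assume t: "t \<in> {0..1}"
        have "s * \<bar>U - a\<bar> \<le> 1 * \<bar>U - a\<bar>" "t * \<bar>V - b\<bar> \<le> 1 * \<bar>V - b\<bar>"
          by (intro mult_right_mono; use s t in simp)+
        then have *: "\<bar>(a + s * (U - a)) - a\<bar> \<le> A" "\<bar>(b + t * (V - b)) - b\<bar> \<le> A"
          using Ua Vb s t by (simp_all add: abs_mult)
        show "\<bar>Q (a + s * (U - a)) (b + t * (V - b)) * ?h (a + s * (U - a)) (b + t * (V - b))\<bar>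
            \<le> K * (2 * C * (1 / 2) ^ N)" unfolding abs_mult S_def
          by (rule mult_mono[OF K(2)[OF *] goursat_tail[OF C(2)[OF *]]]) (use K(1) in auto)
      qed
    qed
    also have "\<dots> \<le> K * (2 * C * (1 / 2) ^ N) * A * A"
      using K(1) C(1) Ua Vb by (intro mult_mono mult_left_mono) auto
    finally show ?thesis unfolding eq by (simp add: mult_ac)
  qed
  have z: "(\<lambda>N. (K * (2 * C) * A * A) * (1 / 2) ^ N) \<longlonglongrightarrow> 0"
    using tendsto_mult[OF tendsto_const LIMSEQ_power_zero[of "1 / 2 :: real"], of "K * (2 * C) * A * A"] by simp
  have "(\<lambda>N. ?I goursat U V - ?I (S N) U V) \<longlonglongrightarrow> 0"
    by (rule Lim_null_comparison[OF _ z]) (simp only: real_norm_def diff eventually_True)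
  from tendsto_diff[OF tendsto_const this]
  have "(\<lambda>N. (f0 U V + ?I goursat U V) - (?I goursat U V - ?I (S N) U V)) \<longlonglongrightarrow> (f0 U V + ?I goursat U V) - 0" .
  moreover have "(f0 U V + ?I goursat U V) - (?I goursat U V - ?I (S N) U V) = S (Suc N) U V" for N
    unfolding SI by simp
  ultimately have "(\<lambda>N. S (Suc N) U V) \<longlonglongrightarrow> f0 U V + ?I goursat U V" by simp
  moreover have "(\<lambda>N. S N U V) \<longlonglongrightarrow> goursat U V"
    unfolding S_def goursat_def by (rule summable_LIMSEQ[OF summable_picard])
  ultimately show ?thesis by (rule LIMSEQ_unique[OF LIMSEQ_Suc, rotated])
qed

lemma goursat_bound:
  assumes K: "K > 0" and A: "A > 0" and M: "M \<ge> 0"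
    and Qb: "\<And>U V. \<bar>U - a\<bar> \<le> A \<Longrightarrow> \<bar>V - b\<bar> \<le> A \<Longrightarrow> \<bar>Q U V\<bar> \<le> K"
    and fb: "\<And>U V. \<bar>U - a\<bar> \<le> A \<Longrightarrow> \<bar>V - b\<bar> \<le> A \<Longrightarrow> \<bar>f0 U V\<bar> \<le> M"
    and UV: "\<bar>U - a\<bar> \<le> A" "\<bar>V - b\<bar> \<le> A"
  shows "\<bar>goursat U V\<bar> \<le> 2 * exp (2 * K * A * A) * M"
proof -
  have "\<bar>picard n U V\<bar> \<le> (M * exp (2 * K * A * A)) * (1 / 2) ^ n" for n
  proof -
    have "\<bar>picard n U V\<bar> \<le> M * (1 / 2) ^ n * exp (2 * K * A * \<bar>U - a\<bar>)"
      by (rule picard_bound[OF K A M Qb fb UV])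
    also have "\<dots> \<le> M * (1 / 2) ^ n * exp (2 * K * A * A)"
      using M K A UV by (intro mult_left_mono) auto
    finally show ?thesis by (simp add: mult_ac)
  qed
  from goursat_tail[OF this, of 0] show ?thesis by (simp add: mult_ac)
qed

text \<open>Domain of dependence: the value at a point involves only the rectangle spanned by it and
  the base point. If the set \<open>S\<close> contains this rectangle for each of its points, every
  term of the series inherits the zeros of \<open>f0\<close> on \<open>S\<close>.\<close>

lemma goursat_zero:
  assumes S: "\<And>U V s t. S U V \<Longrightarrow> s \<in> {0..1} \<Longrightarrow> t \<in> {0..1} \<Longrightarrow> S (a + s * (U - a)) (b + t * (V - b))"
    and f: "\<And>U V. S U V \<Longrightarrow> f0 U V = 0" and UV: "S U V"
  shows "goursat U V = 0"
proof -
  have "S U V \<Longrightarrow> picard n U V = 0" for n U V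
  proof (induction n arbitrary: U V)
    case 0 then show ?case using f by simp
  next
    case (Suc n)
    have "int_snd b (\<lambda>U V. Q U V * picard n U V) (a + s * (U - a)) V = 0" if "s \<in> {0..1}" for s
    proof -
      have "int_snd b (\<lambda>U V. Q U V * picard n U V) (a + s * (U - a)) V
          = int_snd b (\<lambda>U V. 0) (a + s * (U - a)) V"
        by (rule int_snd_cong) (simp add: Suc.IH[OF S[OF Suc.prems that]])
      then show ?thesis by (simp add: int_snd_def)
    qed
    then have "int_fst a (int_snd b (\<lambda>U V. Q U V * picard n U V)) U V = int_fst a (\<lambda>U V. 0) U V"
      unfolding int_fst_def by (intro int_snd_cong) simp
    then show ?case by (simp add: int_fst_def int_snd_def)
  qed
  then show ?thesis using UV by (simp add: goursat_def)
qed

text \<open>Bootstrap on the integral equation: if the solution has order \<open>k\<close>, the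
  double integral on the right-hand side has order \<open>k + 1\<close>.\<close>

lemma C2_goursat:
  assumes Q: "\<And>k. C2 k Q" and f: "\<And>k. C2 k f0"
  shows "C2 k goursat"
proof (induction k)
  case 0 show ?case by (rule C2_0_goursat)
next
  case (Suc k)
  have g: "C2 k (\<lambda>U V. Q U V * goursat U V)" by (intro C2_mult Q Suc)
  have "goursat = (\<lambda>U V. f0 U V + int_fst a (int_snd b (\<lambda>U V. Q U V * goursat U V)) U V)"
    by (intro ext goursat_eq)
  moreover have "C2 (Suc k) \<dots>"
    by (intro C2_add f C2_SucI[OF has_partials_int_fst_int_snd[OF C2_0[OF g]]] C2_int_snd C2_int_fst g)
  ultimately show ?case by simp
qed

end

lemma goursat_zero_on:
  assumes Q0: "C2 0 Q" and f00: "C2 0 f0"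
    and S: "\<And>U V s t. S U V \<Longrightarrow> s \<in> {0..1} \<Longrightarrow> t \<in> {0..1} \<Longrightarrow> S (a + s * (U - a)) (b + t * (V - b))"
    and f: "\<And>U V. S U V \<Longrightarrow> f0 U V = 0" and UV: "S U V"
  defines "\<psi> \<equiv> goursat Q f0 a b"
  shows "\<psi> U V = 0" "int_snd b (\<lambda>U V. Q U V * \<psi> U V) U V = 0" "int_fst a (\<lambda>U V. Q U V * \<psi> U V) U V = 0"
proof -
  have z: "S U V \<Longrightarrow> \<psi> U V = 0" for U V unfolding \<psi>_def by (rule goursat_zero[where S = S, OF Q0 f00 S f])
  show "\<psi> U V = 0" by (rule z[OF UV])
  have "S U (b + t * (V - b))" if "t \<in> {0..1}" for t using S[OF UV, of 1 t] that by simp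
  then have "int_snd b (\<lambda>U V. Q U V * \<psi> U V) U V = int_snd b (\<lambda>U V. 0) U V"
    by (intro int_snd_cong) (simp add: z)
  then show "int_snd b (\<lambda>U V. Q U V * \<psi> U V) U V = 0" by (simp add: int_snd_def)
  have "S (a + t * (U - a)) V" if "t \<in> {0..1}" for t using S[OF UV, of t 1] that by simp
  then have "int_fst a (\<lambda>U V. Q U V * \<psi> U V) U V = int_fst a (\<lambda>U V. 0) U V"
    unfolding int_fst_def by (intro int_snd_cong) (simp add: z)
  then show "int_fst a (\<lambda>U V. Q U V * \<psi> U V) U V = 0" by (simp add: int_fst_def int_snd_def)
qed

text \<open>The two single integrals are what the first derivatives of the solution contain besides
  those of \<open>f0\<close>. They are controlled by the supremum of \<open>f0\<close> alone, with
  constants that see no derivative of \<open>f0\<close>; this is why the correction of a steep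
  profile stays small.\<close>

lemma goursat_integral_bounds:
  assumes Q0: "C2 0 Q" and f00: "C2 0 f0" and K: "K > 0" and A: "A > 0" and M: "M \<ge> 0"
    and Qb: "\<And>U V. \<bar>U - a\<bar> \<le> A \<Longrightarrow> \<bar>V - b\<bar> \<le> A \<Longrightarrow> \<bar>Q U V\<bar> \<le> K"
    and fb: "\<And>U V. \<bar>f0 U V\<bar> \<le> M"
    and UV: "\<bar>U - a\<bar> \<le> A" "\<bar>V - b\<bar> \<le> A"
  defines "\<psi> \<equiv> goursat Q f0 a b" and "G \<equiv> 2 * exp (2 * K * A * A)"
  shows "\<bar>\<psi> U V\<bar> \<le> G * M" "\<bar>int_snd b (\<lambda>U V. Q U V * \<psi> U V) U V\<bar> \<le> K * G * A * M"
    "\<bar>int_fst a (\<lambda>U V. Q U V * \<psi> U V) U V\<bar> \<le> K * G * A * M"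
proof -
  have p: "\<bar>\<psi> U V\<bar> \<le> G * M" if "\<bar>U - a\<bar> \<le> A" "\<bar>V - b\<bar> \<le> A" for U V
    unfolding \<psi>_def G_def by (rule goursat_bound[OF Q0 f00 K A M Qb fb that])
  then show "\<bar>\<psi> U V\<bar> \<le> G * M" using UV .
  have Qp: "\<bar>Q U V * \<psi> U V\<bar> \<le> K * (G * M)" if "\<bar>U - a\<bar> \<le> A" "\<bar>V - b\<bar> \<le> A" for U V
    unfolding abs_mult by (rule mult_mono[OF Qb[OF that] p[OF that]]) (use K in auto)
  have C: "C2 0 (\<lambda>U V. Q U V * \<psi> U V)" unfolding \<psi>_def by (intro C2_mult Q0 C2_0_goursat[OF Q0 f00])
  have sc: "\<bar>(c + t * (x - c)) - c\<bar> \<le> A" if "\<bar>x - c\<bar> \<le> A" "t \<in> {0..1}" for c t x :: real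
  proof -
    have "t * \<bar>x - c\<bar> \<le> 1 * \<bar>x - c\<bar>" using that by (intro mult_right_mono) auto
    then show ?thesis using that by (simp add: abs_mult)
  qed
  have G: "G \<ge> 0" by (simp add: G_def)
  have mono: "K * (G * M) * \<bar>y\<bar> \<le> K * G * A * M" if "\<bar>y\<bar> \<le> A" for y
    using mult_left_mono[OF that, of "K * (G * M)"] K G M by (simp add: mult_ac)
  have "\<bar>int_snd b (\<lambda>U V. Q U V * \<psi> U V) U V\<bar> \<le> K * (G * M) * \<bar>V - b\<bar>"
    by (rule int_snd_bound[OF C]) (rule Qp[OF UV(1) sc[OF UV(2)]])
  then show "\<bar>int_snd b (\<lambda>U V. Q U V * \<psi> U V) U V\<bar> \<le> K * G * A * M" using mono[OF UV(2)] by linarith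
  have "\<bar>int_fst a (\<lambda>U V. Q U V * \<psi> U V) U V\<bar> \<le> K * (G * M) * \<bar>U - a\<bar>"
    unfolding int_fst_def by (rule int_snd_bound[OF C2_swap[OF C]]) (rule Qp[OF sc[OF UV(1)] UV(2)])
  then show "\<bar>int_fst a (\<lambda>U V. Q U V * \<psi> U V) U V\<bar> \<le> K * G * A * M" using mono[OF UV(1)] by linarith
qed


section \<open>Smooth profiles of compact support and a smooth cut-off\<close>

section \<open>Bump functions\<close>

text \<open>The span of these functions is closed under differentiation.\<close>

definition flat :: "nat \<Rightarrow> real \<Rightarrow> real" where
  "flat n x = (if x \<le> 0 then 0 else exp (- 1 / x) / x ^ n)"

lemma flat_tendsto_0: "(flat n \<longlongrightarrow> 0) (at 0)"
proof (rule filterlim_split_at)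
  have "eventually (\<lambda>x::real. 0 = flat n x) (at_left 0)"
    by (auto simp: eventually_at_filter flat_def intro: always_eventually)
  then show "(flat n \<longlongrightarrow> 0) (at_left 0)" by (rule Lim_transform_eventually[OF tendsto_const])
  have "((\<lambda>x. inverse x ^ n / exp (inverse x)) \<longlongrightarrow> 0) (at_right (0::real))"
    by (rule filterlim_compose[OF tendsto_power_div_exp_0 filterlim_inverse_at_top_right])
  moreover have "eventually (\<lambda>x::real. inverse x ^ n / exp (inverse x) = flat n x) (at_right 0)"
    by (auto simp: eventually_at_filter flat_def exp_minus field_simps power_inverse intro!: always_eventually)
  ultimately show "(flat n \<longlongrightarrow> 0) (at_right 0)" by (rule Lim_transform_eventually)
qed

lemma DERIV_flat:
  "(flat n has_real_derivative flat (Suc (Suc n)) x - real n * flat (Suc n) x) (at x)"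
proof -
  consider "x < 0" | "x = 0" | "x > 0" by linarith
  then show ?thesis
  proof cases
    case 1
    have "((\<lambda>x. 0) has_real_derivative 0) (at x)" by simp
    moreover have ev: "eventually (\<lambda>y. 0 = flat n y) (nhds x)"
    proof (rule eventually_mono)
      show "eventually (\<lambda>y. y \<in> {..<0}) (nhds x)" using 1 by (intro eventually_nhds_in_open) auto
    qed (simp add: flat_def)
    ultimately have "(flat n has_real_derivative 0) (at x)" by (simp only: DERIV_cong_ev[OF refl ev refl])
    then show ?thesis using 1 by (simp add: flat_def)
  next
    case 2
    \<comment> \<open>The difference quotient at 0 is itself a member of the family, so its limit is
      already known.\<close>
    have "(\<lambda>h. (flat n (0 + h) - flat n 0) / h) = flat (Suc n)" by (auto simp: flat_def fun_eq_iff)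
    then have "(flat n has_real_derivative 0) (at 0)" using flat_tendsto_0[of "Suc n"] by (simp add: DERIV_def)
    then show ?thesis using 2 by (simp add: flat_def)
  next
    case 3
    have "((\<lambda>x. exp (- 1 / x) / x ^ n) has_real_derivative
        (exp (- 1 / x) * (1 / x\<^sup>2) * x ^ n - exp (- 1 / x) * (real n * x ^ (n - 1))) / (x ^ n * x ^ n)) (at x)"
      using 3 by (auto intro!: derivative_eq_intros simp: power2_eq_square)
    also have "(exp (- 1 / x) * (1 / x\<^sup>2) * x ^ n - exp (- 1 / x) * (real n * x ^ (n - 1))) / (x ^ n * x ^ n)
        = flat (Suc (Suc n)) x - real n * flat (Suc n) x"
      using 3 by (cases n) (auto simp: flat_def field_simps power2_eq_square)
    finally have d: "((\<lambda>x. exp (- 1 / x) / x ^ n) has_real_derivative flat (Suc (Suc n)) x - real n * flat (Suc n) x) (at x)" .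
    have ev: "eventually (\<lambda>y. exp (- 1 / y) / y ^ n = flat n y) (nhds x)"
    proof (rule eventually_mono)
      show "eventually (\<lambda>y. y \<in> {0<..}) (nhds x)" using 3 by (intro eventually_nhds_in_open) auto
    qed (simp add: flat_def)
    show ?thesis using d by (simp only: DERIV_cong_ev[OF refl ev refl])
  qed
qed

text \<open>The affine argument covers translations, reflections and rescalings in one
  induction.\<close>

lemma C2_flat: "C2 k (\<lambda>U V. flat n (\<alpha> * U + \<beta> * V + \<gamma>))"
proof (induction k arbitrary: n)
  case 0
  have "isCont (flat n) x" for x by (rule DERIV_isCont[OF DERIV_flat])
  then have "continuous_on UNIV (flat n)" by (simp add: continuous_on_eq_continuous_at)
  then have "continuous_on UNIV (\<lambda>p::real\<times>real. flat n (\<alpha> * fst p + \<beta> * snd p + \<gamma>))"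
    by (rule continuous_on_compose2) (auto intro!: continuous_intros)
  then show ?case by simp
next
  case (Suc k)
  show ?case
    by (rule C2_SucI[OF has_partials_compose[OF has_partials_affine DERIV_flat]])
      (intro C2_intros Suc)+
qed

text \<open>The usual smooth transition from 0 to 1. The denominator never vanishes because
  \<open>x\<close> and \<open>1 - x\<close> are not both nonpositive.\<close>

definition step :: "real \<Rightarrow> real" where
  "step x = flat 0 x * inverse (flat 0 x + flat 0 (1 - x))"

lemma flat_nonneg: "flat n x \<ge> 0" by (simp add: flat_def)

lemma step_denominator_pos: "flat 0 x + flat 0 (1 - x) > 0"
  by (cases "x \<le> 0") (auto simp: flat_def add_pos_nonneg)

lemma step_eq: "x \<le> 0 \<Longrightarrow> step x = 0" "x \<ge> 1 \<Longrightarrow> step x = 1"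
  by (auto simp: step_def flat_def)

lemma step_bounds: "0 \<le> step x" "step x \<le> 1"
  using step_denominator_pos[of x] flat_nonneg[of 0 x] flat_nonneg[of 0 "1 - x"]
  by (auto simp: step_def field_simps)

lemma C2_step: "C2 k (\<lambda>U V. step U)"
proof -
  have *: "C2 k (\<lambda>U V. flat 0 U)" using C2_flat[of k 0 1 0 0] by simp
  moreover have "C2 k (\<lambda>U V. flat 0 (1 - U))" using C2_flat[of k 0 "- 1" 0 1] by simp
  ultimately have "C2 k (\<lambda>U V. flat 0 U + flat 0 (1 - U))" by (rule C2_add)
  then have "C2 k (\<lambda>U V. inverse (flat 0 U + flat 0 (1 - U)))"
    by (rule C2_inverse[rotated]) (use step_denominator_pos in \<open>simp add: less_imp_neq[symmetric]\<close>)
  with * show ?thesis unfolding step_def by (rule C2_mult)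
qed

text \<open>The interval \<open>(-1, 2)\<close> is not symmetric, so the derivative does not vanish at \<open>0\<close>.\<close>

definition bump :: "real \<Rightarrow> real" where
  "bump x = flat 0 (x + 1) * flat 0 (2 - x)"

definition bump' :: "real \<Rightarrow> real" where
  "bump' x = flat 2 (x + 1) * flat 0 (2 - x) - flat 0 (x + 1) * flat 2 (2 - x)"

lemma DERIV_bump: "(bump has_real_derivative bump' x) (at x)"
proof -
  have a: "((\<lambda>x. flat 0 (x + 1)) has_real_derivative flat 2 (x + 1)) (at x)"
    by (rule DERIV_cong[OF DERIV_chain2[OF DERIV_flat]]) (auto intro!: derivative_eq_intros simp: numeral_2_eq_2)
  have b: "((\<lambda>x. flat 0 (2 - x)) has_real_derivative - flat 2 (2 - x)) (at x)"
    by (rule DERIV_cong[OF DERIV_chain2[OF DERIV_flat]]) (auto intro!: derivative_eq_intros simp: numeral_2_eq_2)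
  show ?thesis unfolding bump_def[abs_def] bump'_def
    by (rule DERIV_cong[OF DERIV_mult[OF a b]]) simp
qed

lemma isCont_flat: "isCont (flat n) x"
  by (rule DERIV_isCont[OF DERIV_flat])

lemma isCont_bump': "isCont bump' x"
proof -
  have "isCont (\<lambda>x. flat n (x + 1)) x" "isCont (\<lambda>x. flat n (2 - x)) x" for n
    by (rule isCont_o2[OF _ isCont_flat]; simp)+
  then show ?thesis unfolding bump'_def[abs_def] by (intro continuous_intros)
qed

lemma bump_support: "\<bar>x\<bar> \<ge> 2 \<Longrightarrow> bump x = 0" "\<bar>x\<bar> \<ge> 2 \<Longrightarrow> bump' x = 0"
  by (auto simp: bump_def bump'_def flat_def)

lemma bump_bounded: "\<exists>B>0. \<forall>x. \<bar>bump x\<bar> \<le> B \<and> \<bar>bump' x\<bar> \<le> B"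
proof -
  have "\<exists>M. \<forall>x. -2 \<le> x \<and> x \<le> 2 \<longrightarrow> \<bar>bump x\<bar> \<le> M"
    by (rule isCont_bounded) (auto intro!: continuous_intros DERIV_isCont[OF DERIV_bump])
  then obtain M where M: "\<And>x. -2 \<le> x \<Longrightarrow> x \<le> 2 \<Longrightarrow> \<bar>bump x\<bar> \<le> M" by blast
  have "\<exists>M. \<forall>x. -2 \<le> x \<and> x \<le> 2 \<longrightarrow> \<bar>bump' x\<bar> \<le> M"
    by (rule isCont_bounded) (auto intro!: continuous_intros isCont_bump')
  then obtain N where N: "\<And>x. -2 \<le> x \<Longrightarrow> x \<le> 2 \<Longrightarrow> \<bar>bump' x\<bar> \<le> N" by blast
  define B where "B = max 1 (max M N)"
  have "\<bar>bump x\<bar> \<le> B \<and> \<bar>bump' x\<bar> \<le> B" for x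
  proof (cases "\<bar>x\<bar> \<ge> 2")
    case True then show ?thesis by (simp add: bump_support B_def)
  next
    case False
    then have "-2 \<le> x" "x \<le> 2" by auto
    then show ?thesis using M[of x] N[of x] by (auto simp: B_def)
  qed
  moreover have "B > 0" by (simp add: B_def)
  ultimately show ?thesis by blast
qed

text \<open>A whole interval around 0 is needed: rescaled by \<delta> it becomes the range of V, of
  radius \<open>\<rho> * \<delta>\<close>, over which the energy is bounded from below.\<close>

lemma bump'_lower: "\<exists>\<rho>>0. \<rho> \<le> 1 \<and> (\<exists>\<beta>>0. \<forall>x. \<bar>x\<bar> \<le> \<rho> \<longrightarrow> \<bar>bump' x\<bar> \<ge> \<beta>)"
proof -
  \<comment> \<open>The value is \<open>3 / 4 * exp (- 3 / 2)\<close>; the factor 3 / 4 comes from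
    the unequal distances 1 and 2 to the ends of the support.\<close>
  have "bump' 0 > 0" by (simp add: bump'_def flat_def)
  then have "eventually (\<lambda>x. bump' x > bump' 0 / 2) (at 0)"
    by (intro order_tendstoD(1)[OF isCont_bump'[of 0, unfolded isCont_def]]) simp
  then obtain d where d: "d > 0" "\<And>x. x \<noteq> 0 \<Longrightarrow> dist x 0 < d \<Longrightarrow> bump' x > bump' 0 / 2"
    unfolding eventually_at by blast
  define \<rho> where "\<rho> = min 1 (d / 2)"
  have "\<bar>bump' x\<bar> \<ge> bump' 0 / 2" if "\<bar>x\<bar> \<le> \<rho>" for x
  proof (cases "x = 0")
    case True then show ?thesis using \<open>bump' 0 > 0\<close> by simp
  next
    case False
    have "dist x 0 < d" using that d(1) by (auto simp: \<rho>_def min_def split: if_splits)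
    from d(2)[OF False this] show ?thesis by linarith
  qed
  moreover have "\<rho> > 0" "\<rho> \<le> 1" using d by (auto simp: \<rho>_def)
  ultimately show ?thesis using \<open>bump' 0 > 0\<close> by (intro exI[of _ \<rho>] conjI exI[of _ "bump' 0 / 2"]) auto
qed

lemma C2_bump: "C2 k (\<lambda>U V. bump (\<alpha> * U + \<beta> * V + \<gamma>))"
  unfolding bump_def
  using C2_mult[OF C2_flat[of k 0 \<alpha> \<beta> "\<gamma> + 1"] C2_flat[of k 0 "- \<alpha>" "- \<beta>" "2 - \<gamma>"]]
  by (simp add: algebra_simps)

text \<open>The factor sqrt \<delta> keeps the square integral of the derivative fixed as \<delta>
  shrinks, while the function itself tends to 0 uniformly. The bound 1 / 2 on \<delta> puts the
  support within distance 1 of \<open>V0\<close>.\<close>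

lemma scaled_bump:
  fixes \<delta> V0 :: real
  assumes \<delta>: "0 < \<delta>" "\<delta> \<le> 1 / 2" and B: "\<And>x. \<bar>bump x\<bar> \<le> B"
  defines "\<phi> \<equiv> \<lambda>V. sqrt \<delta> * bump ((V - V0) / \<delta>)" and "\<phi>' \<equiv> \<lambda>V. bump' ((V - V0) / \<delta>) / sqrt \<delta>"
  shows "C2 k (\<lambda>U V. \<phi> V)" "(\<phi> has_real_derivative \<phi>' V) (at V)" "\<bar>\<phi> V\<bar> \<le> sqrt \<delta> * B"
    "\<bar>V - V0\<bar> \<ge> 2 * \<delta> \<Longrightarrow> \<phi> V = 0 \<and> \<phi>' V = 0"
proof -
  have "C2 k (\<lambda>U V. bump (0 * U + 1 / \<delta> * V + - V0 / \<delta>))" by (rule C2_bump)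
  then have "C2 k (\<lambda>U V. bump ((V - V0) / \<delta>))" by (simp add: diff_divide_distrib)
  then show "C2 k (\<lambda>U V. \<phi> V)" unfolding \<phi>_def by (intro C2_mult C2_const)
  have s: "sqrt \<delta> * (1 / \<delta>) = 1 / sqrt \<delta>" using \<delta> by (simp add: field_simps flip: real_sqrt_mult)
  have "((\<lambda>V. (V - V0) / \<delta>) has_real_derivative 1 / \<delta>) (at V)"
    using \<delta> by (auto intro!: derivative_eq_intros)
  from DERIV_cmult[OF DERIV_chain2[OF DERIV_bump this], of "sqrt \<delta>"]
  have "(\<phi> has_real_derivative sqrt \<delta> * (bump' ((V - V0) / \<delta>) * (1 / \<delta>))) (at V)" unfolding \<phi>_def .
  also have "sqrt \<delta> * (bump' ((V - V0) / \<delta>) * (1 / \<delta>)) = \<phi>' V"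
    unfolding \<phi>'_def using s by (metis mult.left_commute times_divide_eq_right mult_1_right)
  finally show "(\<phi> has_real_derivative \<phi>' V) (at V)" .
  show "\<bar>\<phi> V\<bar> \<le> sqrt \<delta> * B" unfolding \<phi>_def abs_mult using \<delta> B by (simp add: mult_left_mono)
  assume "\<bar>V - V0\<bar> \<ge> 2 * \<delta>"
  then have "\<bar>(V - V0) / \<delta>\<bar> \<ge> 2" using \<delta> by (simp add: abs_divide field_simps)
  then show "\<phi> V = 0 \<and> \<phi>' V = 0" unfolding \<phi>_def \<phi>'_def by (simp add: bump_support)
qed


section \<open>Block form of the metric, curves in the plane and elementary estimates\<close>

section \<open>Coordinates, metric and slices\<close>

text \<open>The radius depends on the product \<open>U * V\<close> only. As a function of that
  product it is the inverse of \<open>kruskal_product\<close>, so one-dimensional inverse function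
  arguments apply.\<close>

definition krad :: "real \<Rightarrow> real \<Rightarrow> real \<Rightarrow> real" where
  "krad m e x = kruskal_radius m e x 1"

lemma kruskal_radius_krad: "kruskal_radius m e U V = krad m e (U * V)"
  by (simp add: krad_def kruskal_radius_def)

text \<open>The common value \<open>X\<close> expresses \<open>\<partial>\<^sub>U (r\<^sup>2 f\<^sub>V) + \<partial>\<^sub>V (r\<^sup>2 f\<^sub>U) = 0\<close>, which is the wave equation for \<open>f(U, V)\<close>.\<close>

definition radial_wave ::
  "real \<Rightarrow> real \<Rightarrow> (real \<Rightarrow> real \<Rightarrow> real) \<Rightarrow> (real \<Rightarrow> real \<Rightarrow> real) \<Rightarrow> (real \<Rightarrow> real \<Rightarrow> real) \<Rightarrow> bool" where
  "radial_wave m e f fU fV \<longleftrightarrow> (\<forall>k. C2 k f) \<and> has_partials f fU fV \<and>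
     (\<forall>U V. \<exists>X. ((\<lambda>U. (kruskal_radius m e U V)\<^sup>2 * fV U V) has_real_derivative X) (at U) \<and>
                ((\<lambda>V. (kruskal_radius m e U V)\<^sup>2 * fU U V) has_real_derivative - X) (at V))"

text \<open>The shape of the metric in coordinates with two null directions and two orthogonal
  angles; it is preserved under inversion.\<close>

definition null_block :: "real \<Rightarrow> real \<Rightarrow> real \<Rightarrow> real^4^4" where
  "null_block A B C = (\<chi> i j. if i = 1 \<and> j = 2 \<or> i = 2 \<and> j = 1 then A
     else if i = 3 \<and> j = 3 then B else if i = 4 \<and> j = 4 then C else 0)"

lemma null_block_nth [simp]:
  "null_block A B C $ 1 $ 1 = 0" "null_block A B C $ 1 $ 2 = A" "null_block A B C $ 1 $ 3 = 0" "null_block A B C $ 1 $ 4 = 0"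
  "null_block A B C $ 2 $ 1 = A" "null_block A B C $ 2 $ 2 = 0" "null_block A B C $ 2 $ 3 = 0" "null_block A B C $ 2 $ 4 = 0"
  "null_block A B C $ 3 $ 1 = 0" "null_block A B C $ 3 $ 2 = 0" "null_block A B C $ 3 $ 3 = B" "null_block A B C $ 3 $ 4 = 0"
  "null_block A B C $ 4 $ 1 = 0" "null_block A B C $ 4 $ 2 = 0" "null_block A B C $ 4 $ 3 = 0" "null_block A B C $ 4 $ 4 = C"
  by (simp_all add: null_block_def)

lemma matrix_inv_null_block:
  assumes "A \<noteq> 0" "B \<noteq> 0" "C \<noteq> 0"
  shows "matrix_inv (null_block A B C) = null_block (1 / A) (1 / B) (1 / C)"
proof -
  let ?M = "null_block A B C" and ?N = "null_block (1 / A) (1 / B) (1 / C)"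
  have 1: "?M ** ?N = mat 1"
    unfolding vec_eq_iff forall_4 matrix_matrix_mult_def mat_def using assms by (simp add: sum_4)
  then have "?N ** ?M = mat 1" by (simp add: matrix_left_right_inverse)
  with 1 have "?M ** matrix_inv ?M = mat 1 \<and> matrix_inv ?M ** ?M = mat 1"
    unfolding matrix_inv_def by (intro someI[where P = "\<lambda>A'. ?M ** A' = mat 1 \<and> A' ** ?M = mat 1"]) simp
  then have 2: "matrix_inv ?M ** ?M = mat 1" ..
  have "matrix_inv ?M = matrix_inv ?M ** (?M ** ?N)" unfolding 1 by simp
  also have "\<dots> = ?N" unfolding matrix_mul_assoc 2 by simp
  finally show ?thesis .
qed

text \<open>Exchanging the first two rows makes the matrix diagonal and changes only the sign of the
  determinant.\<close>

lemma abs_det_null_block: "\<bar>det (null_block A B C)\<bar> = A\<^sup>2 * \<bar>B\<bar> * \<bar>C\<bar>"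
proof -
  let ?M = "null_block A B C" and ?p = "Transposition.transpose (1::4) 2"
  let ?N = "(\<chi> i. ?M $ ?p i) :: real^4^4"
  have "det ?N = of_int (sign ?p) * det ?M"
    by (rule det_permute_rows) (simp add: permutes_swap_id)
  then have "\<bar>det ?M\<bar> = \<bar>det ?N\<bar>" by (simp add: sign_swap_id abs_mult)
  also have "det ?N = (\<Prod>i\<in>UNIV. ?N $ i $ i)"
  proof (rule det_diagonal)
    have "\<forall>i j::4. i \<noteq> j \<longrightarrow> ?N $ i $ j = 0"
      unfolding forall_4 by (simp add: Transposition.transpose_def)
    then show "?N $ i $ j = 0" if "i \<noteq> j" for i j using that by blast
  qed
  also have "\<dots> = A * A * B * C"
    unfolding UNIV_4 by (simp add: Transposition.transpose_def)
  finally show ?thesis by (simp add: abs_mult power2_eq_square)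
qed

lemma RN_coord_metric_null_block:
  assumes "orthogonal_matrix R"
  shows "RN_coord_metric m e R x =
    (let r = kruskal_radius m e (x $ 1) (x $ 2)
     in null_block (- kruskal_F m e r / 2) (r\<^sup>2) (r\<^sup>2 * (sin (x $ 3))\<^sup>2))"
  unfolding RN_coord_metric_eq[OF assms] null_block_def Let_def ..

lemma pderiv_at_radial:
  assumes "has_partials f fU fV"
  defines "w \<equiv> \<lambda>x::real^4. complex_of_real (f (x $ 1) (x $ 2))"
  shows "pderiv_at w 1 x = complex_of_real (fU (x $ 1) (x $ 2))"
    and "pderiv_at w 2 x = complex_of_real (fV (x $ 1) (x $ 2))"
    and "pderiv_at w 3 x = 0" "pderiv_at w 4 x = 0"
proof -
  have "((\<lambda>h. complex_of_real (f (x $ 1 + h) (x $ 2))) has_vector_derivative complex_of_real (fU (x $ 1) (x $ 2))) (at 0)"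
    using DERIV_shift[of "\<lambda>U. f U (x $ 2)" "fU (x $ 1) (x $ 2)" 0 "x $ 1"] has_partials_DERIV(1)[OF assms(1)]
    by (intro has_vector_derivative_of_real) (simp add: add.commute)
  then show "pderiv_at w 1 x = complex_of_real (fU (x $ 1) (x $ 2))"
    unfolding pderiv_at_def w_def by (simp add: axis_def vector_derivative_at)
  have "((\<lambda>h. complex_of_real (f (x $ 1) (x $ 2 + h))) has_vector_derivative complex_of_real (fV (x $ 1) (x $ 2))) (at 0)"
    using DERIV_shift[of "\<lambda>V. f (x $ 1) V" "fV (x $ 1) (x $ 2)" 0 "x $ 2"] has_partials_DERIV(2)[OF assms(1)]
    by (intro has_vector_derivative_of_real) (simp add: add.commute)
  then show "pderiv_at w 2 x = complex_of_real (fV (x $ 1) (x $ 2))"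
    unfolding pderiv_at_def w_def by (simp add: axis_def vector_derivative_at)
  show "pderiv_at w 3 x = 0" "pderiv_at w 4 x = 0"
    unfolding pderiv_at_def w_def by (simp_all add: axis_def)
qed

definition radial :: "(real \<Rightarrow> real \<Rightarrow> real) \<Rightarrow> event \<Rightarrow> complex" where
  "radial f p = complex_of_real (f (fst p) (fst (snd p)))"

lemma radial_chart: "radial f \<circ> kruskal_chart R = (\<lambda>x. complex_of_real (f (x $ 1) (x $ 2)))"
  by (simp add: fun_eq_iff radial_def kruskal_chart_def)

lemma smooth_on_curve:
  fixes c :: "real \<Rightarrow> 'a::real_normed_vector"
  assumes "smooth_on J c"
  shows "\<And>s. s \<in> J \<Longrightarrow> (c has_vector_derivative vector_derivative c (at s)) (at s)"
    and "continuous_on J (\<lambda>s. vector_derivative c (at s))" "continuous_on J c"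
proof -
  have C: "Ck_on 1 J c" "Ck_on 0 J c" using assms unfolding smooth_on_def by blast+
  then show "continuous_on J c" by simp
  have diff: "c differentiable at s" if "s \<in> J" for s using C(1) that by simp
  then show "(c has_vector_derivative vector_derivative c (at s)) (at s)" if "s \<in> J" for s
    using that by (simp add: vector_derivative_works)
  have "continuous_on J (\<lambda>s. frechet_derivative c (at s) 1)" using C(1) by simp
  moreover have "frechet_derivative c (at s) 1 = vector_derivative c (at s)" if "s \<in> J" for s
    using diff[OF that] unfolding vector_derivative_works has_vector_derivative_def
    by (simp add: frechet_derivative_at[symmetric])
  ultimately show "continuous_on J (\<lambda>s. vector_derivative c (at s))"
    by (simp cong: continuous_on_cong)
qed

text \<open>Supplies the rectangle condition of \<open>goursat_zero\<close> for half-planes bounded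
  by a base line.\<close>

lemma convex_halfline:
  fixes c x s :: real
  assumes "s \<in> {0..1}"
  shows "x \<le> c \<Longrightarrow> c + s * (x - c) \<le> c" "x \<ge> c \<Longrightarrow> c + s * (x - c) \<ge> c"
  using assms by (auto simp: mult_nonneg_nonpos)

lemma emeasure_box3:
  fixes a1 a2 a3 b1 b2 b3 :: real
  assumes "a1 \<le> b1" "a2 \<le> b2" "a3 \<le> b3"
  shows "emeasure lborel {y::real^3. y $ 1 \<in> {a1..b1} \<and> y $ 2 \<in> {a2..b2} \<and> y $ 3 \<in> {a3..b3}}
    = ennreal ((b1 - a1) * (b2 - a2) * (b3 - a3))"
    and "{y::real^3. y $ 1 \<in> {a1..b1} \<and> y $ 2 \<in> {a2..b2} \<and> y $ 3 \<in> {a3..b3}} \<in> sets lborel"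
proof -
  let ?a = "vector [a1, a2, a3] :: real^3" and ?b = "vector [b1, b2, b3] :: real^3"
  have eq: "{y::real^3. y $ 1 \<in> {a1..b1} \<and> y $ 2 \<in> {a2..b2} \<and> y $ 3 \<in> {a3..b3}} = cbox ?a ?b"
    by (auto simp: mem_box_cart forall_3)
  have "?a \<in> cbox ?a ?b" using assms by (simp add: mem_box_cart forall_3)
  then have ne: "cbox ?a ?b \<noteq> {}" by blast
  have "emeasure lborel (cbox ?a ?b) = ennreal (measure lborel (cbox ?a ?b))"
    by (rule emeasure_eq_ennreal_measure) (simp add: emeasure_lborel_cbox_eq)
  also have "measure lborel (cbox ?a ?b) = prod (\<lambda>i. ?b $ i - ?a $ i) UNIV"
    by (rule content_cbox_cart[OF ne])
  also have "\<dots> = (b1 - a1) * (b2 - a2) * (b3 - a3)" unfolding UNIV_3 by simp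
  finally show "emeasure lborel {y::real^3. y $ 1 \<in> {a1..b1} \<and> y $ 2 \<in> {a2..b2} \<and> y $ 3 \<in> {a3..b3}}
    = ennreal ((b1 - a1) * (b2 - a2) * (b3 - a3))" unfolding eq .
  show "{y::real^3. y $ 1 \<in> {a1..b1} \<and> y $ 2 \<in> {a2..b2} \<and> y $ 3 \<in> {a3..b3}} \<in> sets lborel"
    unfolding eq by simp
qed

text \<open>With the eventuality filter, finitely many linear smallness conditions on the width can
  be imposed at once.\<close>

lemma eventually_small: "b > 0 \<Longrightarrow> eventually (\<lambda>\<delta>. k * \<delta> \<le> b) (at_right (0::real))" for k b :: real
proof -
  assume "b > 0"
  have "((\<lambda>\<delta>. k * \<delta>) \<longlongrightarrow> k * 0) (at_right 0)" by (intro tendsto_intros)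
  then have "eventually (\<lambda>\<delta>. k * \<delta> < b) (at_right 0)" by (rule order_tendstoD(2)) (use \<open>b > 0\<close> in simp)
  then show ?thesis by eventually_elim simp
qed

lemma compact_slice_bound:
  assumes "compact K" "continuous_on K c"
  shows "\<exists>L>0. \<forall>s\<in>K. \<bar>fst (c s)\<bar> \<le> L \<and> \<bar>snd (c s :: real \<times> real)\<bar> \<le> L"
proof -
  from compact_imp_bounded[OF compact_continuous_image[OF assms(2,1)]]
  obtain L where L: "L > 0" "\<And>x. x \<in> c ` K \<Longrightarrow> norm x \<le> L" unfolding bounded_pos by blast
  have "\<bar>fst (c s)\<bar> \<le> L \<and> \<bar>snd (c s)\<bar> \<le> L" if "s \<in> K" for s
    using L(2)[OF imageI[OF that]] norm_fst_le[of "fst (c s)" "snd (c s)"]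
      norm_snd_le[of "snd (c s)" "fst (c s)"] by simp
  then show ?thesis using L(1) by blast
qed


abbreviation dU :: "(real \<Rightarrow> real \<times> real) \<Rightarrow> real \<Rightarrow> real" where
  "dU c s \<equiv> fst (vector_derivative c (at s))"

abbreviation dV :: "(real \<Rightarrow> real \<times> real) \<Rightarrow> real \<Rightarrow> real" where
  "dV c s \<equiv> snd (vector_derivative c (at s))"

abbreviation V_increasing :: "(real \<Rightarrow> real \<times> real) \<Rightarrow> real set \<Rightarrow> bool" where
  "V_increasing c J \<equiv> \<forall>s\<in>J. \<forall>t\<in>J. s < t \<longrightarrow> snd (c s) < snd (c t) \<and> fst (c t) < fst (c s)"

abbreviation V_decreasing :: "(real \<Rightarrow> real \<times> real) \<Rightarrow> real set \<Rightarrow> bool" where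
  "V_decreasing c J \<equiv> \<forall>s\<in>J. \<forall>t\<in>J. s < t \<longrightarrow> snd (c t) < snd (c s) \<and> fst (c s) < fst (c t)"

context
  fixes m e :: real
  assumes e0: "0 < e" and em: "e < m"
begin

section \<open>The radius as a smooth function of the product of the null coordinates\<close>

subsection \<open>Smoothness of the radius function\<close>

lemma krad_gt: "r_minus m e < krad m e x"
  and kruskal_product_krad: "kruskal_product m e (krad m e x) = x"
  using theI'[OF kruskal_product_ex1[OF e0 em, of x]] by (auto simp: krad_def kruskal_radius_def)

lemma krad_kruskal_product: "r_minus m e < r \<Longrightarrow> krad m e (kruskal_product m e r) = r"
  unfolding krad_def by (rule kruskal_radius_eqI[OF e0 em]) auto

lemma krad_pos: "krad m e x > 0"
  using krad_gt[of x] r_minus_pos[OF e0 em] by linarith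

lemma kruskal_F_pos: "r_minus m e < r \<Longrightarrow> kruskal_F m e r > 0"
  using kappa_plus_pos[OF e0 em] r_minus_pos[OF e0 em] by (auto simp: kruskal_F_def)

lemma isCont_krad: "isCont (krad m e) x"
proof -
  let ?r = "krad m e x" and ?q = "r_minus m e"
  define a where "a = (?q + ?r) / 2"
  have a: "?q < a" "a < ?r" using krad_gt[of x] by (auto simp: a_def field_simps)
  have "isCont (krad m e) (kruskal_product m e ?r)"
    by (rule isCont_inverse_function2[of a _ "?r + 1"])
      (use a in \<open>auto intro!: krad_kruskal_product DERIV_isCont[OF DERIV_kruskal_product[OF e0 em]]\<close>)
  then show ?thesis by (simp add: kruskal_product_krad)
qed

text \<open>Since \<open>dr/dx = - (\<kappa>\<^sub>+ / 2) F(r)\<close> for \<open>x = U V\<close>, the span of these functions is closed under differentiation.\<close>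

definition krad_monom :: "real \<Rightarrow> real \<Rightarrow> real \<Rightarrow> real \<Rightarrow> real" where
  "krad_monom \<alpha> \<beta> \<gamma> x =
     (krad m e x - r_minus m e) powr \<alpha> * exp (\<beta> * krad m e x) * krad m e x powr \<gamma>"

lemma kruskal_F_krad:
  "kruskal_F m e (krad m e x)
     = krad_monom (1 + kappa_plus m e / kappa_minus m e) (- 2 * kappa_plus m e) (- 2) x / (kappa_plus m e)\<^sup>2"
proof -
  have "krad m e x powr (- 2) = 1 / (krad m e x)\<^sup>2"
    using krad_pos[of x] by (simp add: powr_minus_divide powr_numeral)
  then show ?thesis by (simp add: kruskal_F_def krad_monom_def field_simps)
qed

lemma DERIV_krad:
  "(krad m e has_real_derivative - (kappa_plus m e / 2) * kruskal_F m e (krad m e x)) (at x)"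
proof -
  let ?r = "krad m e x" and ?k = "kappa_plus m e" and ?q = "r_minus m e"
  define c where "c = kappa_plus m e / kappa_minus m e"
  define D where "D = - 2 * ?k * ?r\<^sup>2 * exp (2 * ?k * ?r) * (?r - ?q) powr (- c - 1)"
  have k: "?k > 0" by (rule kappa_plus_pos[OF e0 em])
  have d: "(kruskal_product m e has_real_derivative D) (at ?r)"
    unfolding D_def c_def by (rule DERIV_kruskal_product[OF e0 em krad_gt])
  have "D \<noteq> 0" using k krad_pos[of x] krad_gt[of x] by (simp add: D_def)
  then have "(krad m e has_real_derivative inverse D) (at x)"
    by (intro DERIV_inverse_function[where f = "kruskal_product m e" and a = "x - 1" and b = "x + 1"])
      (auto simp: kruskal_product_krad isCont_krad d)
  also have "inverse D = - (?k / 2) * kruskal_F m e ?r"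
  proof -
    have "- c - 1 = - (1 + c)" by simp
    then have p: "(?r - ?q) powr (- c - 1) = inverse ((?r - ?q) powr (1 + c))"
      by (simp only: powr_minus)
    have ex: "exp (- 2 * ?k * ?r) = inverse (exp (2 * ?k * ?r))" by (simp flip: exp_minus)
    show ?thesis
      using k krad_pos[of x] krad_gt[of x] unfolding D_def p kruskal_F_def c_def[symmetric] ex
      by (simp add: field_simps power2_eq_square)
  qed
  finally show ?thesis .
qed

lemma DERIV_krad_monom:
  defines "c \<equiv> kappa_plus m e / kappa_minus m e" and "k \<equiv> kappa_plus m e"
  shows "(krad_monom \<alpha> \<beta> \<gamma> has_real_derivative
    - (1 / (2 * k)) * (\<alpha> * krad_monom (\<alpha> + c) (\<beta> - 2 * k) (\<gamma> - 2) x
       + \<beta> * krad_monom (\<alpha> + 1 + c) (\<beta> - 2 * k) (\<gamma> - 2) x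
       + \<gamma> * krad_monom (\<alpha> + 1 + c) (\<beta> - 2 * k) (\<gamma> - 3) x)) (at x)"
proof -
  let ?r = "krad m e x" and ?q = "r_minus m e"
  define d where "d = - (1 / (2 * k)) * ((?r - ?q) powr (1 + c) * exp (- 2 * k * ?r) * ?r powr (- 2))"
  have k: "k > 0" unfolding k_def by (rule kappa_plus_pos[OF e0 em])
  have r: "?r > 0" "?r - ?q > 0" using krad_pos[of x] krad_gt[of x] by auto
  have D: "(krad m e has_real_derivative d) (at x)"
    using DERIV_krad[of x] k unfolding kruskal_F_krad krad_monom_def d_def k_def c_def
    by (simp add: power2_eq_square mult_ac)
  have "(krad_monom \<alpha> \<beta> \<gamma> has_real_derivative
      (\<alpha> * (?r - ?q) powr (\<alpha> - 1) * d) * exp (\<beta> * ?r) * ?r powr \<gamma>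
      + (?r - ?q) powr \<alpha> * (exp (\<beta> * ?r) * (\<beta> * d)) * ?r powr \<gamma>
      + (?r - ?q) powr \<alpha> * exp (\<beta> * ?r) * (\<gamma> * ?r powr (\<gamma> - 1) * d)) (at x)"
    unfolding krad_monom_def[abs_def]
  proof -
    have 1: "((\<lambda>x. (krad m e x - ?q) powr \<alpha>) has_real_derivative \<alpha> * (?r - ?q) powr (\<alpha> - 1) * d) (at x)"
      using has_real_derivative_powr[OF r(2), of \<alpha>] DERIV_diff[OF D DERIV_const[of ?q]]
      by (auto dest: DERIV_chain2)
    have 2: "((\<lambda>x. krad m e x powr \<gamma>) has_real_derivative \<gamma> * ?r powr (\<gamma> - 1) * d) (at x)"
      using DERIV_chain2[OF has_real_derivative_powr[OF r(1), of \<gamma>] D] .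
    have 3: "((\<lambda>x. exp (\<beta> * krad m e x)) has_real_derivative exp (\<beta> * ?r) * (\<beta> * d)) (at x)"
      by (rule DERIV_chain2[OF DERIV_exp DERIV_cmult[OF D]])
    show "((\<lambda>x. (krad m e x - ?q) powr \<alpha> * exp (\<beta> * krad m e x) * krad m e x powr \<gamma>) has_real_derivative
      (\<alpha> * (?r - ?q) powr (\<alpha> - 1) * d) * exp (\<beta> * ?r) * ?r powr \<gamma>
      + (?r - ?q) powr \<alpha> * (exp (\<beta> * ?r) * (\<beta> * d)) * ?r powr \<gamma>
      + (?r - ?q) powr \<alpha> * exp (\<beta> * ?r) * (\<gamma> * ?r powr (\<gamma> - 1) * d)) (at x)"
      by (rule DERIV_cong[OF DERIV_mult[OF DERIV_mult[OF 1 3] 2]]) (simp add: algebra_simps)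
  qed
  moreover have p: "(?r - ?q) powr (\<alpha> - 1) * (?r - ?q) powr (1 + c) = (?r - ?q) powr (\<alpha> + c)"
    "(?r - ?q) powr \<alpha> * (?r - ?q) powr (1 + c) = (?r - ?q) powr (\<alpha> + 1 + c)"
    "?r powr \<gamma> * ?r powr (- 2) = ?r powr (\<gamma> - 2)" "?r powr (\<gamma> - 1) * ?r powr (- 2) = ?r powr (\<gamma> - 3)"
    "exp (\<beta> * ?r) * exp (- 2 * k * ?r) = exp ((\<beta> - 2 * k) * ?r)"
    by (simp_all add: powr_add[symmetric] exp_add[symmetric] algebra_simps)
  ultimately show ?thesis unfolding krad_monom_def d_def p[symmetric]
    by (elim DERIV_cong) (simp add: algebra_simps)
qed

lemma C2_krad_monom: "C2 k (\<lambda>U V. krad_monom \<alpha> \<beta> \<gamma> (U * V))"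
proof (induction k arbitrary: \<alpha> \<beta> \<gamma>)
  case 0
  have "continuous_on UNIV (krad_monom \<alpha> \<beta> \<gamma>)"
    by (intro continuous_at_imp_continuous_on ballI DERIV_isCont[OF DERIV_krad_monom])
  then have "continuous_on UNIV (\<lambda>p::real\<times>real. krad_monom \<alpha> \<beta> \<gamma> (fst p * snd p))"
    by (rule continuous_on_compose2) (auto intro!: continuous_intros)
  then show ?case by simp
next
  case (Suc k)
  have UV: "has_partials (\<lambda>U V. U * V) (\<lambda>U V. V) (\<lambda>U V. U)"
    unfolding has_partials_def by (auto intro!: derivative_eq_intros)
  show ?case
    by (rule C2_SucI[OF has_partials_compose[OF UV DERIV_krad_monom]]) (intro C2_intros Suc)+
qed

lemma C2_kruskal_radius: "C2 k (kruskal_radius m e)"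
proof -
  have "kruskal_radius m e = (\<lambda>U V. krad_monom 0 0 1 (U * V))"
  proof (intro ext)
    fix U V
    show "kruskal_radius m e U V = krad_monom 0 0 1 (U * V)"
      using krad_pos[of "U * V"] krad_gt[of "U * V"] by (simp add: kruskal_radius_krad krad_monom_def)
  qed
  then show ?thesis using C2_krad_monom by simp
qed

lemma C2_kruskal_F: "C2 k (\<lambda>U V. kruskal_F m e (kruskal_radius m e U V))"
  unfolding kruskal_radius_krad kruskal_F_krad divide_inverse by (intro C2_intros C2_krad_monom)

text \<open>With \<open>x = U * V\<close> the chain rule gives \<open>rU = V * d x\<close>,
  \<open>rV = U * d x\<close> and \<open>rUV = d x + x * d' x\<close>, where \<open>d\<close> is the
  derivative of the radius in \<open>x\<close>. The mixed partial is provided in both orders because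
  both halves of \<open>radial_wave\<close> use it.\<close>

lemma kruskal_radius_partials:
  obtains rU rV rUV where "has_partials (kruskal_radius m e) rU rV"
    and "\<And>k. C2 k rU" "\<And>k. C2 k rV" "\<And>k. C2 k rUV"
    and "\<And>U V. ((\<lambda>V. rU U V) has_real_derivative rUV U V) (at V)"
    and "\<And>U V. ((\<lambda>U. rV U V) has_real_derivative rUV U V) (at U)"
proof -
  define c k where "c = kappa_plus m e / kappa_minus m e" and "k = kappa_plus m e"
  define d where "d x = (- k / 2 / k\<^sup>2) * krad_monom (1 + c) (- 2 * k) (- 2) x" for x
  define d' where "d' x = (- k / 2 / k\<^sup>2) * (- (1 / (2 * k)) *
     ((1 + c) * krad_monom (1 + c + c) (- 2 * k - 2 * k) (- 2 - 2) x
       + (- 2 * k) * krad_monom (1 + c + 1 + c) (- 2 * k - 2 * k) (- 2 - 2) x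
       + (- 2) * krad_monom (1 + c + 1 + c) (- 2 * k - 2 * k) (- 2 - 3) x))" for x
  have dd: "(d has_real_derivative d' x) (at x)" for x
    unfolding d_def[abs_def] d'_def c_def k_def by (rule DERIV_cmult[OF DERIV_krad_monom])
  have dr: "(krad m e has_real_derivative d x) (at x)" for x
    using DERIV_krad[of x] unfolding d_def kruskal_F_krad c_def k_def by simp
  have Cd: "C2 n (\<lambda>U V. d (U * V))" "C2 n (\<lambda>U V. d' (U * V))" for n
    unfolding d_def d'_def by (intro C2_intros C2_krad_monom)+
  have UV: "has_partials (\<lambda>U V. U * V) (\<lambda>U V. V) (\<lambda>U V. U)"
    unfolding has_partials_def by (auto intro!: derivative_eq_intros)
  show thesis
  proof (rule that[of "\<lambda>U V. d (U * V) * V" "\<lambda>U V. d (U * V) * U" "\<lambda>U V. d (U * V) + U * V * d' (U * V)"])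
    have "kruskal_radius m e = (\<lambda>U V. krad m e (U * V))" by (intro ext kruskal_radius_krad)
    then show "has_partials (kruskal_radius m e) (\<lambda>U V. d (U * V) * V) (\<lambda>U V. d (U * V) * U)"
      using has_partials_compose[OF UV dr] by simp
    note dUV = has_partials_compose[OF UV dd]
    show "((\<lambda>V. d (U * V) * V) has_real_derivative d (U * V) + U * V * d' (U * V)) (at V)" for U V
      by (rule DERIV_cong[OF DERIV_mult[OF has_partials_DERIV(2)[OF dUV] DERIV_ident]]) simp
    show "((\<lambda>U. d (U * V) * U) has_real_derivative d (U * V) + U * V * d' (U * V)) (at U)" for U V
      by (rule DERIV_cong[OF DERIV_mult[OF has_partials_DERIV(1)[OF dUV] DERIV_ident]]) simp
  qed (intro C2_intros Cd)+
qed

section \<open>Solutions equal to a prescribed profile up to a correction bounded by its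
  supremum\<close>

subsection \<open>Wave packets\<close>

text \<open>The retarded part \<open>\<psi>1\<close> starts from \<open>step(U) \<phi>(V)\<close> and vanishes for \<open>U \<le> 0\<close> and for \<open>V \<le> V0 - 1\<close>; the
  advanced part \<open>\<psi>2\<close> starts from \<open>(1 - step(U)) \<phi>(V)\<close> and vanishes for \<open>U \<ge> 1\<close> and for \<open>V \<ge> V0 + 1\<close>.\<close>

lemma wave_packet:
  fixes V0 L :: real
  shows "\<exists>C>0. \<forall>\<phi> \<phi>' \<mu>. (\<forall>k. C2 k (\<lambda>U V. \<phi> V)) \<and> (\<forall>V. (\<phi> has_real_derivative \<phi>' V) (at V)) \<and>
      (\<forall>V. \<bar>\<phi> V\<bar> \<le> \<mu>) \<and> (\<forall>V. \<bar>V - V0\<bar> \<ge> 1 \<longrightarrow> \<phi> V = 0 \<and> \<phi>' V = 0) \<longrightarrow>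
    (\<exists>f fU fV. radial_wave m e f fU fV \<and>
      (\<forall>U V. \<bar>U\<bar> \<le> L \<longrightarrow> \<bar>V\<bar> \<le> L \<longrightarrow>
         \<bar>kruskal_radius m e U V * fU U V\<bar> \<le> C * \<mu> \<and> \<bar>kruskal_radius m e U V * fV U V - \<phi>' V\<bar> \<le> C * \<mu>) \<and>
      (\<forall>U V. (U \<le> 0 \<and> V \<ge> V0 + 1) \<or> (U \<ge> 1 \<and> V \<le> V0 - 1) \<longrightarrow> fU U V = 0 \<and> fV U V = 0))"
proof -
  let ?r = "kruskal_radius m e"
  obtain rU rV rUV where rP: "has_partials ?r rU rV"
    and rC: "\<And>k. C2 k rU" "\<And>k. C2 k rV" "\<And>k. C2 k rUV"
    and rUD: "\<And>U V. ((\<lambda>V. rU U V) has_real_derivative rUV U V) (at V)"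
    and rVD: "\<And>U V. ((\<lambda>U. rV U V) has_real_derivative rUV U V) (at U)"
    using kruskal_radius_partials by blast
  have r0: "?r U V > 0" for U V unfolding kruskal_radius_krad by (rule krad_pos)
  then have rn: "?r U V \<noteq> 0" for U V by (simp add: less_imp_neq[symmetric])
  have irC: "C2 k (\<lambda>U V. inverse (?r U V))" for k
    by (rule C2_inverse[OF rn C2_kruskal_radius])
  define Q where "Q U V = rUV U V * inverse (?r U V)" for U V
  have QC: "C2 k Q" for k unfolding Q_def[abs_def] by (intro C2_mult rC irC)
  \<comment> \<open>Wide enough for the square of half-width \<open>L\<close> about the origin to
    lie within distance \<open>A\<close>, in each coordinate, of both base points
    \<open>(0, V0 - 1)\<close> and \<open>(1, V0 + 1)\<close>. The bound \<open>A + A\<close> for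
    \<open>Q\<close> covers the boxes of half-width \<open>A\<close> about them.\<close>
  define A where "A = \<bar>L\<bar> + \<bar>V0\<bar> + 2"
  have A: "A > 0" by (simp add: A_def)
  obtain K where K: "K > 0" "\<And>U V. \<bar>U\<bar> \<le> A + A \<Longrightarrow> \<bar>V\<bar> \<le> A + A \<Longrightarrow> \<bar>Q U V\<bar> \<le> K"
    using C2_0_bounded[OF QC, of "A + A"] by blast
  obtain H1 where H1: "H1 > 0" "\<And>U V. \<bar>U\<bar> \<le> L \<Longrightarrow> \<bar>V\<bar> \<le> L \<Longrightarrow> \<bar>rU U V * inverse (?r U V)\<bar> \<le> H1"
    using C2_0_bounded[OF C2_mult[OF rC(1) irC], of L] by blast
  obtain H2 where H2: "H2 > 0" "\<And>U V. \<bar>U\<bar> \<le> L \<Longrightarrow> \<bar>V\<bar> \<le> L \<Longrightarrow> \<bar>rV U V * inverse (?r U V)\<bar> \<le> H2"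
    using C2_0_bounded[OF C2_mult[OF rC(2) irC], of L] by blast
  define G where "G = 2 * exp (2 * K * A * A)"
  \<comment> \<open>Two correction integrals of size \<open>K * G * A\<close> each, and the term
    produced by dividing \<psi> by the radius, where \<psi> is at most
    \<open>2 * G * \<mu>\<close>.\<close>
  define C where "C = 2 * (K * G * A) + 2 * G * (H1 + H2)"
  have G: "G > 0" by (simp add: G_def)
  have C: "C > 0" using G K A H1 H2 by (simp add: C_def add_pos_pos)
  show ?thesis
  proof (intro exI[of _ C] conjI C allI impI, elim conjE)
    fix \<phi> \<phi>' :: "real \<Rightarrow> real" and \<mu> :: real
    assume phC: "\<forall>k. C2 k (\<lambda>U V. \<phi> V)" and phD: "\<forall>V. (\<phi> has_real_derivative \<phi>' V) (at V)"
      and phb: "\<forall>V. \<bar>\<phi> V\<bar> \<le> \<mu>" and phs: "\<forall>V. \<bar>V - V0\<bar> \<ge> 1 \<longrightarrow> \<phi> V = 0 \<and> \<phi>' V = 0"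
    have mu: "\<mu> \<ge> 0" using phb abs_ge_zero order_trans by blast
    define f1 f2 where "f1 U V = step U * \<phi> V" and "f2 U V = (1 - step U) * \<phi> V" for U V
    have fC: "C2 k f1" "C2 k f2" for k
      unfolding f1_def[abs_def] f2_def[abs_def] using phC by (intro C2_mult C2_diff C2_const C2_step; simp)+
    have fb: "\<bar>f1 U V\<bar> \<le> \<mu>" "\<bar>f2 U V\<bar> \<le> \<mu>" for U V
    proof -
      have *: "\<bar>s * \<phi> V\<bar> \<le> \<mu>" if "0 \<le> s" "s \<le> 1" for s
        using mult_mono[of "\<bar>s\<bar>" 1 "\<bar>\<phi> V\<bar>" \<mu>] that phb by (simp add: abs_mult)
      show "\<bar>f1 U V\<bar> \<le> \<mu>" "\<bar>f2 U V\<bar> \<le> \<mu>" unfolding f1_def f2_def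
        using step_bounds[of U] by (auto intro!: *)
    qed
    define \<psi>1 \<psi>2 where "\<psi>1 = goursat Q f1 0 (V0 - 1)" and "\<psi>2 = goursat Q f2 1 (V0 + 1)"
    have psC: "C2 k \<psi>1" "C2 k \<psi>2" for k
      unfolding \<psi>1_def \<psi>2_def by (rule C2_goursat[OF QC fC(1) QC fC(1)] C2_goursat[OF QC fC(2) QC fC(2)])+
    define g1 g2 where "g1 U V = Q U V * \<psi>1 U V" and "g2 U V = Q U V * \<psi>2 U V" for U V
    have gC: "C2 k g1" "C2 k g2" for k
      unfolding g1_def[abs_def] g2_def[abs_def] by (intro C2_mult QC psC)+
    define \<psi> where "\<psi> U V = \<psi>1 U V + \<psi>2 U V" for U V
    define \<psi>U where "\<psi>U U V = int_snd (V0 - 1) g1 U V + int_snd (V0 + 1) g2 U V" for U V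
    define \<psi>V where "\<psi>V U V = \<phi>' V + (int_fst 0 g1 U V + int_fst 1 g2 U V)" for U V
    have pC: "C2 k \<psi>" for k unfolding \<psi>_def[abs_def] by (intro C2_add psC)
    have pP: "has_partials \<psi> \<psi>U \<psi>V"
    proof -
      \<comment> \<open>\<open>f1\<close> and \<open>f2\<close> add up to \<phi>(V): the cut-off
        survives only inside the integrals, and no derivative of \<open>step\<close> enters the
        estimates.\<close>
      have "\<psi> U V = \<phi> V + (int_fst 0 (int_snd (V0 - 1) g1) U V + int_fst 1 (int_snd (V0 + 1) g2) U V)" for U V
        using goursat_eq[OF QC fC(1), of 0 "V0 - 1" U V] goursat_eq[OF QC fC(2), of 1 "V0 + 1" U V]
        unfolding \<psi>_def \<psi>1_def[symmetric] \<psi>2_def[symmetric] g1_def[abs_def, symmetric] g2_def[abs_def, symmetric]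
        by (simp add: f1_def f2_def algebra_simps)
      then have eq: "\<psi> = (\<lambda>U V. \<phi> V + (int_fst 0 (int_snd (V0 - 1) g1) U V + int_fst 1 (int_snd (V0 + 1) g2) U V))"
        by blast
      obtain x y where xy: "has_partials (\<lambda>U V. \<phi> V) x y" using phC C2_SucE by meson
      have "x = (\<lambda>U V. 0)" "y = (\<lambda>U V. \<phi>' V)"
        using has_partials_DERIV[OF xy] phD by (blast intro: DERIV_unique DERIV_const)+
      then have "has_partials (\<lambda>U V. \<phi> V) (\<lambda>U V. 0) (\<lambda>U V. \<phi>' V)" using xy by simp
      from has_partials_add[OF this has_partials_add[OF has_partials_int_fst_int_snd[OF gC(1)]
          has_partials_int_fst_int_snd[OF gC(2)]], of 0 "V0 - 1" 1 "V0 + 1"]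
      show ?thesis unfolding eq \<psi>U_def[abs_def] \<psi>V_def[abs_def] by simp
    qed
    have pUD: "((\<lambda>V. \<psi>U U V) has_real_derivative Q U V * \<psi> U V) (at V)" for U V
      unfolding \<psi>U_def \<psi>_def distrib_left g1_def[symmetric] g2_def[symmetric]
      by (intro DERIV_add DERIV_int_snd gC)
    have pVD: "((\<lambda>U. \<psi>V U V) has_real_derivative Q U V * \<psi> U V) (at U)" for U V
    proof -
      have "((\<lambda>U. int_fst 0 g1 U V) has_real_derivative g1 U V) (at U)"
        "((\<lambda>U. int_fst 1 g2 U V) has_real_derivative g2 U V) (at U)"
        unfolding int_fst_def by (rule DERIV_int_snd[OF C2_swap[OF gC(1)]] DERIV_int_snd[OF C2_swap[OF gC(2)]])+
      from DERIV_add[OF DERIV_const DERIV_add[OF this], of "\<phi>' V"] show ?thesis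
        unfolding \<psi>V_def \<psi>_def distrib_left g1_def g2_def by simp
    qed
    define f where "f U V = \<psi> U V * inverse (?r U V)" for U V
    define fU where "fU U V = (\<psi>U U V - \<psi> U V * (rU U V * inverse (?r U V))) * inverse (?r U V)" for U V
    define fV where "fV U V = (\<psi>V U V - \<psi> U V * (rV U V * inverse (?r U V))) * inverse (?r U V)" for U V
    have frC: "C2 k f" for k unfolding f_def[abs_def] by (intro C2_mult pC irC)
    have frP: "has_partials f fU fV"
    proof -
      have "has_partials (\<lambda>U V. inverse (?r U V)) (\<lambda>U V. - (inverse (?r U V) * inverse (?r U V)) * rU U V)
          (\<lambda>U V. - (inverse (?r U V) * inverse (?r U V)) * rV U V)"
        by (rule has_partials_compose[OF rP]) (use rn in \<open>auto intro!: derivative_eq_intros simp: power2_eq_square\<close>)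
      from has_partials_mult[OF pP this]
      show ?thesis unfolding f_def[abs_def] fU_def[abs_def] fV_def[abs_def] by (simp add: algebra_simps)
    qed
    have rfU: "?r U V * fU U V = \<psi>U U V - \<psi> U V * (rU U V * inverse (?r U V))"
      and rfV: "?r U V * fV U V = \<psi>V U V - \<psi> U V * (rV U V * inverse (?r U V))" for U V
      using rn[of U V] by (simp_all add: fU_def fV_def)
    \<comment> \<open>In this form the radius is no longer in a denominator. Differentiating and
      using \<open>r * Q = rUV\<close> cancels the terms with \<psi> itself and leaves
      \<open>rU * \<psi>V - rV * \<psi>U\<close>, up to sign the same for both, which is the common
      value required.\<close>
    have r2: "(?r U V)\<^sup>2 * fV U V = ?r U V * \<psi>V U V - rV U V * \<psi> U V"
      "(?r U V)\<^sup>2 * fU U V = ?r U V * \<psi>U U V - rU U V * \<psi> U V" for U V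
      using rn[of U V] rfU[of U V] rfV[of U V] by (simp_all add: power2_eq_square mult.assoc field_simps)
    have wave: "radial_wave m e f fU fV"
      unfolding radial_wave_def r2
    proof (intro conjI allI frC frP exI)
      fix U V
      show "((\<lambda>U. ?r U V * \<psi>V U V - rV U V * \<psi> U V) has_real_derivative
          rU U V * \<psi>V U V - rV U V * \<psi>U U V) (at U)"
        by (rule DERIV_cong[OF DERIV_diff[OF DERIV_mult[OF has_partials_DERIV(1)[OF rP] pVD]
              DERIV_mult[OF rVD has_partials_DERIV(1)[OF pP]]]]) (use rn[of U V] in \<open>simp add: Q_def field_simps\<close>)
      show "((\<lambda>V. ?r U V * \<psi>U U V - rU U V * \<psi> U V) has_real_derivative
          - (rU U V * \<psi>V U V - rV U V * \<psi>U U V)) (at V)"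
        by (rule DERIV_cong[OF DERIV_diff[OF DERIV_mult[OF has_partials_DERIV(2)[OF rP] pUD]
              DERIV_mult[OF rUD has_partials_DERIV(2)[OF pP]]]]) (use rn[of U V] in \<open>simp add: Q_def field_simps\<close>)
    qed
    have bound: "\<bar>?r U V * fU U V\<bar> \<le> C * \<mu>" "\<bar>?r U V * fV U V - \<phi>' V\<bar> \<le> C * \<mu>"
      if UV: "\<bar>U\<bar> \<le> L" "\<bar>V\<bar> \<le> L" for U V
    proof -
      have 1: "\<bar>U - 0\<bar> \<le> A" "\<bar>V - (V0 - 1)\<bar> \<le> A" "\<bar>U - 1\<bar> \<le> A" "\<bar>V - (V0 + 1)\<bar> \<le> A"
        using UV unfolding A_def by linarith+
      have 2: "\<bar>Q U V\<bar> \<le> K" if "\<bar>U - 0\<bar> \<le> A" "\<bar>V - (V0 - 1)\<bar> \<le> A" for U V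
        using that unfolding A_def by (intro K(2)) (simp_all add: A_def)
      have 3: "\<bar>Q U V\<bar> \<le> K" if "\<bar>U - 1\<bar> \<le> A" "\<bar>V - (V0 + 1)\<bar> \<le> A" for U V
        using that unfolding A_def by (intro K(2)) (simp_all add: A_def)
      note b1 = goursat_integral_bounds[OF QC fC(1) K(1) A mu 2 fb(1) 1(1,2),
          folded \<psi>1_def G_def g1_def, folded g1_def[abs_def]]
      note b2 = goursat_integral_bounds[OF QC fC(2) K(1) A mu 3 fb(2) 1(3,4),
          folded \<psi>2_def G_def g2_def, folded g2_def[abs_def]]
      have p: "\<bar>\<psi> U V\<bar> \<le> 2 * G * \<mu>" using b1(1) b2(1) unfolding \<psi>_def by linarith
      have h: "\<bar>\<psi> U V * x\<bar> \<le> 2 * G * \<mu> * (H1 + H2)" if "\<bar>x\<bar> \<le> H1 + H2" for x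
        unfolding abs_mult using p that G mu by (intro mult_mono) auto
      have h12: "\<bar>\<psi> U V * (rU U V * inverse (?r U V))\<bar> \<le> 2 * G * \<mu> * (H1 + H2)"
        "\<bar>\<psi> U V * (rV U V * inverse (?r U V))\<bar> \<le> 2 * G * \<mu> * (H1 + H2)"
        using H1(2)[OF UV] H2(2)[OF UV] H1(1) H2(1) by (intro h; linarith)+
      have C': "C * \<mu> = K * G * A * \<mu> + K * G * A * \<mu> + 2 * G * \<mu> * (H1 + H2)"
        by (simp add: C_def algebra_simps)
      have tri: "\<bar>x + y - z\<bar> \<le> k + k + l" if "\<bar>x\<bar> \<le> k" "\<bar>y\<bar> \<le> k" "\<bar>z\<bar> \<le> l" for x y z k l :: real
        using that by linarith
      show "\<bar>?r U V * fU U V\<bar> \<le> C * \<mu>"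
        unfolding rfU \<psi>U_def C' by (rule tri[OF b1(2) b2(2) h12(1)])
      have "?r U V * fV U V - \<phi>' V
          = int_fst 0 g1 U V + int_fst 1 g2 U V - \<psi> U V * (rV U V * inverse (?r U V))"
        unfolding rfV \<psi>V_def by simp
      then show "\<bar>?r U V * fV U V - \<phi>' V\<bar> \<le> C * \<mu>"
        unfolding C' by (simp only: tri[OF b1(3) b2(3) h12(2)])
    qed
    \<comment> \<open>Each quadrant lies in a half-plane where one piece vanishes and in a
      half-plane where the other does: in the first, \<open>U \<le> 0\<close> removes \<psi>1 and
      \<open>V \<ge> V0 + 1\<close> removes \<psi>2; in the second, \<open>V \<le> V0 - 1\<close>
      removes \<psi>1 and \<open>U \<ge> 1\<close> removes \<psi>2.\<close>
    have supp: "fU U V = 0 \<and> fV U V = 0" if "(U \<le> 0 \<and> V \<ge> V0 + 1) \<or> (U \<ge> 1 \<and> V \<le> V0 - 1)" for U V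
    proof -
      have "\<bar>V - V0\<bar> \<ge> 1" using that by auto
      then have ph: "\<phi>' V = 0" using phs by blast
      have 1: "\<psi>1 U V = 0 \<and> int_snd (V0 - 1) g1 U V = 0 \<and> int_fst 0 g1 U V = 0"
      proof (cases "U \<le> 0")
        case True
        show ?thesis unfolding \<psi>1_def g1_def[abs_def]
          by (intro conjI goursat_zero_on[OF QC fC(1), where S = "\<lambda>U V. U \<le> 0"])
            (use True convex_halfline(1)[where c = 0] in \<open>auto simp: f1_def step_eq\<close>)
      next
        case False
        then have "V \<le> V0 - 1" using that by auto
        then show ?thesis unfolding \<psi>1_def g1_def[abs_def]
          by (intro conjI goursat_zero_on[OF QC fC(1), where S = "\<lambda>U V. V \<le> V0 - 1"])
            (use convex_halfline(1)[where c = "V0 - 1"] phs in \<open>auto simp: f1_def\<close>)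
      qed
      have 2: "\<psi>2 U V = 0 \<and> int_snd (V0 + 1) g2 U V = 0 \<and> int_fst 1 g2 U V = 0"
      proof (cases "U \<ge> 1")
        case True
        then show ?thesis unfolding \<psi>2_def g2_def[abs_def]
          by (intro conjI goursat_zero_on[OF QC fC(2), where S = "\<lambda>U V. U \<ge> 1"])
            (use convex_halfline(2)[where c = 1] in \<open>auto simp: f2_def step_eq\<close>)
      next
        case False
        then have "V \<ge> V0 + 1" using that by auto
        then show ?thesis unfolding \<psi>2_def g2_def[abs_def]
          by (intro conjI goursat_zero_on[OF QC fC(2), where S = "\<lambda>U V. V \<ge> V0 + 1"])
            (use convex_halfline(2)[where c = "V0 + 1"] phs in \<open>auto simp: f2_def\<close>)
      qed
      show ?thesis unfolding fU_def fV_def \<psi>U_def \<psi>V_def \<psi>_def using 1 2 ph by simp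
    qed
    show "\<exists>f fU fV. radial_wave m e f fU fV \<and>
      (\<forall>U V. \<bar>U\<bar> \<le> L \<longrightarrow> \<bar>V\<bar> \<le> L \<longrightarrow>
         \<bar>kruskal_radius m e U V * fU U V\<bar> \<le> C * \<mu> \<and> \<bar>kruskal_radius m e U V * fV U V - \<phi>' V\<bar> \<le> C * \<mu>) \<and>
      (\<forall>U V. (U \<le> 0 \<and> V \<ge> V0 + 1) \<or> (U \<ge> 1 \<and> V \<le> V0 - 1) \<longrightarrow> fU U V = 0 \<and> fV U V = 0)"
      by (intro exI[of _ f] exI[of _ fU] exI[of _ fV] conjI wave allI impI bound supp)
  qed
qed

section \<open>Reduction of the wave operator and of the energy to functions of the null
  coordinates\<close>

subsection \<open>Radial solutions and their energy\<close>

abbreviation radius_at :: "(real \<Rightarrow> real \<times> real) \<Rightarrow> real \<Rightarrow> real" where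
  "radius_at c s \<equiv> kruskal_radius m e (fst (c s)) (snd (c s))"

lemma kruskal_radius_pos: "kruskal_radius m e U V > 0"
  unfolding kruskal_radius_krad by (rule krad_pos)

lemma kruskal_F_radius_pos: "kruskal_F m e (kruskal_radius m e U V) > 0"
  unfolding kruskal_radius_krad by (rule kruskal_F_pos[OF krad_gt])

lemma matrix_inv_RN_coord_metric:
  assumes "orthogonal_matrix R" "0 < x $ 3" "x $ 3 < pi"
  shows "matrix_inv (RN_coord_metric m e R x) =
    (let r = kruskal_radius m e (x $ 1) (x $ 2)
     in null_block (- 2 / kruskal_F m e r) (1 / r\<^sup>2) (1 / (r\<^sup>2 * (sin (x $ 3))\<^sup>2)))"
  unfolding RN_coord_metric_null_block[OF assms(1)] Let_def
  using kruskal_radius_pos[of "x $ 1" "x $ 2"] kruskal_F_radius_pos[of "x $ 1" "x $ 2"] sin_gt_zero[OF assms(2,3)]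
  by (subst matrix_inv_null_block) auto

lemma sqrt_det_RN_coord_metric:
  assumes "orthogonal_matrix R" "0 < x $ 3" "x $ 3 < pi"
  shows "sqrt \<bar>det (RN_coord_metric m e R x)\<bar> =
    (let r = kruskal_radius m e (x $ 1) (x $ 2) in kruskal_F m e r / 2 * r\<^sup>2 * sin (x $ 3))"
proof -
  let ?r = "kruskal_radius m e (x $ 1) (x $ 2)"
  have "\<bar>det (RN_coord_metric m e R x)\<bar> = (kruskal_F m e ?r / 2 * ?r\<^sup>2 * sin (x $ 3))\<^sup>2"
    unfolding RN_coord_metric_null_block[OF assms(1)] Let_def abs_det_null_block
    by (simp add: power_mult_distrib power2_eq_square)
  then show ?thesis
    using kruskal_radius_pos[of "x $ 1" "x $ 2"] kruskal_F_radius_pos[of "x $ 1" "x $ 2"] sin_gt_zero[OF assms(2,3)]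
    by (simp add: Let_def real_sqrt_unique)
qed

text \<open>In divergence form the volume factor \<open>F / 2 * r^2 * sin\<close> meets the inverse
  metric entry \<open>- 2 / F\<close>. The coefficient F cancels, and what remains is the pair of
  derivatives in \<open>radial_wave\<close>, times \<open>- sin\<close>.\<close>

lemma wave_solution_radial:
  assumes "radial_wave m e f fU fV"
  shows "wave_solution m e (radial f)"
  unfolding wave_solution_def
proof (intro conjI allI impI, goal_cases)
  case 1
  have "Ck_on k UNIV (radial f)" for k
    unfolding radial_def[abs_def] using assms by (intro Ck_on_radial) (simp add: radial_wave_def)
  then show ?case unfolding smooth_on_diamond_def smooth_on_def
    by (intro exI[of _ UNIV] exI[of _ "radial f"]) simp
next
  case (2 R x)
  then have R: "orthogonal_matrix R" and x: "0 < x $ 3" "x $ 3 < pi" by auto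
  have P: "has_partials f fU fV" using assms by (simp add: radial_wave_def)
  let ?r = "\<lambda>U V. kruskal_radius m e U V"
  obtain X where X: "((\<lambda>U. (?r U (x $ 2))\<^sup>2 * fV U (x $ 2)) has_real_derivative X) (at (x $ 1))"
    "((\<lambda>V. (?r (x $ 1) V)\<^sup>2 * fU (x $ 1) V) has_real_derivative - X) (at (x $ 2))"
    using assms unfolding radial_wave_def by blast
  define Z where "Z i y = sqrt \<bar>det (RN_coord_metric m e R y)\<bar> *\<^sub>R (\<Sum>j\<in>UNIV. (matrix_inv (RN_coord_metric m e R y) $ i $ j) *\<^sub>R
      pderiv_at (radial f \<circ> kruskal_chart R) j y)" for i y
  have Z: "Z 1 y = complex_of_real (- sin (y $ 3) * ((?r (y $ 1) (y $ 2))\<^sup>2 * fV (y $ 1) (y $ 2)))"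
    "Z 2 y = complex_of_real (- sin (y $ 3) * ((?r (y $ 1) (y $ 2))\<^sup>2 * fU (y $ 1) (y $ 2)))"
    "Z 3 y = 0" "Z 4 y = 0" if y: "0 < y $ 3" "y $ 3 < pi" for y
    unfolding Z_def radial_chart matrix_inv_RN_coord_metric[OF R y] sqrt_det_RN_coord_metric[OF R y] Let_def
      sum_4 pderiv_at_radial[OF P] scaleR_conv_of_real
    using kruskal_F_radius_pos[of "y $ 1" "y $ 2"] by (simp_all add: field_simps flip: of_real_mult)
  have "pderiv_at (Z 1) 1 x = complex_of_real (- sin (x $ 3) * X)"
  proof -
    have "((\<lambda>h. complex_of_real (- sin (x $ 3) * ((?r (x $ 1 + h) (x $ 2))\<^sup>2 * fV (x $ 1 + h) (x $ 2))))
        has_vector_derivative complex_of_real (- sin (x $ 3) * X)) (at 0)"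
      using DERIV_shift[of "\<lambda>U. (?r U (x $ 2))\<^sup>2 * fV U (x $ 2)" X 0 "x $ 1"] X(1)
      by (intro has_vector_derivative_of_real DERIV_cmult) (simp add: add.commute)
    then show ?thesis unfolding pderiv_at_def using x by (simp add: Z axis_def vector_derivative_at)
  qed
  moreover have "pderiv_at (Z 2) 2 x = complex_of_real (- sin (x $ 3) * - X)"
  proof -
    have "((\<lambda>h. complex_of_real (- sin (x $ 3) * ((?r (x $ 1) (x $ 2 + h))\<^sup>2 * fU (x $ 1) (x $ 2 + h))))
        has_vector_derivative complex_of_real (- sin (x $ 3) * - X)) (at 0)"
      using DERIV_shift[of "\<lambda>V. (?r (x $ 1) V)\<^sup>2 * fU (x $ 1) V" "- X" 0 "x $ 2"] X(2)
      by (intro has_vector_derivative_of_real DERIV_cmult) (simp add: add.commute)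
    then show ?thesis unfolding pderiv_at_def using x by (simp add: Z axis_def vector_derivative_at)
  qed
  moreover have "pderiv_at (Z 3) 3 x = 0"
  proof -
    \<comment> \<open>The formula for \<open>Z 3\<close> is available only for polar angles strictly
      between 0 and \<pi>, so the vanishing of this derivative needs an open interval of
      shifts.\<close>
    have "((\<lambda>h. Z 3 (x + h *\<^sub>R axis 3 1)) has_vector_derivative 0) (at 0)"
    proof (rule has_vector_derivative_transform_within_open)
      show "((\<lambda>h::real. 0 :: complex) has_vector_derivative 0) (at 0)" by simp
      show "open {- (x $ 3)<..<pi - x $ 3}" "0 \<in> {- (x $ 3)<..<pi - x $ 3}" using x by auto
      show "0 = Z 3 (x + h *\<^sub>R axis 3 1)" if "h \<in> {- (x $ 3)<..<pi - x $ 3}" for h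
        using that by (subst Z(3)) (auto simp: axis_def)
    qed
    then show ?thesis unfolding pderiv_at_def by (rule vector_derivative_at)
  qed
  moreover have "pderiv_at (Z 4) 4 x = 0"
    unfolding pderiv_at_def using x by (simp add: Z axis_def)
  ultimately have "(\<Sum>i\<in>UNIV. pderiv_at (Z i) i x) = 0" unfolding sum_4 by simp
  then show ?case unfolding dalembertian_def Z_def[abs_def] by simp
qed

text \<open>The tangent vector without angular part has squared length \<open>- F * U' * V'\<close>;
  positivity of this forces opposite signs.\<close>

lemma spacelike_slice_deriv:
  assumes "spacelike_slice m e c J" "s \<in> J"
  shows "(c has_vector_derivative vector_derivative c (at s)) (at s)"
    and "dU c s * dV c s < 0"
    and "continuous_on J (\<lambda>s. vector_derivative c (at s))" "continuous_on J c"
proof -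
  have sm: "smooth_on J c" using assms(1) by (simp add: spacelike_slice_def)
  from smooth_on_curve[OF this] assms(2)
  show "(c has_vector_derivative vector_derivative c (at s)) (at s)"
    and "continuous_on J (\<lambda>s. vector_derivative c (at s))" "continuous_on J c" by auto
  obtain \<omega> :: "real^3" where \<omega>: "norm \<omega> = 1" using vector_choose_size[of 1] by auto
  have "0 < RN_metric m e (fst (c s), snd (c s), \<omega>)
     (1 * dU c s, 1 * dV c s, 0)
     (1 * dU c s, 1 * dV c s, 0)"
    using assms \<omega> unfolding spacelike_slice_def Let_def by (force simp: sphere_def dist_norm)
  then have "0 < - (kruskal_F m e (radius_at c s)
      * (dU c s * dV c s))"
    by (simp add: RN_metric_def algebra_simps)
  then show "dU c s * dV c s < 0"
    using kruskal_F_radius_pos[of "fst (c s)" "snd (c s)"] by (simp add: zero_less_mult_iff mult_less_0_iff)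
qed

lemma bilin_RN_coord_metric:
  assumes "orthogonal_matrix R"
  shows "bilin (RN_coord_metric m e R) x X Y =
    (let r = kruskal_radius m e (x $ 1) (x $ 2)
     in - kruskal_F m e r / 2 * (X $ 1 * Y $ 2 + X $ 2 * Y $ 1) + r\<^sup>2 * (X $ 3 * Y $ 3)
        + r\<^sup>2 * (sin (x $ 3))\<^sup>2 * (X $ 4 * Y $ 4))"
  unfolding bilin_def RN_coord_metric_null_block[OF assms] Let_def inner_vec_def matrix_vector_mult_def sum_4
  by (simp add: sum_4 algebra_simps)

lemma pderiv_slice_param:
  assumes "(c has_vector_derivative c') (at (y $ 1))"
  shows "pderiv_at (slice_param c) 1 y = fst c' *\<^sub>R axis 1 1 + snd c' *\<^sub>R axis 2 1"
    "pderiv_at (slice_param c) 2 y = axis 3 1" "pderiv_at (slice_param c) 3 y = axis 4 1"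
proof -
  have eq: "slice_param c z = fst (c (z $ 1)) *\<^sub>R axis 1 1 + snd (c (z $ 1)) *\<^sub>R axis 2 1
      + (z $ 2) *\<^sub>R axis 3 1 + (z $ 3) *\<^sub>R axis 4 1" for z :: "real^3"
    unfolding slice_param_def vec_eq_iff forall_4 by (simp add: axis_def)
  have "((\<lambda>h. y $ 1 + h) has_vector_derivative 1) (at 0)" by (auto intro!: derivative_eq_intros)
  from vector_diff_chain_at[OF this, of c c'] assms
  have c: "((\<lambda>h. c (y $ 1 + h)) has_vector_derivative c') (at 0)" by (simp add: o_def)
  have "((\<lambda>h. fst (c (y $ 1 + h)) *\<^sub>R axis 1 1 + snd (c (y $ 1 + h)) *\<^sub>R axis 2 1
      + (y $ 2) *\<^sub>R axis 3 1 + (y $ 3) *\<^sub>R axis 4 1) has_vector_derivative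
      (fst c' *\<^sub>R axis 1 1 + snd c' *\<^sub>R axis 2 1 :: real^4)) (at 0)"
    using bounded_linear.has_vector_derivative[OF bounded_linear_fst c]
      bounded_linear.has_vector_derivative[OF bounded_linear_snd c]
    by (auto intro!: derivative_eq_intros simp: has_real_derivative_iff_has_vector_derivative)
  then show "pderiv_at (slice_param c) 1 y = fst c' *\<^sub>R axis 1 1 + snd c' *\<^sub>R axis 2 1"
    unfolding pderiv_at_def eq by (simp add: axis_def[of "1::3"] vector_derivative_at)
  have "((\<lambda>h. fst (c (y $ 1)) *\<^sub>R axis 1 1 + snd (c (y $ 1)) *\<^sub>R axis 2 1
      + (y $ 2 + h) *\<^sub>R axis 3 1 + (y $ 3) *\<^sub>R axis 4 1) has_vector_derivative
      (axis 3 1 :: real^4)) (at 0)"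
    by (auto intro!: derivative_eq_intros)
  then show "pderiv_at (slice_param c) 2 y = axis 3 1"
    unfolding pderiv_at_def eq by (simp add: axis_def[of "2::3"] vector_derivative_at)
  have "((\<lambda>h. fst (c (y $ 1)) *\<^sub>R axis 1 1 + snd (c (y $ 1)) *\<^sub>R axis 2 1
      + (y $ 2) *\<^sub>R axis 3 1 + (y $ 3 + h) *\<^sub>R axis 4 1) has_vector_derivative
      (axis 4 1 :: real^4)) (at 0)"
    by (auto intro!: derivative_eq_intros)
  then show "pderiv_at (slice_param c) 3 y = axis 4 1"
    unfolding pderiv_at_def eq by (simp add: axis_def[of "3::3"] vector_derivative_at)
qed

text \<open>Energy per unit of curve parameter and of solid angle. The root is the length of the
  tangent vector of the curve.\<close>

definition energy_density ::
  "(real \<Rightarrow> real \<times> real) \<Rightarrow> (real \<Rightarrow> real \<Rightarrow> real) \<Rightarrow> (real \<Rightarrow> real \<Rightarrow> real) \<Rightarrow> real \<Rightarrow> real" where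
  "energy_density c fU fV s =
     (let U = fst (c s); V = snd (c s); r = kruskal_radius m e U V;
          U' = dU c s; V' = dV c s
      in ((r * fU U V)\<^sup>2 * U'\<^sup>2 + (r * fV U V)\<^sup>2 * V'\<^sup>2) / sqrt (kruskal_F m e r * \<bar>U' * V'\<bar>))"

text \<open>As \<open>U'\<close> and \<open>V'\<close> have opposite signs, the vector with
  components \<open>\<bar>U'\<bar> / N\<close> and \<open>\<bar>V'\<bar> / N\<close> is orthogonal
  to the tangent. Its components have product \<open>1 / F\<close>, which is what removes the mixed
  term in the two derivatives of \<open>f\<close>.\<close>

lemma energy_integrand:
  assumes sp: "spacelike_slice m e c J" and y1: "y $ 1 \<in> J" and y2: "0 < y $ 2" "y $ 2 < pi"
    and P: "has_partials f fU fV"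
  shows "Re (stress_energy (RN_coord_metric m e (mat 1)) (radial f \<circ> kruskal_chart (mat 1))
                       (slice_param c y) (unit_normal m e c y) (unit_normal m e c y))
                 * sqrt (det (induced_metric m e c y)) = energy_density c fU fV (y $ 1) * sin (y $ 2)"
proof -
  let ?x = "slice_param c y"
  define U V where "U = fst (c (y $ 1))" and "V = snd (c (y $ 1))"
  define r where "r = kruskal_radius m e U V"
  define F where "F = kruskal_F m e r"
  define U' V' where "U' = dU c (y $ 1)" and "V' = dV c (y $ 1)"
  define N where "N = sqrt (F * \<bar>U' * V'\<bar>)"
  define S where "S = sin (y $ 2)"
  have R: "orthogonal_matrix (mat 1 :: real^3^3)" by (rule orthogonal_matrix_id)
  have F: "F > 0" unfolding F_def r_def by (rule kruskal_F_radius_pos)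
  have r: "r > 0" unfolding r_def by (rule kruskal_radius_pos)
  have S: "S > 0" unfolding S_def using y2 by (rule sin_gt_zero)
  have neg: "U' * V' < 0" unfolding U'_def V'_def by (rule spacelike_slice_deriv(2)[OF sp y1])
  then have nz: "U' \<noteq> 0" "V' \<noteq> 0" by auto
  have N2: "N\<^sup>2 = F * \<bar>U' * V'\<bar>" and N: "N > 0" using F nz by (auto simp: N_def)
  have x [simp]: "?x $ 1 = U" "?x $ 2 = V" "?x $ 3 = y $ 2" by (simp_all add: slice_param_def U_def V_def)
  note pd = pderiv_slice_param[OF spacelike_slice_deriv(1)[OF sp y1], folded U'_def V'_def]
  have g: "bilin (RN_coord_metric m e (mat 1)) ?x X Y =
      - F / 2 * (X $ 1 * Y $ 2 + X $ 2 * Y $ 1) + r\<^sup>2 * (X $ 3 * Y $ 3) + r\<^sup>2 * S\<^sup>2 * (X $ 4 * Y $ 4)" for X Y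
    unfolding bilin_RN_coord_metric[OF R] Let_def x r_def F_def S_def ..
  define n :: "real^4" where "n = (\<bar>U'\<bar> / N) *\<^sub>R axis 1 1 + (\<bar>V'\<bar> / N) *\<^sub>R axis 2 1"
  have n: "n $ 1 = \<bar>U'\<bar> / N" "n $ 2 = \<bar>V'\<bar> / N" "n $ 3 = 0" "n $ 4 = 0"
    by (simp_all add: n_def axis_def)
  have n12: "F * (n $ 1 * n $ 2) = 1"
  proof -
    have "F * (n $ 1 * n $ 2) = F * \<bar>U' * V'\<bar> / N\<^sup>2" by (simp add: n power2_eq_square abs_mult)
    also have "\<dots> = 1" unfolding N2 using F nz by simp
    finally show ?thesis .
  qed
  have "bilin (RN_coord_metric m e (mat 1)) ?x n n = - (F * (n $ 1 * n $ 2))"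
    unfolding g by (simp add: n(3,4))
  then have gn: "bilin (RN_coord_metric m e (mat 1)) ?x n n = - 1" unfolding n12 .
  have normal: "unit_normal m e c y = n"
    unfolding unit_normal_def Let_def
  proof (rule the_equality)
    have opp: "\<bar>U'\<bar> * V' + \<bar>V'\<bar> * U' = 0" using neg by (auto simp: abs_if mult_less_0_iff)
    have "bilin (RN_coord_metric m e (mat 1)) ?x n (pderiv_at (slice_param c) k y) = 0" for k
    proof -
      have "\<bar>U'\<bar> / N * V' + \<bar>V'\<bar> / N * U' = 0" using opp N by (simp add: field_simps)
      then have "\<forall>k. bilin (RN_coord_metric m e (mat 1)) ?x n (pderiv_at (slice_param c) k y) = 0"
        unfolding g forall_3 pd by (simp add: axis_def n)
      then show ?thesis by blast
    qed
    moreover have "bilin (RN_coord_metric m e (mat 1)) ?x n (axis 1 1 + axis 2 1) < 0"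
      unfolding g using F N nz by (simp add: n axis_def add_pos_pos flip: add_divide_distrib)
    ultimately show "bilin (RN_coord_metric m e (mat 1)) ?x n n = - 1 \<and>
      (\<forall>k. bilin (RN_coord_metric m e (mat 1)) ?x n (pderiv_at (slice_param c) k y) = 0) \<and>
      bilin (RN_coord_metric m e (mat 1)) ?x n (axis 1 1 + axis 2 1) < 0" using gn by blast
  next
    fix l assume l: "bilin (RN_coord_metric m e (mat 1)) ?x l l = - 1 \<and>
      (\<forall>k. bilin (RN_coord_metric m e (mat 1)) ?x l (pderiv_at (slice_param c) k y) = 0) \<and>
      bilin (RN_coord_metric m e (mat 1)) ?x l (axis 1 1 + axis 2 1) < 0"
    \<comment> \<open>For uniqueness: orthogonality fixes the ratio of the two null components,
      normalisation their product, and the time orientation their common sign.\<close>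
    have l34: "l $ 3 = 0" "l $ 4 = 0" and o: "l $ 1 * V' + l $ 2 * U' = 0"
      using l r S F unfolding g forall_3 pd by (auto simp: axis_def)
    have l12: "F * (l $ 1 * l $ 2) = 1" using l unfolding g l34 by simp
    have pos: "l $ 1 + l $ 2 > 0" using l F unfolding g by (simp add: axis_def mult_pos_neg mult_less_0_iff zero_less_mult_iff)
    have "l $ 1 * l $ 2 > 0" using l12 F by (metis zero_less_mult_pos zero_less_one)
    with pos have l0: "l $ 1 > 0" "l $ 2 > 0" by (auto simp: zero_less_mult_iff)
    have oo: "l $ 1 * \<bar>V'\<bar> = l $ 2 * \<bar>U'\<bar>"
      using o neg by (auto simp: abs_if mult_less_0_iff algebra_simps)
    have "(l $ 1)\<^sup>2 = (n $ 1)\<^sup>2"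
    proof -
      have "(l $ 1)\<^sup>2 * N\<^sup>2 = (F * (l $ 1 * l $ 2)) * \<bar>U'\<bar>\<^sup>2"
      proof -
        have "(l $ 1)\<^sup>2 * N\<^sup>2 = F * l $ 1 * (l $ 1 * \<bar>V'\<bar>) * \<bar>U'\<bar>"
          unfolding N2 abs_mult by (simp add: power2_eq_square mult_ac)
        also have "\<dots> = (F * (l $ 1 * l $ 2)) * \<bar>U'\<bar>\<^sup>2"
          unfolding oo by (simp add: power2_eq_square mult_ac)
        finally show ?thesis .
      qed
      then show ?thesis unfolding l12 using N by (simp add: n power_divide field_simps)
    qed
    then have 1: "l $ 1 = n $ 1" by (rule power2_eq_imp_eq) (use l0 N in \<open>simp_all add: n(1)\<close>)
    have "l $ 2 = (l $ 1 * \<bar>V'\<bar>) / \<bar>U'\<bar>" unfolding oo using nz by simp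
    also have "\<dots> = n $ 2" unfolding 1 n using nz by simp
    finally have "l $ 2 = n $ 2" .
    with 1 l34 show "l = n" unfolding vec_eq_iff forall_4 by (simp add: n(3,4))
  qed
  have ind: "induced_metric m e c y = (\<chi> i j. bilin (RN_coord_metric m e (mat 1)) ?x (pderiv_at (slice_param c) i y) (pderiv_at (slice_param c) j y))"
    by (simp add: induced_metric_def pullback_metric_def)
  have "det (induced_metric m e c y) = (N * r\<^sup>2 * S)\<^sup>2"
    unfolding ind det_3 vec_lambda_beta pd g power_mult_distrib N2
    using neg by (simp add: axis_def power2_eq_square)
  then have det: "sqrt (det (induced_metric m e c y)) = N * r\<^sup>2 * S" using N r S by simp
  have dif: "differential (radial f \<circ> kruskal_chart (mat 1)) ?x n = complex_of_real (n $ 1 * fU U V + n $ 2 * fV U V)"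
    unfolding differential_def radial_chart sum_4 pderiv_at_radial[OF P]
    by (simp add: n(3,4) scaleR_conv_of_real)
  have inv: "matrix_inv (RN_coord_metric m e (mat 1) ?x) = null_block (- 2 / F) (1 / r\<^sup>2) (1 / (r\<^sup>2 * S\<^sup>2))"
    using matrix_inv_RN_coord_metric[OF R, of ?x] y2 by (simp add: Let_def F_def r_def S_def)
  have "stress_energy (RN_coord_metric m e (mat 1)) (radial f \<circ> kruskal_chart (mat 1)) ?x n n
      = complex_of_real ((n $ 1 * fU U V + n $ 2 * fV U V)\<^sup>2 - 2 / F * (fU U V * fV U V))"
    unfolding stress_energy_def radial_chart dif[unfolded radial_chart] gn inv sum_4 pderiv_at_radial[OF P]
    by (simp add: scaleR_conv_of_real power2_eq_square algebra_simps)
  then have "Re (stress_energy (RN_coord_metric m e (mat 1)) (radial f \<circ> kruskal_chart (mat 1)) ?x n n)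
      = (n $ 1 * fU U V + n $ 2 * fV U V)\<^sup>2 - 2 / F * (fU U V * fV U V)" by simp
  also have "\<dots> = (n $ 1 * fU U V)\<^sup>2 + (n $ 2 * fV U V)\<^sup>2"
  proof -
    \<comment> \<open>The trace term of the stress tensor is exactly the cross term of the
      square.\<close>
    have "2 / F = 2 * (n $ 1 * n $ 2)" using n12 F by (simp add: field_simps)
    then show ?thesis by (simp only:) (simp add: power2_eq_square algebra_simps)
  qed
  finally have T: "Re (stress_energy (RN_coord_metric m e (mat 1)) (radial f \<circ> kruskal_chart (mat 1)) ?x n n)
      = (U'\<^sup>2 * (fU U V)\<^sup>2 + V'\<^sup>2 * (fV U V)\<^sup>2) / N\<^sup>2"
    by (simp add: n power_mult_distrib power_divide add_divide_distrib)
  have ed: "energy_density c fU fV (y $ 1) = ((r * fU U V)\<^sup>2 * U'\<^sup>2 + (r * fV U V)\<^sup>2 * V'\<^sup>2) / N"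
    unfolding energy_density_def Let_def U_def V_def r_def F_def U'_def V'_def N_def ..
  show ?thesis unfolding normal T det ed S_def[symmetric]
    using N by (simp add: power2_eq_square field_simps)
qed

lemma energy_radial:
  assumes "spacelike_slice m e c J" "has_partials f fU fV"
  shows "energy m e c J (radial f) =
    (\<integral>\<^sup>+ y \<in> {y::real^3. y $ 1 \<in> J \<and> 0 < y $ 2 \<and> y $ 2 < pi \<and> 0 < y $ 3 \<and> y $ 3 < 2 * pi}.
       ennreal (energy_density c fU fV (y $ 1) * sin (y $ 2)) \<partial>lborel)"
  unfolding energy_def
proof (rule nn_integral_cong, goal_cases)
  case (1 y)
  show ?case
  proof (cases "y $ 1 \<in> J \<and> 0 < y $ 2 \<and> y $ 2 < pi")
    case True
    then show ?thesis using energy_integrand[OF assms(1) _ _ _ assms(2), of y] by simp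
  qed (auto simp: indicator_def)
qed

section \<open>Monotonicity and ends of spacelike curves in the Kruskal plane\<close>

subsection \<open>Spacelike slices\<close>

lemma kruskal_product_strict_antimono:
  assumes "r_minus m e < r" "r < r'"
  shows "kruskal_product m e r' < kruskal_product m e r"
proof (rule DERIV_neg_imp_decreasing[OF assms(2)])
  fix y assume "r \<le> y" "y \<le> r'"
  then have y: "r_minus m e < y" using assms(1) by simp
  then have "y > 0" using r_minus_pos[OF e0 em] by simp
  then have "- 2 * kappa_plus m e * y\<^sup>2 * exp (2 * kappa_plus m e * y)
      * (y - r_minus m e) powr (- (kappa_plus m e / kappa_minus m e) - 1) < 0"
    using kappa_plus_pos[OF e0 em] y by (simp add: mult_neg_pos)
  then show "\<exists>d. (kruskal_product m e has_real_derivative d) (at y) \<and> d < 0"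
    using DERIV_kruskal_product[OF e0 em y] by blast
qed

lemma kruskal_radius_gt:
  assumes "r_minus m e < R" "U * V < kruskal_product m e R"
  shows "R < kruskal_radius m e U V"
proof (rule ccontr)
  assume "\<not> R < kruskal_radius m e U V"
  then consider "krad m e (U * V) < R" | "krad m e (U * V) = R" unfolding kruskal_radius_krad by linarith
  then show False
  proof cases
    case 1
    from kruskal_product_strict_antimono[OF krad_gt this] show False
      using assms kruskal_product_krad[of "U * V"] by simp
  next
    case 2
    then show False using assms kruskal_product_krad[of "U * V"] by simp
  qed
qed

text \<open>A curve along which both null coordinates increase, at a fixed point of the sphere, is
  timelike. One of the coordinates is the parameter itself, so no limit exists in either direction
  and the curve is inextendible.\<close>

lemma cauchy_hypersurface_hit:
  assumes cau: "cauchy_hypersurface m e (slice c J)"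
    and a: "\<And>s. (\<alpha> has_real_derivative \<alpha>' s) (at s)" "continuous_on UNIV \<alpha>'" "\<And>s. \<alpha>' s > 0"
    and b: "\<And>s. (\<beta> has_real_derivative \<beta>' s) (at s)" "continuous_on UNIV \<beta>'" "\<And>s. \<beta>' s > 0"
    and id: "(\<forall>s. \<alpha> s = s) \<or> (\<forall>s. \<beta> s = s)"
  shows "\<exists>s. \<exists>t\<in>J. c t = (\<alpha> s, \<beta> s)"
proof -
  obtain \<omega> :: "real^3" where \<omega>: "norm \<omega> = 1" using vector_choose_size[of 1] by auto
  define \<gamma> :: "real \<Rightarrow> event" where "\<gamma> s = (\<alpha> s, \<beta> s, \<omega>)" for s
  have d: "(\<gamma> has_vector_derivative (\<alpha>' s, \<beta>' s, 0)) (at s)" for s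
    unfolding \<gamma>_def[abs_def]
    by (intro has_vector_derivative_Pair has_vector_derivative_const)
      (use a(1) b(1) in \<open>simp_all add: has_real_derivative_iff_has_vector_derivative\<close>)
  have "\<gamma> C1_differentiable_on UNIV"
    unfolding C1_differentiable_on_def
    by (intro exI[of _ "\<lambda>s. (\<alpha>' s, \<beta>' s, 0)"] conjI ballI d continuous_intros a(2) b(2))
  moreover have "range \<gamma> \<subseteq> diamond" using \<omega> by (auto simp: \<gamma>_def diamond_def)
  moreover have "RN_metric m e (\<gamma> s) (vector_derivative \<gamma> (at s)) (vector_derivative \<gamma> (at s)) < 0" for s
    unfolding vector_derivative_at[OF d] \<gamma>_def RN_metric_def
    using mult_pos_pos[OF mult_pos_pos[OF kruskal_F_radius_pos[of "\<alpha> s" "\<beta> s"] a(3)[of s]] b(3)[of s]]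
    by (simp add: algebra_simps)
  ultimately have tl: "timelike_curve m e \<gamma>" unfolding timelike_curve_def by blast
  have no: "\<not> ((\<lambda>s::real. s) \<longlongrightarrow> l) at_top" "\<not> ((\<lambda>s::real. s) \<longlongrightarrow> l) at_bot" for l :: real
  proof safe
    assume "((\<lambda>s::real. s) \<longlongrightarrow> l) at_top"
    from order_tendstoD(2)[OF this, of "l + 1"] have "eventually (\<lambda>s. s < l + 1) at_top" by simp
    then obtain N where "\<forall>s\<ge>N. s < l + 1" unfolding eventually_at_top_linorder by blast
    from this[rule_format, of "max N (l + 1)"] show False by simp
  next
    assume "((\<lambda>s::real. s) \<longlongrightarrow> l) at_bot"
    from order_tendstoD(1)[OF this, of "l - 1"] have "eventually (\<lambda>s. s > l - 1) at_bot" by simp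
    then obtain N where "\<forall>s\<le>N. s > l - 1" unfolding eventually_at_bot_linorder by blast
    from this[rule_format, of "min N (l - 1)"] show False by simp
  qed
  have lim: "\<not> (\<gamma> \<longlongrightarrow> p) F" if F: "F = at_top \<or> F = at_bot" for p F
  proof
    assume "(\<gamma> \<longlongrightarrow> p) F"
    from tendsto_fst[OF this] tendsto_fst[OF tendsto_snd[OF this]]
    have "(\<alpha> \<longlongrightarrow> fst p) F" "(\<beta> \<longlongrightarrow> fst (snd p)) F" by (simp_all add: \<gamma>_def)
    moreover have "\<alpha> = (\<lambda>s. s) \<or> \<beta> = (\<lambda>s. s)" using id by (auto simp: fun_eq_iff)
    ultimately show False using no F by auto
  qed
  have "inextendible_curve \<gamma>" unfolding inextendible_curve_def using lim by blast
  then obtain s where "\<gamma> s \<in> slice c J" using cau tl unfolding cauchy_hypersurface_def by blast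
  then have "\<exists>t\<in>J. c t = (\<alpha> s, \<beta> s)" by (auto simp: slice_def \<gamma>_def)
  then show ?thesis ..
qed

text \<open>The product of the derivatives never vanishes, so \<open>V'\<close> keeps its sign on
  the interval by the intermediate value property. The direction of the parametrisation is not
  prescribed, hence two cases.\<close>

lemma slice_monotone_deriv:
  assumes sp: "spacelike_slice m e c J"
  shows "V_increasing c J \<and>
         (\<forall>s\<in>J. dV c s > 0 \<and> dU c s < 0) \<or>
         V_decreasing c J \<and>
         (\<forall>s\<in>J. dV c s < 0 \<and> dU c s > 0)"
proof -
  let ?V' = "\<lambda>s. dV c s" and ?U' = "\<lambda>s. dU c s"
  have J: "is_interval J" using sp by (simp add: spacelike_slice_def)
  have D: "((\<lambda>s. snd (c s)) has_real_derivative ?V' s) (at s)" "((\<lambda>s. fst (c s)) has_real_derivative ?U' s) (at s)"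
    if "s \<in> J" for s
    unfolding has_real_derivative_iff_has_vector_derivative
    using bounded_linear.has_vector_derivative[OF bounded_linear_snd spacelike_slice_deriv(1)[OF sp that]]
      bounded_linear.has_vector_derivative[OF bounded_linear_fst spacelike_slice_deriv(1)[OF sp that]] by auto
  have neg: "?U' s * ?V' s < 0" if "s \<in> J" for s using spacelike_slice_deriv(2)[OF sp that] .
  have sub: "x \<in> J" if "s \<in> J" "t \<in> J" "s \<le> x" "x \<le> t" for s t x
    using J that unfolding is_interval_1 by blast
  have same: "?V' t > 0" if st: "s \<in> J" "t \<in> J" "?V' s > 0" for s t
  proof (rule ccontr)
    assume "\<not> ?V' t > 0"
    have "continuous_on J ?V'"
      using spacelike_slice_deriv(3)[OF sp st(1)] by (intro continuous_intros)
    then have iv: "is_interval (?V' ` J)"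
      using J by (simp add: is_interval_connected_1 connected_continuous_image)
    have "0 \<in> ?V' ` J"
      by (rule mem_is_interval_1_I[OF iv, of "?V' t" "?V' s"]) (use st \<open>\<not> ?V' t > 0\<close> in auto)
    then obtain x where x: "x \<in> J" "0 = ?V' x" by (rule imageE)
    show False using neg[OF x(1)] unfolding x(2)[symmetric] by simp
  qed
  show ?thesis
  proof (cases "\<exists>s\<in>J. ?V' s > 0")
    case True
    then have pos: "?V' s > 0" if "s \<in> J" for s using same that by blast
    have neg': "?U' s < 0" if "s \<in> J" for s using neg[OF that] pos[OF that] by (auto simp: mult_less_0_iff)
    have "snd (c s) < snd (c t) \<and> fst (c t) < fst (c s)" if st: "s \<in> J" "t \<in> J" "s < t" for s t
    proof
      show "snd (c s) < snd (c t)"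
        by (rule DERIV_pos_imp_increasing[OF st(3)]) (use D(1)[OF sub[OF st(1,2)]] pos[OF sub[OF st(1,2)]] in blast)
      show "fst (c t) < fst (c s)"
        by (rule DERIV_neg_imp_decreasing[OF st(3)]) (use D(2)[OF sub[OF st(1,2)]] neg'[OF sub[OF st(1,2)]] in blast)
    qed
    then show ?thesis using pos neg' by blast
  next
    case False
    have V': "?V' s < 0" if "s \<in> J" for s using False neg[OF that] that by (auto simp: mult_less_0_iff)
    have U': "?U' s > 0" if "s \<in> J" for s using neg[OF that] V'[OF that] by (auto simp: mult_less_0_iff)
    have "snd (c t) < snd (c s) \<and> fst (c s) < fst (c t)" if st: "s \<in> J" "t \<in> J" "s < t" for s t
    proof
      show "snd (c t) < snd (c s)"
        by (rule DERIV_neg_imp_decreasing[OF st(3)]) (use D(1)[OF sub[OF st(1,2)]] V'[OF sub[OF st(1,2)]] in blast)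
      show "fst (c s) < fst (c t)"
        by (rule DERIV_pos_imp_increasing[OF st(3)]) (use D(2)[OF sub[OF st(1,2)]] U'[OF sub[OF st(1,2)]] in blast)
    qed
    then show ?thesis using V' U' by blast
  qed
qed

lemmas slice_monotone = slice_monotone_deriv[THEN disj_forward, OF _ conjunct1 conjunct1]

text \<open>A consequence of monotonicity that does not mention the direction of the
  parametrisation.\<close>

lemma slice_order:
  assumes sp: "spacelike_slice m e c J" and "s \<in> J" "t \<in> J"
  shows "snd (c s) < snd (c t) \<longleftrightarrow> fst (c t) < fst (c s)"
  using slice_monotone[OF sp]
proof
  assume "V_increasing c J"
  note this[rule_format, OF assms(2,3)] this[rule_format, OF assms(3,2)]
  then show ?thesis by (cases s t rule: linorder_cases) auto
next
  assume "V_decreasing c J"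
  note this[rule_format, OF assms(2,3)] this[rule_format, OF assms(3,2)]
  then show ?thesis by (cases s t rule: linorder_cases) auto
qed

text \<open>Beyond the ends of a segment the slice stays in the two quadrants cut out at the end
  points. If the end points lie in the zero quadrants of a wave packet, so does everything beyond
  them.\<close>

lemma slice_between:
  assumes sp: "spacelike_slice m e c J" and J: "s \<in> J" "t \<in> J" "x \<in> J" and x: "x \<notin> closed_segment s t"
    and st: "snd (c s) < snd (c t)"
  shows "snd (c x) < snd (c s) \<and> fst (c x) > fst (c s) \<or> snd (c x) > snd (c t) \<and> fst (c x) < fst (c t)"
proof -
  have ne: "s \<noteq> t" using st by auto
  from slice_monotone[OF sp] show ?thesis
  proof
    assume *: "V_increasing c J"
    then have "s < t" using *[rule_format, OF J(2,1)] ne st by (cases s t rule: linorder_cases) auto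
    then have "x < s \<or> t < x" using x by (auto simp: closed_segment_eq_real_ivl)
    then show ?thesis using *[rule_format, OF J(3,1)] *[rule_format, OF J(2,3)] by blast
  next
    assume *: "V_decreasing c J"
    then have "t < s" using *[rule_format, OF J(1,2)] ne st by (cases s t rule: linorder_cases) auto
    then have "s < x \<or> x < t" using x by (auto simp: closed_segment_eq_real_ivl)
    then show ?thesis using *[rule_format, OF J(1,3)] *[rule_format, OF J(3,2)] by blast
  qed
qed

lemma slice_segment:
  assumes sp: "spacelike_slice m e c J" and J: "s \<in> J" "t \<in> J" and x: "x \<in> closed_segment s t"
    and st: "snd (c s) < snd (c t)"
  shows "x \<in> J" "snd (c s) \<le> snd (c x)" "snd (c x) \<le> snd (c t)" "fst (c t) \<le> fst (c x)" "fst (c x) \<le> fst (c s)"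
proof -
  have iv: "is_interval J" using sp by (simp add: spacelike_slice_def)
  show xJ: "x \<in> J" using closed_segment_subset[OF J is_interval_convex[OF iv]] x by blast
  have ne: "s \<noteq> t" using st by auto
  from slice_monotone[OF sp]
  have "snd (c s) \<le> snd (c x) \<and> snd (c x) \<le> snd (c t) \<and> fst (c t) \<le> fst (c x) \<and> fst (c x) \<le> fst (c s)"
  proof
    assume *: "V_increasing c J"
    then have "s < t" using *[rule_format, OF J(2,1)] ne st by (cases s t rule: linorder_cases) auto
    then have "s = x \<or> s < x" "x = t \<or> x < t" using x by (auto simp: closed_segment_eq_real_ivl)
    then show ?thesis using *[rule_format, OF J(1) xJ] *[rule_format, OF xJ J(2)] st
      slice_order[OF sp J] by fastforce
  next
    assume *: "V_decreasing c J"
    then have "t < s" using *[rule_format, OF J(1,2)] ne st by (cases s t rule: linorder_cases) auto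
    then have "x = s \<or> x < s" "x = t \<or> t < x" using x by (auto simp: closed_segment_eq_real_ivl)
    then show ?thesis using *[rule_format, OF xJ J(1)] *[rule_format, OF J(2) xJ] st
      slice_order[OF sp J] by fastforce
  qed
  then show "snd (c s) \<le> snd (c x)" "snd (c x) \<le> snd (c t)" "fst (c t) \<le> fst (c x)" "fst (c x) \<le> fst (c s)" by auto
qed

text \<open>The inextendible timelike curves \<open>(s, x + exp s)\<close> etc. stay on one side of a null line, so the
  slice has to reach that side.\<close>

lemma initial_slice_ends:
  assumes sp: "spacelike_slice m e c J" and cau: "cauchy_hypersurface m e (slice c J)"
  shows "\<exists>s\<in>J. snd (c s) > x \<and> fst (c s) < y" "\<exists>s\<in>J. snd (c s) < x \<and> fst (c s) > y"
proof -
  have 1: "\<exists>s\<in>J. snd (c s) > x"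
    using cauchy_hypersurface_hit[OF cau, of "\<lambda>s. s" "\<lambda>s. 1" "\<lambda>s. x + exp s" exp]
    by (force intro!: derivative_eq_intros continuous_intros)
  have 2: "\<exists>s\<in>J. fst (c s) < y"
    using cauchy_hypersurface_hit[OF cau, of "\<lambda>s. y - exp (- s)" "\<lambda>s. exp (- s)" "\<lambda>s. s" "\<lambda>s. 1"]
    by (force intro!: derivative_eq_intros continuous_intros)
  have 3: "\<exists>s\<in>J. snd (c s) < x"
    using cauchy_hypersurface_hit[OF cau, of "\<lambda>s. s" "\<lambda>s. 1" "\<lambda>s. x - exp (- s)" "\<lambda>s. exp (- s)"]
    by (force intro!: derivative_eq_intros continuous_intros)
  have 4: "\<exists>s\<in>J. fst (c s) > y"
    using cauchy_hypersurface_hit[OF cau, of "\<lambda>s. y + exp s" exp "\<lambda>s. s" "\<lambda>s. 1"]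
    by (force intro!: derivative_eq_intros continuous_intros)
  obtain s t where st: "s \<in> J" "t \<in> J" "snd (c s) > x" "fst (c t) < y" using 1 2 by blast
  \<comment> \<open>Of the two points, the one further along the slice satisfies both
    inequalities.\<close>
  then have "snd (c t) > x \<or> fst (c s) < y"
    using slice_order[OF sp st(1,2)] by linarith
  then show "\<exists>s\<in>J. snd (c s) > x \<and> fst (c s) < y" using st by blast
  obtain s t where st: "s \<in> J" "t \<in> J" "snd (c s) < x" "fst (c t) > y" using 3 4 by blast
  then have "snd (c t) < x \<or> fst (c s) > y"
    using slice_order[OF sp st(2,1)] by linarith
  then show "\<exists>s\<in>J. snd (c s) < x \<and> fst (c s) > y" using st by blast
qed

section \<open>Bounds for the weight of a null line on either slice\<close>

subsection \<open>Favourable points on the two slices\<close>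

text \<open>In region \<open>I\<close> the logarithms of \<open>V\<close> and \<open>- U\<close>
  have sum \<open>2 * \<kappa> * r*\<close> and difference \<open>2 * \<kappa> * t\<close>, with
  \<kappa> the constant \<open>kappa_plus\<close>; control of \<open>t\<close> thus becomes a
  comparison of the two logarithms.\<close>

lemma kruskal_of_tr_eq:
  assumes "U < 0" "V > 0"
  shows "kruskal_of_tr m e ((ln V - ln (- U)) / (2 * kappa_plus m e), kruskal_radius m e U V) = (U, V)"
    and "kruskal_F m e (kruskal_radius m e U V)
           = D_RN m e (kruskal_radius m e U V) / ((kappa_plus m e)\<^sup>2 * (- U * V))"
proof -
  let ?k = "kappa_plus m e" and ?r = "kruskal_radius m e U V"
  have k: "?k > 0" by (rule kappa_plus_pos[OF e0 em])
  have neg: "U * V < 0" using assms by (simp add: mult_neg_pos)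
  have P: "kruskal_product m e ?r = U * V"
    unfolding kruskal_radius_krad by (rule kruskal_product_krad)
  have "kruskal_product m e (r_plus m e) = 0" by (simp add: kruskal_product_def)
  then have rp: "r_plus m e < ?r"
    using neg by (intro kruskal_radius_gt[OF r_minus_less_r_plus[OF e0 em]]) simp
  have rm: "r_minus m e < ?r" using rp r_minus_less_r_plus[OF e0 em] by simp
  have "exp (2 * ?k * rstar m e ?r) = - U * V"
    using kruskal_product_rstar[OF e0 em rm] rp P by simp
  then have "2 * ?k * rstar m e ?r = ln (- U * V)" by (metis ln_exp)
  also have "\<dots> = ln (- U) + ln V" using assms by (subst ln_mult) auto
  finally have s: "rstar m e ?r = (ln (- U) + ln V) / (2 * ?k)" using k by (simp add: field_simps)
  have 1: "?k * ((ln V - ln (- U)) / (2 * ?k) + rstar m e ?r) = ln V"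
    and 2: "- ?k * ((ln V - ln (- U)) / (2 * ?k) - rstar m e ?r) = ln (- U)"
    unfolding s using k by (simp_all add: field_simps)
  show "kruskal_of_tr m e ((ln V - ln (- U)) / (2 * ?k), ?r) = (U, V)"
    unfolding kruskal_of_tr_def prod.case 1 2 using assms by simp
  show "kruskal_F m e ?r = D_RN m e ?r / (?k\<^sup>2 * (- U * V))"
    using kruskal_F_eq[OF e0 em rm] rp P by (simp add: field_simps)
qed

text \<open>Since \<open>t\<close> is bounded along the far end, \<open>ln (- U)\<close> grows like \<open>ln V\<close>, so its rate of change cannot
  stay below half of that of \<open>ln V\<close>.\<close>

lemma initial_slice_good_point:
  assumes ini: "initial_slice m e c J"
  shows "\<exists>s\<in>J. snd (c s) > V1 \<and> snd (c s) > 0 \<and>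
    \<bar>dV c s\<bar>
      \<le> 4 * (kappa_plus m e)\<^sup>2 * (snd (c s))\<^sup>2
        * (kruskal_F m e (radius_at c s) * \<bar>dU c s\<bar>)"
proof -
  let ?k = "kappa_plus m e"
  define U V where "U s = fst (c s)" and "V s = snd (c s)" for s
  define U' V' where "U' s = dU c s" and "V' s = dV c s" for s
  have sp: "spacelike_slice m e c J" and cau: "cauchy_hypersurface m e (slice c J)"
    and asy: "asymptotic_to_const_t m e c J" using ini by (auto simp: initial_slice_def)
  have k: "?k > 0" by (rule kappa_plus_pos[OF e0 em])
  obtain t0 R where R: "R > r_plus m e"
    "\<And>t r. r > R \<Longrightarrow> kruskal_of_tr m e (t, r) \<in> c ` J \<Longrightarrow> \<bar>t - t0\<bar> < 1"
    using asy unfolding asymptotic_to_const_t_def by (meson zero_less_one)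
  \<comment> \<open>Beyond \<open>4 * m\<close> the term \<open>2 * m / r\<close> is at most 1 / 2,
    and hence \<open>D\<close> is at least 1 / 2.\<close>
  define R1 where "R1 = max R (4 * m)"
  have R1: "R1 > r_minus m e" "R1 \<ge> R" "R1 \<ge> 4 * m"
    using R(1) r_minus_less_r_plus[OF e0 em] by (auto simp: R1_def)
  \<comment> \<open>\<open>kruskal_product\<close> is decreasing, so a product \<open>U * V\<close>
    below \<open>- Z\<close> forces the radius beyond \<open>R1\<close>; the summand 1 makes the
    comparison strict.\<close>
  define Z where "Z = \<bar>kruskal_product m e R1\<bar> + 1"
  define far where "far s \<longleftrightarrow> s \<in> J \<and> V s > max V1 1 \<and> U s < - Z" for s
  have far: "U s < 0" "V s > 0" "\<bar>ln (V s) - ln (- U s) - 2 * ?k * t0\<bar> < 2 * ?k"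
    "kruskal_F m e (kruskal_radius m e (U s) (V s)) * (2 * ?k\<^sup>2 * (- U s * V s)) \<ge> 1" if "far s" for s
  proof -
    have s: "s \<in> J" "V s > 1" "U s < - Z" using that by (auto simp: far_def)
    have "Z > 0" by (simp add: Z_def add_pos_nonneg)
    then show U0: "U s < 0" and V0: "V s > 0" using s by auto
    have "Z * 1 \<le> - U s * V s" using s \<open>Z > 0\<close> by (intro mult_mono) auto
    moreover have "- Z < kruskal_product m e R1" unfolding Z_def by (simp add: abs_if)
    ultimately have "U s * V s < kruskal_product m e R1" by simp
    from kruskal_radius_gt[OF R1(1) this] have r: "kruskal_radius m e (U s) (V s) > R1" .
    define r where "r = kruskal_radius m e (U s) (V s)"
    have "(U s, V s) \<in> c ` J" using s(1) by (auto simp: U_def V_def)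
    then have "\<bar>(ln (V s) - ln (- U s)) / (2 * ?k) - t0\<bar> < 1"
      using r R1 kruskal_of_tr_eq(1)[OF U0 V0] by (intro R(2)[of "kruskal_radius m e (U s) (V s)"]) auto
    then have "2 * ?k * \<bar>(ln (V s) - ln (- U s)) / (2 * ?k) - t0\<bar> < 2 * ?k * 1" using k by (intro mult_strict_left_mono) auto
    also have "2 * ?k * \<bar>(ln (V s) - ln (- U s)) / (2 * ?k) - t0\<bar> = \<bar>2 * ?k * ((ln (V s) - ln (- U s)) / (2 * ?k) - t0)\<bar>"
      using k by (simp add: abs_mult)
    also have "2 * ?k * ((ln (V s) - ln (- U s)) / (2 * ?k) - t0) = ln (V s) - ln (- U s) - 2 * ?k * t0"
      using k by (simp add: field_simps)
    finally show "\<bar>ln (V s) - ln (- U s) - 2 * ?k * t0\<bar> < 2 * ?k" by simp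
    have r4: "r > 4 * m" "r > 0" using r R1 e0 em unfolding r_def by auto
    have "2 * m / r \<le> 1 / 2" using r4 by (simp add: field_simps)
    then have "D_RN m e r \<ge> 1 / 2" unfolding D_RN_def using zero_le_power2[of e] r4 by (simp add: add_increasing2)
    moreover have "kruskal_F m e r * (2 * ?k\<^sup>2 * (- U s * V s)) = 2 * D_RN m e r"
      using kruskal_of_tr_eq(2)[OF U0 V0] k U0 V0 unfolding r_def[symmetric] by simp
    ultimately show "kruskal_F m e (kruskal_radius m e (U s) (V s)) * (2 * ?k\<^sup>2 * (- U s * V s)) \<ge> 1"
      unfolding r_def by linarith
  qed
  obtain sa where sa: "far sa"
    using initial_slice_ends(1)[OF sp cau, of "max V1 1" "- Z"] unfolding far_def U_def V_def by blast
  \<comment> \<open>On the far part \<open>ln (- U)\<close> equals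
    \<open>ln V - 2 * \<kappa> * t0\<close> up to an error below \<open>2 * \<kappa>\<close>. An
    increase of \<open>ln V\<close> by more than \<open>8 * \<kappa> + 1\<close> outweighs both
    errors and makes \<open>ln (- U) - ln V / 2\<close> grow by more than 1 / 2.\<close>
  obtain sb where sb: "sb \<in> J" "V sb > V sa * exp (8 * ?k + 1)" "U sb < U sa"
    using initial_slice_ends(1)[OF sp cau, of "V sa * exp (8 * ?k + 1)" "U sa"] unfolding U_def V_def by blast
  have "V sa * 1 < V sa * exp (8 * ?k + 1)" using far(2)[OF sa] k by (intro mult_strict_left_mono) auto
  then have Vab: "V sa < V sb" using sb by simp
  have Ja: "sa \<in> J" using sa by (simp add: far_def)
  have fseg: "far s" if "s \<in> closed_segment sa sb" for s
    using slice_segment[OF sp Ja sb(1) that] Vab sa unfolding far_def U_def V_def by auto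
  have fb: "far sb" by (rule fseg) simp
  define h where "h s = ln (- U s) - ln (V s) / 2" for s
  have lnV: "ln (V sb) > ln (V sa) + (8 * ?k + 1)"
  proof -
    have "V sa * exp (8 * ?k + 1) > 0" using far(2)[OF sa] by simp
    then have "ln (V sa * exp (8 * ?k + 1)) < ln (V sb)" using sb(2) by (subst ln_less_cancel_iff) auto
    then show ?thesis using far(2)[OF sa] by (simp add: ln_mult)
  qed
  have hab: "h sa < h sb"
    unfolding h_def using lnV far(3)[OF sa] far(3)[OF fb] by linarith
  have D: "(h has_real_derivative U' s / U s - V' s / V s / 2) (at s)" if s: "s \<in> closed_segment sa sb" for s
  proof -
    have J: "s \<in> J" using fseg[OF s] by (simp add: far_def)
    note d = spacelike_slice_deriv(1)[OF sp J]
    have 1: "(U has_real_derivative U' s) (at s)" "(V has_real_derivative V' s) (at s)"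
      unfolding has_real_derivative_iff_has_vector_derivative U_def[abs_def] V_def[abs_def] U'_def V'_def
      by (rule bounded_linear.has_vector_derivative[OF bounded_linear_fst d]
          bounded_linear.has_vector_derivative[OF bounded_linear_snd d])+
    show ?thesis unfolding h_def[abs_def]
      using far(1,2)[OF fseg[OF s]] by (auto intro!: derivative_eq_intros 1 simp: field_simps)
  qed
  have neg: "U' s * V' s < 0" if "s \<in> J" for s
    unfolding U'_def V'_def by (rule spacelike_slice_deriv(2)[OF sp that])
  \<comment> \<open>Were the opposite inequality true along the whole segment, \<open>h\<close>
    would decrease from \<open>sa\<close> to \<open>sb\<close>, against \<open>hab\<close>.\<close>
  have "\<exists>s\<in>closed_segment sa sb. \<bar>V' s\<bar> / V s \<le> 2 * (\<bar>U' s\<bar> / - U s)"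
  proof (rule ccontr)
    assume "\<not> ?thesis"
    then have no: "\<bar>V' s\<bar> / V s > 2 * (\<bar>U' s\<bar> / - U s)" if "s \<in> closed_segment sa sb" for s
      using that by (meson not_less)
    have inJ: "s \<in> J" if "s \<in> closed_segment sa sb" for s using fseg[OF that] by (simp add: far_def)
    have lin: "p - q / 2 < 0" if "2 * p < q" for p q :: real using that by simp
    from slice_monotone_deriv[OF sp] show False
    proof
      assume A: "V_increasing c J \<and>
         (\<forall>s\<in>J. dV c s > 0 \<and> dU c s < 0)"
      have lt: "sa < sb" using A[THEN conjunct1, rule_format, OF sb(1) Ja] Vab unfolding V_def
        by (cases sa sb rule: linorder_cases) auto
      have "h sb < h sa"
      proof (rule DERIV_neg_imp_decreasing[OF lt])
        fix x assume "sa \<le> x" "x \<le> sb"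
        then have x: "x \<in> closed_segment sa sb" using lt by (simp add: closed_segment_eq_real_ivl)
        have sg: "V' x > 0" "U' x < 0" using A inJ[OF x] by (auto simp: U'_def V'_def)
        have "U' x / U x - V' x / V x / 2 = \<bar>U' x\<bar> / - U x - \<bar>V' x\<bar> / V x / 2" using sg by simp
        also have "\<dots> < 0" by (rule lin[OF no[OF x]])
        finally show "\<exists>d. (h has_real_derivative d) (at x) \<and> d < 0" using D[OF x] by blast
      qed
      then show False using hab by simp
    next
      assume A: "V_decreasing c J \<and>
         (\<forall>s\<in>J. dV c s < 0 \<and> dU c s > 0)"
      have lt: "sb < sa" using A[THEN conjunct1, rule_format, OF Ja sb(1)] Vab unfolding V_def
        by (cases sa sb rule: linorder_cases) auto
      have "h sb < h sa"
      proof (rule DERIV_pos_imp_increasing[OF lt])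
        fix x assume "sb \<le> x" "x \<le> sa"
        then have x: "x \<in> closed_segment sa sb" using lt by (simp add: closed_segment_eq_real_ivl)
        have sg: "V' x < 0" "U' x > 0" using A inJ[OF x] by (auto simp: U'_def V'_def)
        have "U' x / U x - V' x / V x / 2 = - (\<bar>U' x\<bar> / - U x - \<bar>V' x\<bar> / V x / 2)" using sg by simp
        also have "\<dots> > 0" unfolding neg_0_less_iff_less by (rule lin[OF no[OF x]])
        finally show "\<exists>d. (h has_real_derivative d) (at x) \<and> d > 0" using D[OF x] by blast
      qed
      then show False using hab by simp
    qed
  qed
  then obtain s where s: "s \<in> closed_segment sa sb" "\<bar>V' s\<bar> / V s \<le> 2 * (\<bar>U' s\<bar> / - U s)" by blast
  note f = far[OF fseg[OF s(1)]]
  define F where "F = kruskal_F m e (kruskal_radius m e (U s) (V s))"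
  \<comment> \<open>The constant 4 of the claim is the 2 of this rate comparison times the 2 in the
    lower bound for F.\<close>
  have "\<bar>V' s\<bar> * - U s \<le> 2 * V s * \<bar>U' s\<bar>" using s(2) f(1,2) by (simp add: field_simps)
  from mult_mono[OF this f(4)[folded F_def]]
  have "(\<bar>V' s\<bar> * - U s) * 1 \<le> (2 * V s * \<bar>U' s\<bar>) * (F * (2 * ?k\<^sup>2 * (- U s * V s)))"
    using f(2) by simp
  also have "\<dots> = (4 * ?k\<^sup>2 * (V s)\<^sup>2 * (F * \<bar>U' s\<bar>)) * - U s" by (simp add: power2_eq_square)
  finally have "\<bar>V' s\<bar> \<le> 4 * ?k\<^sup>2 * (V s)\<^sup>2 * (F * \<bar>U' s\<bar>)"
    using f(1) by simp
  moreover have "s \<in> J" "V s > V1" "V s > 0" using fseg[OF s(1)] by (auto simp: far_def)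
  ultimately show ?thesis unfolding F_def U_def V_def U'_def V'_def by blast
qed

text \<open>In the \<open>u\<close>-chart the quotient of \<open>\<bar>V'\<bar>\<close> by
  \<open>F * \<bar>U'\<bar>\<close> is \<open>(\<kappa> * V)^2 * g / (D * u')^2\<close>, where
  \<open>g\<close> is the squared length of the extended tangent in the \<open>(u, r)\<close> plane.
  At the horizon \<open>g\<close> stays positive because the extension is spacelike, while
  \<open>D\<close> vanishes, so the quotient exceeds every multiple of \<open>V^2\<close>.\<close>

lemma interior_slice_good_point:
  assumes int: "interior_slice m e c a b" and N: "N > 0"
  shows "\<exists>V1>0. \<forall>x>V1. \<exists>s\<in>{a<..<b}. snd (c s) = x \<and>
     \<bar>dV c s\<bar> \<ge> N * x\<^sup>2
        * (kruskal_F m e (radius_at c s) * \<bar>dU c s\<bar>)"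
proof -
  let ?k = "kappa_plus m e" and ?q = "r_minus m e"
  have k: "?k > 0" by (rule kappa_plus_pos[OF e0 em])
  have ab: "a < b" using int by (simp add: interior_slice_def)
  obtain \<epsilon> q where eps: "\<epsilon> > 0" and sm: "smooth_on {a<..<b+\<epsilon>} q"
    and met: "\<And>s. s \<in> {a<..<b+\<epsilon>} \<Longrightarrow> 0 < metric_ur m e (q s) (vector_derivative q (at s)) (vector_derivative q (at s))"
    and q: "\<And>s. s \<in> {a<..<b} \<Longrightarrow> ?q < snd (q s) \<and> snd (q s) < r_plus m e \<and> c s = kruskal_of_ur m e (q s)"
    and qb: "snd (q b) = ?q"
    using int unfolding interior_slice_def extendible_into_IV_def by blast
  define u r where "u s = fst (q s)" and "r s = snd (q s)" for s
  define u' r' where "u' s = fst (vector_derivative q (at s))" and "r' s = snd (vector_derivative q (at s))" for s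
  define D where "D s = D_RN m e (r s)" for s
  define g where "g s = - D s * (u' s)\<^sup>2 - 2 * u' s * r' s" for s
  have bJ: "b \<in> {a<..<b+\<epsilon>}" using ab eps by simp
  have g0: "g s > 0" if "s \<in> {a<..<b+\<epsilon>}" for s
    using met[OF that] unfolding metric_ur_def g_def D_def u'_def r'_def r_def
    by (simp add: power2_eq_square algebra_simps)
  have cont: "continuous_on {a<..<b+\<epsilon>} u'" "continuous_on {a<..<b+\<epsilon>} r'" "continuous_on {a<..<b+\<epsilon>} u" "continuous_on {a<..<b+\<epsilon>} r"
    unfolding u'_def[abs_def] r'_def[abs_def] u_def[abs_def] r_def[abs_def]
    using smooth_on_curve(2,3)[OF sm] by (auto intro!: continuous_intros)
  have iC: "isCont u' b" "isCont r' b" "isCont u b" "isCont r b"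
    using cont bJ by (auto simp: continuous_on_eq_continuous_at)
  have rb: "r b = ?q" "r b \<noteq> 0" using qb r_minus_pos[OF e0 em] by (auto simp: r_def)
  have Db: "D b = 0" unfolding D_def rb(1) using D_RN_factor[OF e0 em r_minus_pos[OF e0 em]] by simp
  have Dc: "isCont D b" unfolding D_def[abs_def] D_RN_def using iC rb by (intro continuous_intros) auto
  have gc: "isCont g b" unfolding g_def[abs_def] by (intro continuous_intros Dc iC)
  \<comment> \<open>The comparison is written without division by \<open>D * u'\<close>, so that it
    is continuous up to \<open>b\<close>, where \<open>D\<close> is 0.\<close>
  have "((\<lambda>s. ?k\<^sup>2 * g s - N * (D s * u' s)\<^sup>2) \<longlongrightarrow> ?k\<^sup>2 * g b - N * (D b * u' b)\<^sup>2) (at b)"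
    using Dc gc iC by (intro tendsto_intros) (auto simp: isCont_def)
  moreover have "?k\<^sup>2 * g b - N * (D b * u' b)\<^sup>2 > 0" using g0[OF bJ] k Db by simp
  ultimately have ev1: "eventually (\<lambda>s. ?k\<^sup>2 * g s - N * (D s * u' s)\<^sup>2 > 0) (at b)"
    by (rule order_tendstoD(1))
  have "((\<lambda>s. exp (- ?k * u s)) \<longlongrightarrow> exp (- ?k * u b)) (at b)"
    using iC(3) by (intro tendsto_intros) (auto simp: isCont_def)
  then have ev2: "eventually (\<lambda>s. exp (- ?k * u s) < exp (- ?k * u b) + 1) (at b)"
    by (rule order_tendstoD(2)) simp
  obtain d1 where d1: "d1 > 0" "\<And>s. s \<noteq> b \<Longrightarrow> dist s b < d1 \<Longrightarrow> ?k\<^sup>2 * g s - N * (D s * u' s)\<^sup>2 > 0"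
    using ev1 unfolding eventually_at by blast
  obtain d2 where d2: "d2 > 0" "\<And>s. s \<noteq> b \<Longrightarrow> dist s b < d2 \<Longrightarrow> exp (- ?k * u s) < exp (- ?k * u b) + 1"
    using ev2 unfolding eventually_at by blast
  \<comment> \<open>Near \<open>b\<close> the coordinate U stays bounded, since \<open>u\<close> is
    continuous across the horizon.\<close>
  define M where "M = exp (- ?k * u b) + 1"
  have M: "M > 0" by (simp add: M_def add_pos_pos)
  define s1 where "s1 = max ((a + b) / 2) (b - min d1 d2 / 2)"
  have s1: "a < s1" "s1 < b" "dist s b < d1" "dist s b < d2" if "s1 \<le> s" "s < b" for s
    using that ab d1(1) d2(1) unfolding s1_def dist_real_def by (auto simp: min_def max_def split: if_splits)
  have s1b: "a < s1" "s1 < b" using ab d1(1) d2(1) unfolding s1_def by (auto simp: less_max_iff_disj)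
  define U V where "U s = fst (c s)" and "V s = snd (c s)" for s
  have UV: "U s = exp (- ?k * u s)" "V s = exp (?k * (u s + 2 * rstar m e (r s)))" if "s \<in> {a<..<b}" for s
    using q[OF that] unfolding U_def V_def u_def r_def kruskal_of_ur_def by (auto simp: case_prod_beta)
  have rr: "?q < r s" "r s < r_plus m e" "r s \<noteq> r_plus m e" if "s \<in> {a<..<b}" for s using q[OF that] by (auto simp: r_def)
  have prod: "U s * V s = kruskal_product m e (r s)" if "s \<in> {a<..<b}" for s
    using kruskal_product_rstar[OF e0 em rr(1,3)[OF that]] rr(2)[OF that]
    unfolding UV[OF that] by (simp add: algebra_simps flip: exp_add)
  have Fs: "kruskal_F m e (kruskal_radius m e (U s) (V s)) * (?k\<^sup>2 * (U s * V s)) = - D s" "D s < 0"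
    if "s \<in> {a<..<b}" for s
  proof -
    have rad: "kruskal_radius m e (U s) (V s) = r s"
      by (rule kruskal_radius_eqI[OF e0 em rr(1)[OF that]]) (simp add: prod[OF that])
    have "U s \<noteq> 0" "V s \<noteq> 0" unfolding UV[OF that] by simp_all
    then show "kruskal_F m e (kruskal_radius m e (U s) (V s)) * (?k\<^sup>2 * (U s * V s)) = - D s"
      unfolding rad kruskal_F_eq[OF e0 em rr(1,3)[OF that]] prod[OF that, symmetric] D_def using k by simp
    have "r s > 0" using rr(1)[OF that] r_minus_pos[OF e0 em] by linarith
    then show "D s < 0" unfolding D_def D_RN_factor[OF e0 em \<open>r s > 0\<close>]
      using rr[OF that] by (simp add: divide_neg_pos mult_neg_pos)
  qed
  have der: "vector_derivative c (at s) = (- ?k * u' s * U s, ?k * V s * (u' s + 2 * r' s / D s))" if s: "s \<in> {a<..<b}" for s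
  proof -
    have s': "s \<in> {a<..<b+\<epsilon>}" using s eps by auto
    note dq = smooth_on_curve(1)[OF sm s']
    have du: "(u has_real_derivative u' s) (at s)" and dr: "(r has_real_derivative r' s) (at s)"
      unfolding has_real_derivative_iff_has_vector_derivative u_def[abs_def] r_def[abs_def] u'_def r'_def
      by (rule bounded_linear.has_vector_derivative[OF bounded_linear_fst dq]
          bounded_linear.has_vector_derivative[OF bounded_linear_snd dq])+
    have drs: "((\<lambda>s. rstar m e (r s)) has_real_derivative 1 / D s * r' s) (at s)"
      unfolding D_def by (rule DERIV_chain2[OF DERIV_rstar[OF e0 em rr(1,3)[OF s]] dr])
    have dexpU: "((\<lambda>s. exp (- ?k * u s)) has_real_derivative - ?k * u' s * U s) (at s)"
      unfolding UV[OF s] by (auto intro!: derivative_eq_intros du)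
    have dexpV: "((\<lambda>s. exp (?k * (u s + 2 * rstar m e (r s)))) has_real_derivative ?k * V s * (u' s + 2 * r' s / D s)) (at s)"
      unfolding UV[OF s] by (auto intro!: derivative_eq_intros du drs)
    have "((\<lambda>s. (exp (- ?k * u s), exp (?k * (u s + 2 * rstar m e (r s))))) has_vector_derivative
        (- ?k * u' s * U s, ?k * V s * (u' s + 2 * r' s / D s))) (at s)"
      using dexpU dexpV unfolding has_real_derivative_iff_has_vector_derivative by (rule has_vector_derivative_Pair)
    moreover have "(exp (- ?k * u s), exp (?k * (u s + 2 * rstar m e (r s)))) = c s" if "s \<in> {a<..<b}" for s
      using UV[OF that] by (simp add: U_def V_def prod_eq_iff)
    ultimately have "(c has_vector_derivative (- ?k * u' s * U s, ?k * V s * (u' s + 2 * r' s / D s))) (at s)"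
      by (rule has_vector_derivative_transform_within_open[OF _ open_greaterThanLessThan s])
    then show ?thesis by (rule vector_derivative_at)
  qed
  have good: "\<bar>dV c s\<bar> \<ge> N * (V s)\<^sup>2
        * (kruskal_F m e (kruskal_radius m e (U s) (V s)) * \<bar>dU c s\<bar>)"
    if s: "s1 \<le> s" "s < b" for s
  proof -
    have sI: "s \<in> {a<..<b}" using s1(1)[OF s] s by auto
    have sE: "s \<in> {a<..<b+\<epsilon>}" using sI eps by auto
    define F where "F = kruskal_F m e (kruskal_radius m e (U s) (V s))"
    have Dn: "D s < 0" by (rule Fs(2)[OF sI])
    have pos: "U s > 0" "V s > 0" unfolding UV[OF sI] by simp_all
    have FD: "F * (?k\<^sup>2 * (U s * V s)) = \<bar>D s\<bar>" using Fs[OF sI] unfolding F_def by simp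
    have u0: "u' s \<noteq> 0" using g0[OF sE] by (auto simp: g_def)
    \<comment> \<open>The singular term \<open>2 * r' / D\<close> in \<open>V'\<close> is absorbed:
      multiplied by \<open>D * u'\<close> the bracket becomes the regular quantity
      \<open>- g\<close>.\<close>
    have "D s * u' s * (u' s + 2 * r' s / D s) = - g s"
      using Dn by (simp add: g_def field_simps power2_eq_square)
    then have "\<bar>D s\<bar> * \<bar>u' s\<bar> * \<bar>u' s + 2 * r' s / D s\<bar> = g s"
      using g0[OF sE] by (simp flip: abs_mult)
    moreover have "N * (\<bar>D s\<bar> * \<bar>u' s\<bar>)\<^sup>2 \<le> ?k\<^sup>2 * g s"
      using d1(2)[of s] s1(3)[OF s] s by (simp add: power_mult_distrib)
    ultimately have "(\<bar>D s\<bar> * \<bar>u' s\<bar>) * (N * (\<bar>D s\<bar> * \<bar>u' s\<bar>)) \<le> (\<bar>D s\<bar> * \<bar>u' s\<bar>) * (?k\<^sup>2 * \<bar>u' s + 2 * r' s / D s\<bar>)"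
      by (simp add: power2_eq_square mult_ac)
    then have *: "N * (\<bar>D s\<bar> * \<bar>u' s\<bar>) \<le> ?k\<^sup>2 * \<bar>u' s + 2 * r' s / D s\<bar>"
      by (rule mult_left_le_imp_le) (use Dn u0 in \<open>simp add: mult_neg_pos\<close>)
    have "?k * (N * (V s)\<^sup>2 * (F * \<bar>- ?k * u' s * U s\<bar>)) = (N * (F * (?k\<^sup>2 * (U s * V s)) * \<bar>u' s\<bar>)) * V s"
      using k pos by (simp add: abs_mult power2_eq_square mult_ac)
    also have "\<dots> \<le> (?k\<^sup>2 * \<bar>u' s + 2 * r' s / D s\<bar>) * V s"
      unfolding FD using * pos by (intro mult_right_mono) auto
    also have "\<dots> = ?k * \<bar>?k * V s * (u' s + 2 * r' s / D s)\<bar>"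
      using k pos by (simp add: abs_mult power2_eq_square mult_ac)
    finally show ?thesis using k unfolding der[OF sI] F_def[symmetric] by simp
  qed
  \<comment> \<open>As \<open>r\<close> approaches \<open>r_minus\<close> the product
    \<open>U * V\<close> exceeds \<open>x * M\<close>; with U below \<open>M\<close> this forces V
    above \<open>x\<close>. By continuity V then takes every value above
    \<open>V s1\<close>.\<close>
  have large: "\<exists>s. s1 < s \<and> s < b \<and> V s > x" if x: "x > 0" for x
  proof -
    define r1 where "r1 = krad m e (x * M)"
    have r1: "r1 > ?q" "kruskal_product m e r1 = x * M"
      unfolding r1_def by (rule krad_gt kruskal_product_krad)+
    have "eventually (\<lambda>s. r s < r1) (at b)"
      using iC(4) r1(1) rb(1) unfolding isCont_def by (intro order_tendstoD(2)[of r "r b"]) auto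
    then obtain d where d: "d > 0" "\<And>s. s \<noteq> b \<Longrightarrow> dist s b < d \<Longrightarrow> r s < r1" unfolding eventually_at by blast
    define s where "s = max ((s1 + b) / 2) (b - d / 2)"
    have s: "s1 < s" "s < b" "dist s b < d" using s1b d(1) unfolding s_def dist_real_def by (auto simp: max_def field_simps)
    have sI: "s \<in> {a<..<b}" using s s1b by simp
    have "x * M < U s * V s"
      using kruskal_product_strict_antimono[OF rr(1)[OF sI] d(2)[of s]] s r1(2) prod[OF sI] by simp
    also have "\<dots> \<le> M * V s"
      using d2(2)[of s] s1(4)[of s] s UV[OF sI] by (intro mult_right_mono) (auto simp: M_def)
    finally have "V s > x" using M by (simp add: mult.commute)
    then show ?thesis using s by blast
  qed
  have Vpos: "V s1 > 0" using UV(2)[of s1] s1b by simp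
  have "\<exists>s\<in>{a<..<b}. snd (c s) = x \<and>
     \<bar>dV c s\<bar> \<ge> N * x\<^sup>2
        * (kruskal_F m e (radius_at c s) * \<bar>dU c s\<bar>)"
    if x: "x > V s1" for x
  proof -
    obtain s2 where s2: "s1 < s2" "s2 < b" "V s2 > x" using large[of x] x Vpos by auto
    have "spacelike_slice m e c {a<..<b}" using int by (simp add: interior_slice_def)
    then have "continuous_on {a<..<b} c" using spacelike_slice_deriv(4)[of c "{a<..<b}" s1] s1b by simp
    then have "continuous_on {s1..s2} c" by (rule continuous_on_subset) (use s1b s2 in auto)
    then have "continuous_on {s1..s2} V" unfolding V_def[abs_def] by (rule continuous_on_snd)
    then obtain s where s: "s1 \<le> s" "s \<le> s2" "V s = x" using IVT'[of V s1 x s2] x s2 by auto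
    have sI: "s \<in> {a<..<b}" "s < b" using s s1b s2 by simp_all
    show ?thesis
      by (rule bexI[OF _ sI(1)]) (use good[OF s(1) sI(2)] s(3) in \<open>simp add: U_def V_def\<close>)
  qed
  then show ?thesis using Vpos by blast
qed

section \<open>Localised lower and upper bounds for the energy integral\<close>

subsection \<open>Energy estimates\<close>

definition slice_F :: "(real \<Rightarrow> real \<times> real) \<Rightarrow> real \<Rightarrow> real" where
  "slice_F c s = kruskal_F m e (radius_at c s)"

definition null_weights :: "(real \<Rightarrow> real \<times> real) \<Rightarrow> real \<Rightarrow> real \<times> real" where
  "null_weights c s =
     (let U' = dU c s; V' = dV c s; N = sqrt (slice_F c s * \<bar>U' * V'\<bar>)
      in (U'\<^sup>2 / N, V'\<^sup>2 / N))"

text \<open>The number called weight of a null line above: for a function of V alone the weight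
  times the parameter element is \<open>beam_factor\<close> times the element of V. It does not
  depend on the parametrisation of the curve.\<close>

definition beam_factor :: "(real \<Rightarrow> real \<times> real) \<Rightarrow> real \<Rightarrow> real" where
  "beam_factor c s =
     sqrt (\<bar>dV c s\<bar> / (slice_F c s * \<bar>dU c s\<bar>))"

lemma energy_density_weights:
  "energy_density c fU fV s =
     (radius_at c s * fU (fst (c s)) (snd (c s)))\<^sup>2 * fst (null_weights c s)
   + (radius_at c s * fV (fst (c s)) (snd (c s)))\<^sup>2 * snd (null_weights c s)"
  by (simp add: energy_density_def null_weights_def Let_def slice_F_def add_divide_distrib)

lemma slice_F_pos: "slice_F c s > 0"
  unfolding slice_F_def by (rule kruskal_F_radius_pos)

lemma null_weights_facts:
  assumes sp: "spacelike_slice m e c J"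
  shows "continuous_on J (\<lambda>s. fst (null_weights c s))" "continuous_on J (\<lambda>s. snd (null_weights c s))"
    and "fst (null_weights c s) \<ge> 0" "snd (null_weights c s) \<ge> 0"
    and "s \<in> J \<Longrightarrow> snd (null_weights c s) = beam_factor c s * \<bar>dV c s\<bar>"
    and "s \<in> J \<Longrightarrow> beam_factor c s > 0"
proof -
  obtain s0 where "s0 \<in> J" using sp by (auto simp: spacelike_slice_def)
  note cont = spacelike_slice_deriv(3,4)[OF sp this]
  have nz: "dU c s * dV c s \<noteq> 0" if "s \<in> J" for s
    using spacelike_slice_deriv(2)[OF sp that] by (rule less_imp_neq)
  have cF: "continuous_on J (\<lambda>s. slice_F c s)" unfolding slice_F_def
    by (intro C2_0_compose[OF C2_kruskal_F] continuous_intros cont)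
  have n0: "sqrt (slice_F c s * \<bar>dU c s * dV c s\<bar>) \<noteq> 0" if "s \<in> J" for s
    using nz[OF that] slice_F_pos[of c s] by simp
  show "continuous_on J (\<lambda>s. fst (null_weights c s))" "continuous_on J (\<lambda>s. snd (null_weights c s))"
    unfolding null_weights_def Let_def fst_conv snd_conv
    by (intro continuous_intros cont cF ballI n0; assumption)+
  show "fst (null_weights c s) \<ge> 0" "snd (null_weights c s) \<ge> 0"
    unfolding null_weights_def Let_def using slice_F_pos[of c s] by simp_all
  assume s: "s \<in> J"
  show "beam_factor c s > 0" unfolding beam_factor_def using nz[OF s] slice_F_pos[of c s] by simp
  show "snd (null_weights c s) = beam_factor c s * \<bar>dV c s\<bar>"
  proof -
    define x y F where "x = \<bar>dU c s\<bar>" and "y = \<bar>dV c s\<bar>" and "F = slice_F c s"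
    have xy: "x > 0" "y > 0" "F > 0" using nz[OF s] slice_F_pos[of c s] by (auto simp: x_def y_def F_def)
    have "sqrt (y / (F * x)) * y = y\<^sup>2 / sqrt (F * (x * y))"
      using xy by (simp add: real_sqrt_divide real_sqrt_mult field_simps power2_eq_square)
    then show ?thesis unfolding null_weights_def beam_factor_def Let_def x_def y_def F_def by (simp add: abs_mult)
  qed
qed

lemma energy_density_nonneg:
  "energy_density c fU fV s \<ge> 0"
  unfolding energy_density_weights null_weights_def Let_def using slice_F_pos[of c s] by simp

lemma energy_lower_bound:
  assumes sp: "spacelike_slice m e c J" and P: "has_partials f fU fV" and h: "h > 0" "{s0 - h..s0 + h} \<subseteq> J"
    and k: "k \<ge> 0" "\<And>s. s \<in> {s0 - h..s0 + h} \<Longrightarrow> energy_density c fU fV s \<ge> k"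
  shows "energy m e c J (radial f) \<ge> ennreal (k * h * (pi\<^sup>2 / 6))"
proof -
  \<comment> \<open>A box of angles on which the sine is at least 1 / 2. Its volume is
    \<open>h * pi^2 / 3\<close>, half of which gives the constant of the claim.\<close>
  let ?A = "{y::real^3. y $ 1 \<in> {s0 - h..s0 + h} \<and> y $ 2 \<in> {pi / 6..pi / 2} \<and> y $ 3 \<in> {pi / 2..pi}}"
  have em: "emeasure lborel ?A = ennreal (2 * h * (pi / 3) * (pi / 2))" "?A \<in> sets lborel"
    using emeasure_box3[of "s0 - h" "s0 + h" "pi / 6" "pi / 2" "pi / 2" pi] h(1) by simp_all
  have "ennreal (k * h * (pi\<^sup>2 / 6)) = ennreal (k / 2) * ennreal (2 * h * (pi / 3) * (pi / 2))"
    using k h by (simp add: ennreal_mult[symmetric] power2_eq_square)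
  also have "\<dots> = (\<integral>\<^sup>+ y. ennreal (k / 2) * indicator ?A y \<partial>lborel)"
    unfolding em(1)[symmetric] using em(2) by (rule nn_integral_cmult_indicator[symmetric])
  also have "\<dots> \<le> energy m e c J (radial f)"
    unfolding energy_radial[OF sp P]
  proof (rule nn_integral_mono)
    fix y :: "real^3"
    show "ennreal (k / 2) * indicator ?A y \<le> ennreal (energy_density c fU fV (y $ 1) * sin (y $ 2))
        * indicator {y. y $ 1 \<in> J \<and> 0 < y $ 2 \<and> y $ 2 < pi \<and> 0 < y $ 3 \<and> y $ 3 < 2 * pi} y"
    proof (cases "y \<in> ?A")
      case True
      then have y: "y $ 1 \<in> {s0 - h..s0 + h}" "pi / 6 \<le> y $ 2" "y $ 2 \<le> pi / 2" "pi / 2 \<le> y $ 3" "y $ 3 \<le> pi" by auto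
      have "y $ 1 \<in> J" using y(1) h(2) by blast
      moreover have "0 < y $ 2" "y $ 2 < pi" "0 < y $ 3" "y $ 3 < 2 * pi" using y pi_gt_zero by linarith+
      moreover have "sin (pi / 6) \<le> sin (y $ 2)" using y pi_gt_zero by (intro sin_monotone_2pi_le) linarith+
      then have "k * (1 / 2) \<le> energy_density c fU fV (y $ 1) * sin (y $ 2)"
        using k(1) k(2)[OF y(1)] by (intro mult_mono) (auto simp: sin_30)
      ultimately show ?thesis using True by (simp add: ennreal_leI)
    qed simp
  qed
  finally show ?thesis .
qed

text \<open>The density is dominated by a tall part over a short interval, the beam, and a low part
  over a fixed one, the correction. The factor \<open>2 * pi^2\<close> is the area of the rectangle
  of angles, on which the sine is at most 1.\<close>

lemma energy_upper_bound:
  assumes sp: "spacelike_slice m e c J" and P: "has_partials f fU fV" and h: "h \<ge> 0" and pq: "p \<le> q"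
    and k: "k1 \<ge> 0" "k2 \<ge> 0"
    and d: "\<And>s. s \<in> J \<Longrightarrow> energy_density c fU fV s
      \<le> k1 * indicator {s0 - h..s0 + h} s + k2 * indicator {p..q} s"
  shows "energy m e c J (radial f) \<le> ennreal ((k1 * (2 * h) + k2 * (q - p)) * (2 * pi\<^sup>2))"
proof -
  let ?A = "{y::real^3. y $ 1 \<in> {s0 - h..s0 + h} \<and> y $ 2 \<in> {0..pi} \<and> y $ 3 \<in> {0..2 * pi}}"
  let ?B = "{y::real^3. y $ 1 \<in> {p..q} \<and> y $ 2 \<in> {0..pi} \<and> y $ 3 \<in> {0..2 * pi}}"
  have A: "emeasure lborel ?A = ennreal (2 * h * pi * (2 * pi))" "?A \<in> sets lborel"
    using emeasure_box3[of "s0 - h" "s0 + h" 0 pi 0 "2 * pi"] h by simp_all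
  have B: "emeasure lborel ?B = ennreal ((q - p) * pi * (2 * pi))" "?B \<in> sets lborel"
    using emeasure_box3[of p q 0 pi 0 "2 * pi"] pq by simp_all
  have "energy m e c J (radial f) \<le> (\<integral>\<^sup>+ y. (ennreal k1 * indicator ?A y + ennreal k2 * indicator ?B y) \<partial>lborel)"
    unfolding energy_radial[OF sp P]
  proof (rule nn_integral_mono)
    fix y :: "real^3"
    let ?C = "{y::real^3. y $ 1 \<in> J \<and> 0 < y $ 2 \<and> y $ 2 < pi \<and> 0 < y $ 3 \<and> y $ 3 < 2 * pi}"
    show "ennreal (energy_density c fU fV (y $ 1) * sin (y $ 2)) * indicator ?C y
        \<le> ennreal k1 * indicator ?A y + ennreal k2 * indicator ?B y"
    proof (cases "y \<in> ?C")
      case True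
      have "energy_density c fU fV (y $ 1) * sin (y $ 2) \<le> energy_density c fU fV (y $ 1) * 1"
        using energy_density_nonneg by (intro mult_left_mono) auto
      also have "\<dots> \<le> k1 * indicator {s0 - h..s0 + h} (y $ 1) + k2 * indicator {p..q} (y $ 1)"
        using d True by simp
      finally have "ennreal (energy_density c fU fV (y $ 1) * sin (y $ 2))
          \<le> ennreal (k1 * indicator {s0 - h..s0 + h} (y $ 1) + k2 * indicator {p..q} (y $ 1))"
        by (rule ennreal_leI)
      also have "\<dots> = ennreal k1 * indicator ?A y + ennreal k2 * indicator ?B y"
        using True k by (auto simp: indicator_def ennreal_plus)
      finally show ?thesis using True by simp
    qed simp
  qed
  also have "\<dots> = (\<integral>\<^sup>+ y. ennreal k1 * indicator ?A y \<partial>lborel) + (\<integral>\<^sup>+ y. ennreal k2 * indicator ?B y \<partial>lborel)"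
    using A(2) B(2) by (intro nn_integral_add) auto
  also have "\<dots> = ennreal k1 * ennreal (2 * h * pi * (2 * pi)) + ennreal k2 * ennreal ((q - p) * pi * (2 * pi))"
    using nn_integral_cmult_indicator[OF A(2)] nn_integral_cmult_indicator[OF B(2)] A(1) B(1) by simp
  also have "\<dots> = ennreal ((k1 * (2 * h) + k2 * (q - p)) * (2 * pi\<^sup>2))"
  proof -
    have n: "0 \<le> k1 * (2 * h * pi * (2 * pi))" "0 \<le> k2 * ((q - p) * pi * (2 * pi))" using k h pq by simp_all
    have "ennreal k1 * ennreal (2 * h * pi * (2 * pi)) + ennreal k2 * ennreal ((q - p) * pi * (2 * pi))
        = ennreal (k1 * (2 * h * pi * (2 * pi))) + ennreal (k2 * ((q - p) * pi * (2 * pi)))"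
      using k h pq by (simp add: ennreal_mult)
    also have "\<dots> = ennreal (k1 * (2 * h * pi * (2 * pi)) + k2 * ((q - p) * pi * (2 * pi)))"
      by (rule ennreal_plus[OF n, symmetric])
    also have "k1 * (2 * h * pi * (2 * pi)) + k2 * ((q - p) * pi * (2 * pi)) = (k1 * (2 * h) + k2 * (q - p)) * (2 * pi\<^sup>2)"
      by (simp add: power2_eq_square algebra_simps)
    finally show ?thesis .
  qed
  finally show ?thesis .
qed

text \<open>Near \<open>s0\<close> the difference quotient of V and the weight stay within a factor
  2 of their values at \<open>s0\<close>. The two-sided bounds translate between the curve parameter
  and V.\<close>

lemma slice_local:
  assumes sp: "spacelike_slice m e c J" and s0: "s0 \<in> J"
  defines "v \<equiv> \<bar>dV c s0\<bar>"
  shows "v > 0" and "\<exists>\<eta>>0. \<forall>s. \<bar>s - s0\<bar> < \<eta> \<longrightarrow> s \<in> J \<and>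
      \<bar>snd (c s) - snd (c s0)\<bar> \<le> 2 * v * \<bar>s - s0\<bar> \<and> v / 2 * \<bar>s - s0\<bar> \<le> \<bar>snd (c s) - snd (c s0)\<bar> \<and>
      snd (null_weights c s) \<le> 2 * (beam_factor c s0 * v) \<and> beam_factor c s0 * v / 2 \<le> snd (null_weights c s)"
proof -
  have op: "open J" using sp by (simp add: spacelike_slice_def)
  show v: "v > 0" unfolding v_def using spacelike_slice_deriv(2)[OF sp s0] by auto
  have "((\<lambda>s. snd (c s)) has_real_derivative dV c s0) (at s0)"
    unfolding has_real_derivative_iff_has_vector_derivative
    by (rule bounded_linear.has_vector_derivative[OF bounded_linear_snd spacelike_slice_deriv(1)[OF sp s0]])
  then have "((\<lambda>s. (snd (c s) - snd (c s0)) / (s - s0)) \<longlongrightarrow> dV c s0) (at s0)"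
    by (simp add: has_field_derivative_iff)
  from tendsto_rabs[OF this]
  have lim: "((\<lambda>s. \<bar>(snd (c s) - snd (c s0)) / (s - s0)\<bar>) \<longlongrightarrow> v) (at s0)" unfolding v_def .
  let ?W = "\<lambda>s. snd (null_weights c s)"
  have W0: "?W s0 = beam_factor c s0 * v" unfolding v_def by (rule null_weights_facts(5)[OF sp s0])
  have Wp: "beam_factor c s0 * v > 0" using v null_weights_facts(6)[OF sp s0] by simp
  have "isCont ?W s0" using null_weights_facts(2)[OF sp] op s0 by (simp add: continuous_on_eq_continuous_at)
  then have Wl: "(?W \<longlongrightarrow> beam_factor c s0 * v) (at s0)" unfolding isCont_def W0 .
  have "eventually (\<lambda>s. s \<in> J) (at s0)" using eventually_at_in_open'[OF op s0] .
  moreover have "eventually (\<lambda>s. \<bar>(snd (c s) - snd (c s0)) / (s - s0)\<bar> < 2 * v) (at s0)"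
    by (rule order_tendstoD(2)[OF lim]) (use v in simp)
  moreover have "eventually (\<lambda>s. \<bar>(snd (c s) - snd (c s0)) / (s - s0)\<bar> > v / 2) (at s0)"
    by (rule order_tendstoD(1)[OF lim]) (use v in simp)
  moreover have "eventually (\<lambda>s. ?W s < 2 * (beam_factor c s0 * v)) (at s0)"
    using Wp by (intro order_tendstoD(2)[OF Wl]) linarith
  moreover have "eventually (\<lambda>s. ?W s > beam_factor c s0 * v / 2) (at s0)"
    using Wp by (intro order_tendstoD(1)[OF Wl]) linarith
  ultimately have "eventually (\<lambda>s. s \<in> J \<and> \<bar>(snd (c s) - snd (c s0)) / (s - s0)\<bar> < 2 * v \<and>
      \<bar>(snd (c s) - snd (c s0)) / (s - s0)\<bar> > v / 2 \<and> ?W s < 2 * (beam_factor c s0 * v) \<and>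
      ?W s > beam_factor c s0 * v / 2) (at s0)" by eventually_elim blast
  then obtain \<eta> where \<eta>: "\<eta> > 0" "\<And>s. s \<noteq> s0 \<Longrightarrow> dist s s0 < \<eta> \<Longrightarrow> s \<in> J \<and>
      \<bar>(snd (c s) - snd (c s0)) / (s - s0)\<bar> < 2 * v \<and>
      \<bar>(snd (c s) - snd (c s0)) / (s - s0)\<bar> > v / 2 \<and> ?W s < 2 * (beam_factor c s0 * v) \<and>
      ?W s > beam_factor c s0 * v / 2"
    unfolding eventually_at by blast
  have "s \<in> J \<and>
      \<bar>snd (c s) - snd (c s0)\<bar> \<le> 2 * v * \<bar>s - s0\<bar> \<and> v / 2 * \<bar>s - s0\<bar> \<le> \<bar>snd (c s) - snd (c s0)\<bar> \<and>
      ?W s \<le> 2 * (beam_factor c s0 * v) \<and> beam_factor c s0 * v / 2 \<le> ?W s" if "\<bar>s - s0\<bar> < \<eta>" for s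
  proof (cases "s = s0")
    case True
    then show ?thesis using s0 less_imp_le[OF Wp] by (simp add: W0 mult.commute)
  next
    case False
    have "dist s s0 < \<eta>" using that by (simp add: dist_real_def)
    note * = \<eta>(2)[OF False this]
    have "\<bar>s - s0\<bar> > 0" using False by simp
    then show ?thesis using * by (auto simp: abs_divide field_simps)
  qed
  then show "\<exists>\<eta>>0. \<forall>s. \<bar>s - s0\<bar> < \<eta> \<longrightarrow> s \<in> J \<and>
      \<bar>snd (c s) - snd (c s0)\<bar> \<le> 2 * v * \<bar>s - s0\<bar> \<and> v / 2 * \<bar>s - s0\<bar> \<le> \<bar>snd (c s) - snd (c s0)\<bar> \<and>
      snd (null_weights c s) \<le> 2 * (beam_factor c s0 * v) \<and> beam_factor c s0 * v / 2 \<le> snd (null_weights c s)"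
    using \<eta>(1) by blast
qed

text \<open>On a parameter interval of length comparable to \<delta> the derivative of the profile
  has size at least \<open>\<beta> / sqrt \<delta>\<close>, and the correction is at most half of
  that. Squared and integrated, \<delta> drops out.\<close>

lemma beam_energy_lower:
  fixes B C \<beta> \<rho> \<delta> \<eta> :: real
  assumes sp: "spacelike_slice m e c J" and s0: "s0 \<in> J" and P: "has_partials f fU fV"
    and \<beta>: "\<beta> > 0" "\<rho> > 0" "\<And>x. \<bar>x\<bar> \<le> \<rho> \<Longrightarrow> \<bar>bump' x\<bar> \<ge> \<beta>"
    and \<delta>: "\<delta> > 0" "\<rho> * \<delta> / (2 * \<bar>dV c s0\<bar>) \<le> \<eta> / 2" "C * B * \<delta> \<le> \<beta> / 2"
    and \<eta>: "\<eta> > 0" "\<And>s. \<bar>s - s0\<bar> < \<eta> \<Longrightarrow> s \<in> J \<and>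
        \<bar>snd (c s) - snd (c s0)\<bar> \<le> 2 * \<bar>dV c s0\<bar> * \<bar>s - s0\<bar> \<and>
        beam_factor c s0 * \<bar>dV c s0\<bar> / 2 \<le> snd (null_weights c s)"
    and app: "\<And>s. \<bar>s - s0\<bar> \<le> \<eta> / 2 \<Longrightarrow>
        \<bar>radius_at c s * fV (fst (c s)) (snd (c s))
          - bump' ((snd (c s) - snd (c s0)) / \<delta>) / sqrt \<delta>\<bar> \<le> C * (sqrt \<delta> * B)"
  shows "energy m e c J (radial f) \<ge> ennreal (\<beta>\<^sup>2 * \<rho> * pi\<^sup>2 / 96 * beam_factor c s0)"
proof -
  define v A where "v = \<bar>dV c s0\<bar>" and "A = beam_factor c s0"
  have v: "v > 0" unfolding v_def by (rule slice_local(1)[OF sp s0])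
  have A: "A > 0" unfolding A_def by (rule null_weights_facts(6)[OF sp s0])
  \<comment> \<open>V moves at speed at most \<open>2 * v\<close>, so this interval keeps the
    rescaled variable within \<rho>.\<close>
  define h where "h = \<rho> * \<delta> / (2 * v)"
  have h: "h > 0" "h \<le> \<eta> / 2" using v \<beta> \<delta> by (auto simp: h_def v_def)
  define k where "k = A * v / 2 * (\<beta>\<^sup>2 / (4 * \<delta>))"
  have k: "k \<ge> 0" using A v \<delta> by (simp add: k_def)
  have "energy m e c J (radial f) \<ge> ennreal (k * h * (pi\<^sup>2 / 6))"
  proof (rule energy_lower_bound[OF sp P h(1) _ k])
    have near: "\<bar>s - s0\<bar> \<le> h" "\<bar>s - s0\<bar> \<le> \<eta> / 2" "\<bar>s - s0\<bar> < \<eta>" if "s \<in> {s0 - h..s0 + h}" for s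
      using that h \<eta>(1) unfolding atLeastAtMost_iff by linarith+
    show "{s0 - h..s0 + h} \<subseteq> J" using near(3) \<eta>(2) by blast
    fix s assume s: "s \<in> {s0 - h..s0 + h}"
    note n = near[OF s] and loc = \<eta>(2)[OF near(3)[OF s], folded v_def A_def]
    let ?x = "(snd (c s) - snd (c s0)) / \<delta>"
    have "\<bar>snd (c s) - snd (c s0)\<bar> \<le> 2 * v * \<bar>s - s0\<bar>" using loc by blast
    also have "\<dots> \<le> 2 * v * h" using n(1) v by (intro mult_left_mono) auto
    also have "\<dots> = \<rho> * \<delta>" using v by (simp add: h_def)
    finally have "\<bar>?x\<bar> \<le> \<rho>" using \<delta>(1) by (simp add: abs_divide field_simps)
    then have b1: "\<beta> / sqrt \<delta> \<le> \<bar>bump' ?x / sqrt \<delta>\<bar>" using \<beta>(3) \<delta>(1) by (simp add: abs_divide divide_right_mono)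
    have b2: "C * (sqrt \<delta> * B) \<le> \<beta> / sqrt \<delta> / 2"
    proof -
      have "C * (sqrt \<delta> * B) * sqrt \<delta> = C * B * (sqrt \<delta> * sqrt \<delta>)" by (simp only: mult_ac)
      also have "\<dots> = C * B * \<delta>" using \<delta>(1) by simp
      also have "\<dots> \<le> \<beta> / 2" by (rule \<delta>(3))
      finally have "C * (sqrt \<delta> * B) * sqrt \<delta> \<le> \<beta> / 2" .
      then have "C * (sqrt \<delta> * B) \<le> \<beta> / 2 / sqrt \<delta>"
        by (simp only: pos_le_divide_eq[OF real_sqrt_gt_zero[OF \<delta>(1)]])
      also have "\<beta> / 2 / sqrt \<delta> = \<beta> / sqrt \<delta> / 2" by simp
      finally show ?thesis .
    qed
    have tri: "x / 2 \<le> \<bar>z\<bar>" if "x \<le> \<bar>y\<bar>" "d \<le> x / 2" "\<bar>z - y\<bar> \<le> d" for x y z d :: real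
      using that by linarith
    have "\<beta> / sqrt \<delta> / 2 \<le> \<bar>radius_at c s * fV (fst (c s)) (snd (c s))\<bar>"
      by (rule tri[OF b1 b2 app[OF n(2)]])
    from power_mono[OF this, of 2]
    have "(\<beta> / sqrt \<delta> / 2)\<^sup>2 \<le> (radius_at c s * fV (fst (c s)) (snd (c s)))\<^sup>2"
      using \<beta> \<delta> by simp
    moreover have "(\<beta> / sqrt \<delta> / 2)\<^sup>2 = \<beta>\<^sup>2 / (4 * \<delta>)" using \<delta>(1) by (simp add: power_divide)
    ultimately have "A * v / 2 * (\<beta>\<^sup>2 / (4 * \<delta>)) \<le> snd (null_weights c s)
        * (radius_at c s * fV (fst (c s)) (snd (c s)))\<^sup>2"
      using loc A v \<delta>(1) null_weights_facts(4)[OF sp, of s] by (intro mult_mono) auto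
    also have "\<dots> \<le> energy_density c fU fV s"
      unfolding energy_density_weights using null_weights_facts(3)[OF sp, of s] by (simp add: mult.commute)
    finally show "k \<le> energy_density c fU fV s" unfolding k_def .
  qed
  \<comment> \<open>96 is 2 * 4 * 2 * 6: half the weight, the square of half the derivative,
    \<open>2 * v\<close> in \<open>h\<close>, and the factor 6 of the angular bound.\<close>
  also have "k * h * (pi\<^sup>2 / 6) = \<beta>\<^sup>2 * \<rho> * pi\<^sup>2 / 96 * A"
    using v \<delta>(1) by (simp add: k_def h_def)
  finally show ?thesis unfolding A_def .
qed

text \<open>At parameter distance \<open>\<eta> / 2\<close> on either side of \<open>s0\<close>, V
  has already changed by at least \<open>v * \<eta> / 4\<close>. Monotonicity of V along the whole
  slice then keeps every point with a smaller change between these two, so the local bounds apply to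
  all points meeting the beam.\<close>

lemma slice_concentrated:
  assumes sp: "spacelike_slice m e c J" and s0: "s0 \<in> J" and s: "s \<in> J" and v: "v > 0" and \<eta>: "\<eta> > 0"
    and loc: "\<And>s. \<bar>s - s0\<bar> < \<eta> \<Longrightarrow> s \<in> J \<and> v / 2 * \<bar>s - s0\<bar> \<le> \<bar>snd (c s) - snd (c s0)\<bar>"
    and near: "\<bar>snd (c s) - snd (c s0)\<bar> < v * \<eta> / 4"
  shows "\<bar>s - s0\<bar> < \<eta>"
proof -
  have end_bound: "x \<in> J \<and> v * \<eta> / 4 \<le> \<bar>snd (c x) - snd (c s0)\<bar>" if "\<bar>x - s0\<bar> = \<eta> / 2" for x
    using loc[of x] that \<eta> by auto
  have *: "s \<in> closed_segment x y"
    if xy: "\<bar>x - s0\<bar> = \<eta> / 2" "\<bar>y - s0\<bar> = \<eta> / 2" "s0 \<in> closed_segment x y" "snd (c x) < snd (c y)" for x y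
  proof (rule ccontr)
    assume no: "s \<notin> closed_segment x y"
    have J: "x \<in> J" "y \<in> J" using end_bound xy by blast+
    have "snd (c x) \<le> snd (c s0)" "snd (c s0) \<le> snd (c y)"
      using slice_segment[OF sp J xy(3,4)] by auto
    then have "snd (c x) \<le> snd (c s0) - v * \<eta> / 4" "snd (c y) \<ge> snd (c s0) + v * \<eta> / 4"
      using end_bound[OF xy(1)] end_bound[OF xy(2)] by linarith+
    moreover have "snd (c s) < snd (c x) \<or> snd (c s) > snd (c y)"
      using slice_between[OF sp J s no xy(4)] by blast
    ultimately show False using near by linarith
  qed
  let ?x = "s0 - \<eta> / 2" and ?y = "s0 + \<eta> / 2"
  have seg: "s0 \<in> closed_segment ?x ?y" "s0 \<in> closed_segment ?y ?x" using \<eta> by (auto simp: closed_segment_eq_real_ivl)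
  have "snd (c ?x) \<noteq> snd (c ?y)"
  proof -
    have J: "?x \<in> J" "?y \<in> J" using end_bound[of ?x] end_bound[of ?y] \<eta> by auto
    have lt: "?x < ?y" using \<eta> by simp
    from slice_monotone[OF sp] show ?thesis
    proof
      assume "V_increasing c J"
      from this[rule_format, OF J lt] show ?thesis by simp
    next
      assume "V_decreasing c J"
      from this[rule_format, OF J lt] show ?thesis by simp
    qed
  qed
  then have "s \<in> closed_segment ?x ?y \<or> s \<in> closed_segment ?y ?x"
    using *[of ?x ?y] *[of ?y ?x] seg \<eta> by (cases "snd (c ?x)" "snd (c ?y)" rule: linorder_cases) auto
  then show ?thesis using \<eta> by (auto simp: closed_segment_eq_real_ivl abs_less_iff)
qed

section \<open>Rescaled profiles concentrating at one null line, on both slices at once\<close>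

subsection \<open>Concentration along an ingoing null ray\<close>

text \<open>The constants in the three bounds come from the fixed bump only; the slices enter solely
  through \<open>beam_factor\<close>. For this the width is chosen last, after the compact piece of
  the initial slice and the constant of the correction.\<close>

lemma beam:
  fixes B \<beta> \<rho> :: real
  assumes B: "B > 0" "\<And>x. \<bar>bump x\<bar> \<le> B" "\<And>x. \<bar>bump' x\<bar> \<le> B"
    and \<beta>: "\<beta> > 0" "\<rho> > 0" "\<And>x. \<bar>x\<bar> \<le> \<rho> \<Longrightarrow> \<bar>bump' x\<bar> \<ge> \<beta>"
    and sp0: "spacelike_slice m e c0 J" and cau: "cauchy_hypersurface m e (slice c0 J)" and s0: "s0 \<in> J"
    and sp1: "spacelike_slice m e c1 I" and s1: "s1 \<in> I" and eq: "snd (c1 s1) = snd (c0 s0)"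
  shows "\<exists>f fU fV. radial_wave m e f fU fV \<and>
    energy m e c0 J (radial f) \<le> ennreal (128 * pi\<^sup>2 * B\<^sup>2 * beam_factor c0 s0) \<and>
    energy m e c0 J (radial f) \<ge> ennreal (\<beta>\<^sup>2 * \<rho> * pi\<^sup>2 / 96 * beam_factor c0 s0) \<and>
    energy m e c1 I (radial f) \<ge> ennreal (\<beta>\<^sup>2 * \<rho> * pi\<^sup>2 / 96 * beam_factor c1 s1)"
proof -
  define V0 where "V0 = snd (c0 s0)"
  define v0 v1 where "v0 = \<bar>dV c0 s0\<bar>" and "v1 = \<bar>dV c1 s1\<bar>"
  have v: "v0 > 0" "v1 > 0" unfolding v0_def v1_def
    by (rule slice_local(1)[OF sp0 s0] slice_local(1)[OF sp1 s1])+
  define A where "A = beam_factor c0 s0"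
  have A: "A > 0" unfolding A_def by (rule null_weights_facts(6)[OF sp0 s0])
  obtain \<eta>0 where \<eta>0: "\<eta>0 > 0" "\<And>s. \<bar>s - s0\<bar> < \<eta>0 \<Longrightarrow> s \<in> J \<and>
      \<bar>snd (c0 s) - snd (c0 s0)\<bar> \<le> 2 * v0 * \<bar>s - s0\<bar> \<and> v0 / 2 * \<bar>s - s0\<bar> \<le> \<bar>snd (c0 s) - snd (c0 s0)\<bar> \<and>
      snd (null_weights c0 s) \<le> 2 * (A * v0) \<and> A * v0 / 2 \<le> snd (null_weights c0 s)"
    using slice_local(2)[OF sp0 s0] unfolding v0_def A_def by blast
  obtain \<eta>1 where \<eta>1: "\<eta>1 > 0" "\<And>s. \<bar>s - s1\<bar> < \<eta>1 \<Longrightarrow> s \<in> I \<and>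
      \<bar>snd (c1 s) - snd (c1 s1)\<bar> \<le> 2 * v1 * \<bar>s - s1\<bar> \<and>
      beam_factor c1 s1 * v1 / 2 \<le> snd (null_weights c1 s)"
    using slice_local(2)[OF sp1 s1] unfolding v1_def by blast
  \<comment> \<open>Both end points lie in quadrants where the derivatives of the wave packet
    vanish, so only the compact segment between them carries initial energy.\<close>
  obtain sa where sa: "sa \<in> J" "snd (c0 sa) < V0 - 1" "fst (c0 sa) > 1"
    using initial_slice_ends(2)[OF sp0 cau] by blast
  obtain sb where sb: "sb \<in> J" "snd (c0 sb) > V0 + 1" "fst (c0 sb) < 0"
    using initial_slice_ends(1)[OF sp0 cau] by blast
  have ab: "snd (c0 sa) < snd (c0 sb)" using sa sb by simp
  let ?S = "closed_segment sa sb"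
  have SJ: "?S \<subseteq> J" using slice_segment(1)[OF sp0 sa(1) sb(1) _ ab] by blast
  define p q where "p = min sa sb" and "q = max sa sb"
  have pq: "p \<le> q" "?S = {p..q}" by (auto simp: p_def q_def closed_segment_eq_real_ivl)
  have ball: "cball s0 (\<eta>0 / 2) \<subseteq> J" "cball s1 (\<eta>1 / 2) \<subseteq> I"
  proof -
    show "cball s0 (\<eta>0 / 2) \<subseteq> J"
    proof
      fix s assume "s \<in> cball s0 (\<eta>0 / 2)"
      then have "\<bar>s - s0\<bar> < \<eta>0" using \<eta>0(1) by (simp add: dist_real_def abs_minus_commute)
      then show "s \<in> J" using \<eta>0(2) by blast
    qed
    show "cball s1 (\<eta>1 / 2) \<subseteq> I"
    proof
      fix s assume "s \<in> cball s1 (\<eta>1 / 2)"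
      then have "\<bar>s - s1\<bar> < \<eta>1" using \<eta>1(1) by (simp add: dist_real_def abs_minus_commute)
      then show "s \<in> I" using \<eta>1(2) by blast
    qed
  qed
  have c0c: "continuous_on J c0" and c1c: "continuous_on I c1"
    by (rule spacelike_slice_deriv(4)[OF sp0 s0] spacelike_slice_deriv(4)[OF sp1 s1])+
  obtain L1 where L1: "L1 > 0" "\<And>s. s \<in> ?S \<Longrightarrow> \<bar>fst (c0 s)\<bar> \<le> L1 \<and> \<bar>snd (c0 s)\<bar> \<le> L1"
    using compact_slice_bound[OF compact_segment continuous_on_subset[OF c0c SJ]] by blast
  obtain L2 where L2: "L2 > 0" "\<And>s. s \<in> cball s0 (\<eta>0 / 2) \<Longrightarrow> \<bar>fst (c0 s)\<bar> \<le> L2 \<and> \<bar>snd (c0 s)\<bar> \<le> L2"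
    using compact_slice_bound[OF compact_cball continuous_on_subset[OF c0c ball(1)]] by blast
  obtain L3 where L3: "L3 > 0" "\<And>s. s \<in> cball s1 (\<eta>1 / 2) \<Longrightarrow> \<bar>fst (c1 s)\<bar> \<le> L3 \<and> \<bar>snd (c1 s)\<bar> \<le> L3"
    using compact_slice_bound[OF compact_cball continuous_on_subset[OF c1c ball(2)]] by blast
  define L where "L = L1 + L2 + L3"
  have L: "L1 \<le> L" "L2 \<le> L" "L3 \<le> L" using L1(1) L2(1) L3(1) by (auto simp: L_def)
  obtain C where C: "C > 0" "\<And>\<phi> \<phi>' \<mu>. (\<forall>k. C2 k (\<lambda>U V. \<phi> V)) \<and> (\<forall>V. (\<phi> has_real_derivative \<phi>' V) (at V)) \<and>
      (\<forall>V. \<bar>\<phi> V\<bar> \<le> \<mu>) \<and> (\<forall>V. \<bar>V - V0\<bar> \<ge> 1 \<longrightarrow> \<phi> V = 0 \<and> \<phi>' V = 0) \<Longrightarrow>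
    (\<exists>f fU fV. radial_wave m e f fU fV \<and>
      (\<forall>U V. \<bar>U\<bar> \<le> L \<longrightarrow> \<bar>V\<bar> \<le> L \<longrightarrow>
         \<bar>kruskal_radius m e U V * fU U V\<bar> \<le> C * \<mu> \<and> \<bar>kruskal_radius m e U V * fV U V - \<phi>' V\<bar> \<le> C * \<mu>) \<and>
      (\<forall>U V. (U \<le> 0 \<and> V \<ge> V0 + 1) \<or> (U \<ge> 1 \<and> V \<le> V0 - 1) \<longrightarrow> fU U V = 0 \<and> fV U V = 0))"
    using wave_packet[of V0 L] by blast
  let ?X = "\<lambda>s. fst (null_weights c0 s)" and ?W = "\<lambda>s. snd (null_weights c0 s)"
  have XW0: "?X s \<ge> 0" "?W s \<ge> 0" for s using null_weights_facts(3,4)[OF sp0] by auto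
  \<comment> \<open>The weight of the squared correction; the factor 2 comes from bounding the
    square of a sum by twice the sum of squares.\<close>
  obtain Wm where Wm: "Wm > 0" "\<And>s. s \<in> ?S \<Longrightarrow> ?X s + 2 * ?W s \<le> Wm"
  proof -
    have "continuous_on J (\<lambda>s. ?X s + 2 * ?W s)"
      by (intro continuous_on_add continuous_on_mult continuous_on_const null_weights_facts(1,2)[OF sp0])
    then have "continuous_on ?S (\<lambda>s. ?X s + 2 * ?W s)" by (rule continuous_on_subset[OF _ SJ])
    from compact_imp_bounded[OF compact_continuous_image[OF this compact_segment]]
    obtain w where "w > 0" "\<And>x. x \<in> (\<lambda>s. ?X s + 2 * ?W s) ` ?S \<Longrightarrow> norm x \<le> w" unfolding bounded_pos by blast
    then show thesis by (intro that[of w]) (auto simp: abs_le_iff)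
  qed
  \<comment> \<open>In turn: support within distance 1, concentration near \<open>s0\<close>, room
    for the lower bounds on either slice, correction below half the profile, and total energy of the
    correction below that of the beam.\<close>
  have "eventually (\<lambda>\<delta>. \<delta> > 0 \<and> 1 * \<delta> \<le> 1 / 2 \<and> 16 * \<delta> \<le> v0 * \<eta>0 \<and> \<rho> / (2 * v0) * \<delta> \<le> \<eta>0 / 2 \<and> \<rho> / (2 * v1) * \<delta> \<le> \<eta>1 / 2 \<and>
      C * B * \<delta> \<le> \<beta> / 2 \<and> C\<^sup>2 * Wm * (q - p) * \<delta> \<le> 32 * A) (at_right (0::real))"
    using v \<eta>0(1) \<eta>1(1) \<beta>(1) A
    by (intro eventually_conj eventually_small eventually_at_right_less) auto
  then obtain \<delta> where \<delta>: "\<delta> > 0" "\<delta> \<le> 1 / 2" "16 * \<delta> \<le> v0 * \<eta>0" "\<rho> / (2 * v0) * \<delta> \<le> \<eta>0 / 2" "\<rho> / (2 * v1) * \<delta> \<le> \<eta>1 / 2"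
    "C * B * \<delta> \<le> \<beta> / 2" "C\<^sup>2 * Wm * (q - p) * \<delta> \<le> 32 * A"
    by (auto dest!: eventually_happens)
  define \<phi> \<phi>' where "\<phi> = (\<lambda>V. sqrt \<delta> * bump ((V - V0) / \<delta>))" and "\<phi>' = (\<lambda>V. bump' ((V - V0) / \<delta>) / sqrt \<delta>)"
  have sb_facts: "C2 k (\<lambda>U V. \<phi> V)" "(\<phi> has_real_derivative \<phi>' V) (at V)" "\<bar>\<phi> V\<bar> \<le> sqrt \<delta> * B"
    "\<bar>V - V0\<bar> \<ge> 2 * \<delta> \<Longrightarrow> \<phi> V = 0 \<and> \<phi>' V = 0" for k V
    unfolding \<phi>_def \<phi>'_def
    by (rule scaled_bump(1)[OF \<delta>(1,2) B(2)] scaled_bump(2)[OF \<delta>(1,2) B(2)] scaled_bump(3)[OF \<delta>(1,2) B(2)]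
        scaled_bump(4)[OF \<delta>(1,2) B(2)]; assumption?)+
  have "\<phi> V = 0 \<and> \<phi>' V = 0" if "\<bar>V - V0\<bar> \<ge> 1" for V
    using sb_facts(4)[of V] that \<delta>(2) by simp
  then obtain f fU fV where f: "radial_wave m e f fU fV"
    and fb: "\<And>U V. \<bar>U\<bar> \<le> L \<Longrightarrow> \<bar>V\<bar> \<le> L \<Longrightarrow>
         \<bar>kruskal_radius m e U V * fU U V\<bar> \<le> C * (sqrt \<delta> * B) \<and> \<bar>kruskal_radius m e U V * fV U V - \<phi>' V\<bar> \<le> C * (sqrt \<delta> * B)"
    and fs: "\<And>U V. (U \<le> 0 \<and> V \<ge> V0 + 1) \<or> (U \<ge> 1 \<and> V \<le> V0 - 1) \<Longrightarrow> fU U V = 0 \<and> fV U V = 0"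
    using C(2)[of \<phi> \<phi>' "sqrt \<delta> * B"] sb_facts(1,2,3) by blast
  have P: "has_partials f fU fV" using f by (simp add: radial_wave_def)
  have low0: "energy m e c0 J (radial f) \<ge> ennreal (\<beta>\<^sup>2 * \<rho> * pi\<^sup>2 / 96 * beam_factor c0 s0)"
  proof (rule beam_energy_lower[OF sp0 s0 P \<beta> \<delta>(1) _ \<delta>(6) \<eta>0(1)])
    show "\<rho> * \<delta> / (2 * \<bar>dV c0 s0\<bar>) \<le> \<eta>0 / 2"
      using \<delta>(4) unfolding v0_def by simp
    show "s \<in> J \<and> \<bar>snd (c0 s) - snd (c0 s0)\<bar> \<le> 2 * \<bar>dV c0 s0\<bar> * \<bar>s - s0\<bar> \<and>
        beam_factor c0 s0 * \<bar>dV c0 s0\<bar> / 2 \<le> snd (null_weights c0 s)"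
      if "\<bar>s - s0\<bar> < \<eta>0" for s using \<eta>0(2)[OF that] unfolding v0_def A_def by blast
    show "\<bar>radius_at c0 s * fV (fst (c0 s)) (snd (c0 s))
          - bump' ((snd (c0 s) - snd (c0 s0)) / \<delta>) / sqrt \<delta>\<bar> \<le> C * (sqrt \<delta> * B)" if "\<bar>s - s0\<bar> \<le> \<eta>0 / 2" for s
      using fb[of "fst (c0 s)" "snd (c0 s)"] L2(2)[of s] L(2) that unfolding \<phi>'_def V0_def
      by (auto simp: dist_real_def abs_minus_commute)
  qed
  have low1: "energy m e c1 I (radial f) \<ge> ennreal (\<beta>\<^sup>2 * \<rho> * pi\<^sup>2 / 96 * beam_factor c1 s1)"
  proof (rule beam_energy_lower[OF sp1 s1 P \<beta> \<delta>(1) _ \<delta>(6) \<eta>1(1)])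
    show "\<rho> * \<delta> / (2 * \<bar>dV c1 s1\<bar>) \<le> \<eta>1 / 2"
      using \<delta>(5) unfolding v1_def by simp
    show "s \<in> I \<and> \<bar>snd (c1 s) - snd (c1 s1)\<bar> \<le> 2 * \<bar>dV c1 s1\<bar> * \<bar>s - s1\<bar> \<and>
        beam_factor c1 s1 * \<bar>dV c1 s1\<bar> / 2 \<le> snd (null_weights c1 s)"
      if "\<bar>s - s1\<bar> < \<eta>1" for s using \<eta>1(2)[OF that] unfolding v1_def by blast
    show "\<bar>radius_at c1 s * fV (fst (c1 s)) (snd (c1 s))
          - bump' ((snd (c1 s) - snd (c1 s1)) / \<delta>) / sqrt \<delta>\<bar> \<le> C * (sqrt \<delta> * B)" if "\<bar>s - s1\<bar> \<le> \<eta>1 / 2" for s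
      using fb[of "fst (c1 s)" "snd (c1 s)"] L3(2)[of s] L(3) that unfolding \<phi>'_def V0_def eq
      by (auto simp: dist_real_def abs_minus_commute)
  qed
  have up: "energy m e c0 J (radial f) \<le> ennreal (128 * pi\<^sup>2 * B\<^sup>2 * A)"
  proof -
    \<comment> \<open>On the support of the profile V differs from \<open>V0\<close> by less than
      \<open>2 * \<delta>\<close>; at speed at least \<open>v0 / 2\<close> this bounds the parameter
      distance by \<open>h\<close>.\<close>
    define h where "h = 4 * \<delta> / v0"
    define k1 where "k1 = 4 * B\<^sup>2 * A * v0 / \<delta>"
    define k2 where "k2 = (C * (sqrt \<delta> * B))\<^sup>2 * Wm"
    have k: "h \<ge> 0" "k1 \<ge> 0" "k2 \<ge> 0" using v A \<delta>(1) Wm(1) by (auto simp: h_def k1_def k2_def)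
    have dens: "energy_density c0 fU fV s \<le> k1 * indicator {s0 - h..s0 + h} s + k2 * indicator {p..q} s"
      if s: "s \<in> J" for s
    proof (cases "s \<in> ?S")
      case False
      have "fU (fst (c0 s)) (snd (c0 s)) = 0 \<and> fV (fst (c0 s)) (snd (c0 s)) = 0"
        using slice_between[OF sp0 sa(1) sb(1) s False ab] sa sb by (intro fs) auto
      then have "energy_density c0 fU fV s = 0" unfolding energy_density_weights by simp
      then show ?thesis using k by (simp add: indicator_def)
    next
      case True
      let ?d = "C * (sqrt \<delta> * B)" and ?U = "fst (c0 s)" and ?V = "snd (c0 s)"
      let ?r = "kruskal_radius m e ?U ?V"
      have bnd: "\<bar>?U\<bar> \<le> L" "\<bar>?V\<bar> \<le> L" using L1(2)[OF True] L(1) by auto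
      have 1: "(?r * fU ?U ?V)\<^sup>2 \<le> ?d\<^sup>2"
        using fb[OF bnd] by (intro power2_le_iff_abs_le[THEN iffD2]) auto
      have 2: "(?r * fV ?U ?V)\<^sup>2 \<le> 2 * (\<phi>' ?V)\<^sup>2 + 2 * ?d\<^sup>2"
      proof -
        define x where "x = ?r * fV ?U ?V - \<phi>' ?V"
        have "x\<^sup>2 \<le> ?d\<^sup>2" using fb[OF bnd] unfolding x_def by (intro power2_le_iff_abs_le[THEN iffD2]) auto
        moreover have "(?r * fV ?U ?V)\<^sup>2 = (\<phi>' ?V + x)\<^sup>2" by (simp add: x_def)
        moreover have "(\<phi>' ?V + x)\<^sup>2 \<le> 2 * (\<phi>' ?V)\<^sup>2 + 2 * x\<^sup>2"
          using sum_squares_ge_zero[of "\<phi>' ?V - x" 0] by (simp add: power2_eq_square algebra_simps)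
        ultimately show ?thesis by linarith
      qed
      have "energy_density c0 fU fV s \<le> ?d\<^sup>2 * ?X s + (2 * (\<phi>' ?V)\<^sup>2 + 2 * ?d\<^sup>2) * ?W s"
        unfolding energy_density_weights using 1 2 XW0[of s] by (intro add_mono mult_right_mono) auto
      also have "\<dots> = 2 * (\<phi>' ?V)\<^sup>2 * ?W s + ?d\<^sup>2 * (?X s + 2 * ?W s)" by (simp add: algebra_simps)
      also have "\<dots> \<le> 2 * (\<phi>' ?V)\<^sup>2 * ?W s + k2"
        unfolding k2_def using Wm(2)[OF True] by (intro add_left_mono mult_left_mono) auto
      finally have le: "energy_density c0 fU fV s \<le> 2 * (\<phi>' ?V)\<^sup>2 * ?W s + k2" .
      have in_pq: "indicator {p..q} s = (1::real)" using True pq(2) by simp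
      show ?thesis
      proof (cases "\<bar>?V - V0\<bar> \<ge> 2 * \<delta>")
        case True
        then have "\<phi>' ?V = 0" using sb_facts(4) by blast
        then show ?thesis using le k in_pq by (simp add: indicator_def)
      next
        case False
        have near: "\<bar>s - s0\<bar> < \<eta>0"
          using False \<delta>(3) \<eta>0(2) v \<delta>(1) unfolding V0_def
          by (intro slice_concentrated[OF sp0 s0 s v(1) \<eta>0(1)]) auto
        note loc = \<eta>0(2)[OF near]
        have "v0 / 2 * \<bar>s - s0\<bar> \<le> 2 * \<delta>" using loc False unfolding V0_def by linarith
        then have "\<bar>s - s0\<bar> \<le> h" using v by (simp add: h_def field_simps)
        then have ins: "indicator {s0 - h..s0 + h} s = (1::real)" by (auto simp: abs_le_iff)
        have "(\<phi>' ?V)\<^sup>2 \<le> B\<^sup>2 / \<delta>"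
        proof -
          have "(bump' ((?V - V0) / \<delta>))\<^sup>2 \<le> B\<^sup>2" using B(3) B(1) by (intro power2_le_iff_abs_le[THEN iffD2]) auto
          then show ?thesis unfolding \<phi>'_def using \<delta>(1) by (simp add: power_divide divide_right_mono)
        qed
        then have "2 * (\<phi>' ?V)\<^sup>2 * ?W s \<le> 2 * (B\<^sup>2 / \<delta>) * (2 * (A * v0))"
          using loc XW0[of s] \<delta>(1) by (intro mult_mono) auto
        also have "\<dots> = k1" by (simp add: k1_def)
        finally show ?thesis using le ins in_pq by simp
      qed
    qed
    have "energy m e c0 J (radial f) \<le> ennreal ((k1 * (2 * h) + k2 * (q - p)) * (2 * pi\<^sup>2))"
      by (rule energy_upper_bound[OF sp0 P k(1) pq(1) k(2,3) dens])
    also have "\<dots> \<le> ennreal (128 * pi\<^sup>2 * B\<^sup>2 * A)"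
    proof (rule ennreal_leI)
      \<comment> \<open>Beam and correction contribute at most \<open>32 * B^2 * A\<close> each;
        with the angular factor \<open>2 * pi^2\<close> this makes 128.\<close>
      have "k1 * (2 * h) = 32 * B\<^sup>2 * A" using v \<delta>(1) by (simp add: k1_def h_def)
      moreover have "k2 * (q - p) = B\<^sup>2 * (C\<^sup>2 * Wm * (q - p) * \<delta>)"
        using \<delta>(1) by (simp add: k2_def power_mult_distrib)
      moreover have "B\<^sup>2 * (C\<^sup>2 * Wm * (q - p) * \<delta>) \<le> B\<^sup>2 * (32 * A)" using \<delta>(7) by (intro mult_left_mono) auto
      ultimately have "k1 * (2 * h) + k2 * (q - p) \<le> 64 * B\<^sup>2 * A" by linarith
      then have "(k1 * (2 * h) + k2 * (q - p)) * (2 * pi\<^sup>2) \<le> 64 * B\<^sup>2 * A * (2 * pi\<^sup>2)"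
        by (intro mult_right_mono) auto
      then show "(k1 * (2 * h) + k2 * (q - p)) * (2 * pi\<^sup>2) \<le> 128 * pi\<^sup>2 * B\<^sup>2 * A" by (simp add: mult_ac)
    qed
    finally show ?thesis .
  qed
  show ?thesis using f low0 low1 up unfolding A_def by blast
qed

section \<open>Scaling and normalisation of the initial energy\<close>

lemma continuous_on_energy_density:
  assumes sp: "spacelike_slice m e c J" and C: "C2 0 fU" "C2 0 fV"
  shows "continuous_on J (energy_density c fU fV)"
proof -
  obtain s0 where "s0 \<in> J" using sp by (auto simp: spacelike_slice_def)
  from spacelike_slice_deriv(4)[OF sp this]
  have c: "continuous_on J (\<lambda>s. fst (c s))" "continuous_on J (\<lambda>s. snd (c s))" by (auto intro: continuous_intros)
  have "continuous_on J (\<lambda>s. (radius_at c s * fU (fst (c s)) (snd (c s)))\<^sup>2 * fst (null_weights c s)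
   + (radius_at c s * fV (fst (c s)) (snd (c s)))\<^sup>2 * snd (null_weights c s))"
    by (intro continuous_on_add continuous_on_mult continuous_on_power null_weights_facts(1,2)[OF sp]
        C2_0_compose[OF C2_kruskal_radius c] C2_0_compose[OF C(1) c] C2_0_compose[OF C(2) c])
  then show ?thesis unfolding energy_density_weights[symmetric] .
qed

text \<open>The density is quadratic in the derivatives. Moving the constant out of the integral
  requires measurability, which follows from continuity of the density on the open parameter
  domain.\<close>

lemma energy_scale:
  assumes sp: "spacelike_slice m e c J" and f: "radial_wave m e f fU fV"
  shows "energy m e c J (radial (\<lambda>U V. k * f U V)) = ennreal (k\<^sup>2) * energy m e c J (radial f)"
proof -
  have P: "has_partials f fU fV" and f2: "C2 (Suc 0) f" using f by (auto simp: radial_wave_def)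
  have C: "C2 0 fU" "C2 0 fV" by (rule C2_partials[OF P f2])+
  have Pk: "has_partials (\<lambda>U V. k * f U V) (\<lambda>U V. k * fU U V) (\<lambda>U V. k * fV U V)"
    using has_partials_mult[OF has_partials_const[of k] P] by simp
  let ?A = "{y::real^3. y $ 1 \<in> J \<and> 0 < y $ 2 \<and> y $ 2 < pi \<and> 0 < y $ 3 \<and> y $ 3 < 2 * pi}"
  let ?g = "\<lambda>y::real^3. energy_density c fU fV (y $ 1) * sin (y $ 2)"
  have J: "open J" using sp by (simp add: spacelike_slice_def)
  have "open ((\<lambda>y::real^3. y $ 1) -` J)" by (intro open_vimage J continuous_intros)
  then have "open {y::real^3. y $ 1 \<in> J}" by (simp add: vimage_def)
  then have A: "?A \<in> sets borel"
    by (intro borel_open open_Collect_conj open_Collect_less continuous_intros)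
  have "continuous_on ?A (\<lambda>y. energy_density c fU fV (y $ 1))"
    by (rule continuous_on_compose2[OF continuous_on_energy_density[OF sp C]]) (auto intro!: continuous_intros)
  then have "continuous_on ?A ?g" by (intro continuous_intros)
  then have "(\<lambda>y. indicator ?A y *\<^sub>R ?g y) \<in> borel_measurable borel"
    by (rule borel_measurable_continuous_on_indicator[OF A])
  then have "(\<lambda>y. ennreal (indicator ?A y *\<^sub>R ?g y)) \<in> borel_measurable lborel" by simp
  moreover have "ennreal (indicator ?A y *\<^sub>R ?g y) = ennreal (?g y) * indicator ?A y" for y
    by (simp add: indicator_def)
  ultimately have meas: "(\<lambda>y. ennreal (?g y) * indicator ?A y) \<in> borel_measurable lborel" by simp
  have "energy_density c (\<lambda>U V. k * fU U V) (\<lambda>U V. k * fV U V) s = k\<^sup>2 * energy_density c fU fV s" for s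
    unfolding energy_density_weights by (simp add: power_mult_distrib algebra_simps)
  then have "energy m e c J (radial (\<lambda>U V. k * f U V)) = (\<integral>\<^sup>+ y. ennreal (k\<^sup>2) * (ennreal (?g y) * indicator ?A y) \<partial>lborel)"
    unfolding energy_radial[OF sp Pk]
    by (intro nn_integral_cong) (simp add: ennreal_mult' mult.assoc)
  also have "\<dots> = ennreal (k\<^sup>2) * energy m e c J (radial f)"
    unfolding energy_radial[OF sp P] by (rule nn_integral_cmult[OF meas])
  finally show ?thesis .
qed

lemma radial_wave_scale:
  assumes "radial_wave m e f fU fV"
  shows "radial_wave m e (\<lambda>U V. k * f U V) (\<lambda>U V. k * fU U V) (\<lambda>U V. k * fV U V)"
  unfolding radial_wave_def
proof (intro conjI allI)
  show "C2 n (\<lambda>U V. k * f U V)" for n using assms by (intro C2_mult C2_const) (simp add: radial_wave_def)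
  show "has_partials (\<lambda>U V. k * f U V) (\<lambda>U V. k * fU U V) (\<lambda>U V. k * fV U V)"
    using has_partials_mult[OF has_partials_const[of k], of f fU fV] assms by (simp add: radial_wave_def)
  fix U V
  obtain X where X: "((\<lambda>U. (kruskal_radius m e U V)\<^sup>2 * fV U V) has_real_derivative X) (at U)"
    "((\<lambda>V. (kruskal_radius m e U V)\<^sup>2 * fU U V) has_real_derivative - X) (at V)"
    using assms unfolding radial_wave_def by blast
  show "\<exists>X. ((\<lambda>U. (kruskal_radius m e U V)\<^sup>2 * (k * fV U V)) has_real_derivative X) (at U) \<and>
       ((\<lambda>V. (kruskal_radius m e U V)\<^sup>2 * (k * fU U V)) has_real_derivative - X) (at V)"
    using DERIV_cmult[OF X(1), of k] DERIV_cmult[OF X(2), of k]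
    by (intro exI[of _ "k * X"]) (simp add: mult.left_commute)
qed

text \<open>A beam on a suitable null line is divided by the root of its initial energy. The upper
  bound for that energy makes it finite and limits the division; the lower one makes it
  positive.\<close>

lemma large_energy_solution:
  assumes ini: "initial_slice m e c0 J" and int: "interior_slice m e c1 a b" and K: "K > 0"
  shows "\<exists>u. wave_solution m e u \<and> energy m e c0 J u = 1 \<and> energy m e c1 {a<..<b} u \<ge> ennreal K"
proof -
  have sp0: "spacelike_slice m e c0 J" and cau: "cauchy_hypersurface m e (slice c0 J)"
    using ini by (auto simp: initial_slice_def)
  have sp1: "spacelike_slice m e c1 {a<..<b}" using int by (simp add: interior_slice_def)
  obtain B where B: "B > 0" "\<And>x. \<bar>bump x\<bar> \<le> B" "\<And>x. \<bar>bump' x\<bar> \<le> B" using bump_bounded by blast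
  obtain \<rho> \<beta> where \<beta>: "\<rho> > 0" "\<beta> > 0" "\<And>x. \<bar>x\<bar> \<le> \<rho> \<Longrightarrow> \<bar>bump' x\<bar> \<ge> \<beta>" using bump'_lower by blast
  let ?k = "kappa_plus m e"
  have k: "?k > 0" by (rule kappa_plus_pos[OF e0 em])
  define up lo where "up = 128 * pi\<^sup>2 * B\<^sup>2" and "lo = \<beta>\<^sup>2 * \<rho> * pi\<^sup>2 / 96"
  have ul: "up > 0" "lo > 0" using B \<beta> by (auto simp: up_def lo_def)
  \<comment> \<open>Chosen so that \<open>lo * (M * x)\<close> equals
    \<open>K * (up * (2 * \<kappa> * x))\<close>: the unknown value \<open>x\<close> of V cancels,
    so \<open>M\<close> can be fixed before the null line.\<close>
  define M where "M = K * up * (2 * ?k) / lo"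
  have M: "M > 0" using K ul k by (simp add: M_def)
  \<comment> \<open>The interior slice supplies a threshold beyond which every V is good; the
    initial slice then supplies one good V beyond it.\<close>
  obtain V1 where V1: "V1 > 0" "\<And>x. x > V1 \<Longrightarrow> \<exists>s\<in>{a<..<b}. snd (c1 s) = x \<and>
     \<bar>dV c1 s\<bar> \<ge> M\<^sup>2 * x\<^sup>2
        * (kruskal_F m e (radius_at c1 s) * \<bar>dU c1 s\<bar>)"
    using interior_slice_good_point[OF int, of "M\<^sup>2"] M by auto
  obtain s0 where s0: "s0 \<in> J" "snd (c0 s0) > V1" "snd (c0 s0) > 0"
    "\<bar>dV c0 s0\<bar> \<le> 4 * ?k\<^sup>2 * (snd (c0 s0))\<^sup>2
        * (kruskal_F m e (radius_at c0 s0) * \<bar>dU c0 s0\<bar>)"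
    using initial_slice_good_point[OF ini] by blast
  define x where "x = snd (c0 s0)"
  have x: "x > 0" using s0(3) by (simp add: x_def)
  obtain s1 where s1: "s1 \<in> {a<..<b}" "snd (c1 s1) = x"
     "\<bar>dV c1 s1\<bar> \<ge> M\<^sup>2 * x\<^sup>2
        * (kruskal_F m e (radius_at c1 s1) * \<bar>dU c1 s1\<bar>)"
    using V1(2)[of x] s0(2) unfolding x_def by blast
  define A0 A1 where "A0 = beam_factor c0 s0" and "A1 = beam_factor c1 s1"
  have A0: "A0 > 0" unfolding A0_def by (rule null_weights_facts(6)[OF sp0 s0(1)])
  have nz: "dU c0 s0 \<noteq> 0" "dU c1 s1 \<noteq> 0"
    using spacelike_slice_deriv(2)[OF sp0 s0(1)] spacelike_slice_deriv(2)[OF sp1 s1(1)] by auto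
  have "A0 \<le> 2 * ?k * x"
    unfolding A0_def beam_factor_def
  proof (rule real_le_lsqrt)
    show "\<bar>dV c0 s0\<bar> / (slice_F c0 s0 * \<bar>dU c0 s0\<bar>) \<le> (2 * ?k * x)\<^sup>2"
      using s0(4) slice_F_pos[of c0 s0] nz(1) unfolding x_def slice_F_def[symmetric]
      by (simp add: pos_divide_le_eq power_mult_distrib)
  qed (use k x in auto)
  have A1: "M * x \<le> A1"
    unfolding A1_def beam_factor_def
  proof (rule real_le_rsqrt)
    show "(M * x)\<^sup>2 \<le> \<bar>dV c1 s1\<bar> / (slice_F c1 s1 * \<bar>dU c1 s1\<bar>)"
      using s1(3) slice_F_pos[of c1 s1] nz(2) unfolding slice_F_def[symmetric]
      by (simp add: pos_le_divide_eq power_mult_distrib)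
  qed
  have ratio: "K * (up * A0) \<le> lo * A1"
  proof -
    have "K * (up * A0) \<le> K * (up * (2 * ?k * x))" using \<open>A0 \<le> 2 * ?k * x\<close> K ul by (intro mult_left_mono) auto
    also have "\<dots> = lo * (M * x)" using ul by (simp add: M_def)
    also have "\<dots> \<le> lo * A1" using A1 ul by (intro mult_left_mono) auto
    finally show ?thesis .
  qed
  obtain f fU fV where f: "radial_wave m e f fU fV"
    and E: "energy m e c0 J (radial f) \<le> ennreal (up * A0)" "energy m e c0 J (radial f) \<ge> ennreal (lo * A0)"
      "energy m e c1 {a<..<b} (radial f) \<ge> ennreal (lo * A1)"
    using beam[OF B \<beta>(2,1,3) sp0 cau s0(1) sp1 s1(1)] s1(2) unfolding x_def up_def lo_def A0_def A1_def by blast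
  define E0 where "E0 = enn2real (energy m e c0 J (radial f))"
  have "energy m e c0 J (radial f) < \<infinity>" using E(1) by (rule le_less_trans) simp
  then have E0: "energy m e c0 J (radial f) = ennreal E0" by (simp add: E0_def)
  have E0n: "E0 \<ge> 0" by (simp add: E0_def)
  have "lo * A0 \<le> E0" "E0 \<le> up * A0"
    using E(1,2) ul A0 E0n unfolding E0 by (simp_all add: ennreal_le_iff)
  moreover have "lo * A0 > 0" using ul A0 by simp
  ultimately have E0p: "E0 > 0" and E0u: "E0 \<le> up * A0" by linarith+
  define c where "c = 1 / sqrt E0"
  have c2: "c\<^sup>2 = 1 / E0" using E0p by (simp add: c_def power_divide)
  let ?u = "radial (\<lambda>U V. c * f U V)"
  have "wave_solution m e ?u" by (rule wave_solution_radial[OF radial_wave_scale[OF f]])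
  moreover have "energy m e c0 J ?u = 1"
    unfolding energy_scale[OF sp0 f] E0 c2 using E0p by (simp add: ennreal_mult[symmetric])
  moreover have "energy m e c1 {a<..<b} ?u \<ge> ennreal K"
  proof -
    have "K \<le> 1 / E0 * (lo * A1)"
    proof -
      have "K * E0 \<le> K * (up * A0)" using E0u K by (intro mult_left_mono) auto
      then have "K * E0 \<le> lo * A1" using ratio by (rule order_trans)
      then show ?thesis using E0p by (simp add: field_simps)
    qed
    then have "ennreal K \<le> ennreal (1 / E0 * (lo * A1))" by (rule ennreal_leI)
    also have "\<dots> = ennreal (1 / E0) * ennreal (lo * A1)" by (rule ennreal_mult') (use E0p in simp)
    also have "\<dots> \<le> ennreal (1 / E0) * energy m e c1 {a<..<b} (radial f)" using E(3) by (rule mult_left_mono) simp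
    also have "\<dots> = energy m e c1 {a<..<b} ?u" unfolding energy_scale[OF sp1 f] c2 ..
    finally show ?thesis .
  qed
  ultimately show ?thesis by blast
qed

end

theorem theorem3p7:
  fixes m e :: real
    and c\<^sub>0 c\<^sub>1 :: "real \<Rightarrow> real \<times> real"
    and J :: "real set"
    and a b :: real
  assumes "0 < e" and "e < m"
    and "initial_slice m e c\<^sub>0 J"
    and "interior_slice m e c\<^sub>1 a b"
    and "slice c\<^sub>1 {a<..<b} \<subseteq> chronological_future m e (slice c\<^sub>0 J)"
  shows "\<exists>u :: nat \<Rightarrow> event \<Rightarrow> complex.
           (\<forall>i. wave_solution m e (u i) \<and> energy m e c\<^sub>0 J (u i) = 1) \<and>
           (\<lambda>i. energy m e c\<^sub>1 {a<..<b} (u i)) \<longlonglongrightarrow> \<infinity>"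
proof -
  \<comment> \<open>\<open>Suc i\<close> instead of \<open>i\<close> keeps the required energy bound
    positive for \<open>i = 0\<close>.\<close>
  have "\<forall>i::nat. \<exists>u. wave_solution m e u \<and> energy m e c\<^sub>0 J u = 1 \<and>
      energy m e c\<^sub>1 {a<..<b} u \<ge> ennreal (real (Suc i))"
    by (intro allI large_energy_solution[OF assms(1-4)]) simp
  then obtain u where u: "\<And>i. wave_solution m e (u i) \<and> energy m e c\<^sub>0 J (u i) = 1 \<and>
      energy m e c\<^sub>1 {a<..<b} (u i) \<ge> ennreal (real (Suc i))" by metis
  have "(\<lambda>i. of_nat (Suc i) :: ennreal) \<longlonglongrightarrow> \<infinity>"
    by (rule LIMSEQ_Suc[OF of_nat_tendsto_top_ennreal[unfolded infinity_ennreal_def[symmetric]]])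
  then have "(\<lambda>i. energy m e c\<^sub>1 {a<..<b} (u i)) \<longlonglongrightarrow> \<infinity>"
    unfolding infinity_ennreal_def
    by (rule tendsto_sandwich[OF _ _ _ tendsto_const, rotated 2])
      (use u in \<open>simp_all add: ennreal_of_nat_eq_real_of_nat del: of_nat_Suc\<close>)
  with u show ?thesis by blast
qed

end
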